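(* Let $M$ be a finitely generated commutative monoid and $X$ a bounded-to-one Borel $M$-set. Then $\operatorname{asdim}_B(M\curvearrowright X)=\operatorname{asdim}(M\curvearrowright X)$.
   Context: A Borel $M$-set is a standard Borel space $X$ with an action of $M$ such that each map $x\mapsto mx$ is Borel. It is bounded-to-one if for every $m\in M$ there is $k_m\in\mathbb N$ bounding the size of every fiber of $x\mapsto mx$. For $R\subseteq M$, the Schreier graph $G_R^X$ is the graph on $X$ in which distinct points $x,y$ are adjacent iff $y=rx$ or $x=ry$ for some $r\in R$. For a graph $G$ on $X$, $\rho_G$ is the path metric (infinite between different components) and $B_G(x,s)$ the ball of radius $s$ about $x$. For $G$ locally finite and $s,d\in\mathbb N$, an uncolored dimension $d$ witness at scale $s$ is a function $f:X\to X$ with $\sup_x\rho_G(x,f(x))<\infty$ and $|f[B_G(x,s)]|\le d+1$ for all $x$; if $G$ is a Borel graph on a standard Borel space, the witness is Borel if $f$ is Borel. $\operatorname{asdim}(G)$ (resp. $\operatorname{asdim}_B(G)$) is the least $d$ such that for every $s\in\mathbb N$ there is an uncolored (resp. Borel uncolored) dimension $d$ witness at scale $s$, and $\infty$ if there is no such $d$. For $M$ finitely generated, $\operatorname{asdim}(M\curvearrowright X)$ and $\operatorname{asdim}_B(M\curvearrowright X)$ are the values of these parameters for $G_R^X$, where $R$ is any finite generating set of $M$ (the values do not depend on $R$). *)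

theory Defs
  imports "HOL-Analysis.Analysis" "HOL-Algebra.Group"
begin

section \<open>Standard Borel spaces and Borel actions of monoids\<close>

text \<open>A measurable space is given by a value of type \<^typ>\<open>'x measure\<close>; only the carrier and
  the \<open>\<sigma>\<close>-algebra are used, the measure component plays no role.\<close>

definition standard_borel :: "'x measure \<Rightarrow> bool" where
  "standard_borel X \<longleftrightarrow>
     (\<exists>T. topspace T = space X \<and> completely_metrizable_space T \<and> separable_space T \<and>
          sets X = sigma_sets (space X) {U. openin T U})"

definition finitely_generates :: "('m, 'b) monoid_scheme \<Rightarrow> 'm set \<Rightarrow> bool" where
  "finitely_generates M R \<longleftrightarrow>
     finite R \<and> R \<subseteq> carrier M \<and> \<Inter>{H. submonoid H M \<and> R \<subseteq> H} = carrier M"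

definition finitely_generated :: "('m, 'b) monoid_scheme \<Rightarrow> bool" where
  "finitely_generated M \<longleftrightarrow> (\<exists>R. finitely_generates M R)"

locale borel_monoid_set = monoid M for M (structure) +
  fixes act :: "'a \<Rightarrow> 'x \<Rightarrow> 'x" and X :: "'x measure"
  assumes standard_borel: "standard_borel X"
    and act_measurable: "m \<in> carrier M \<Longrightarrow> act m \<in> X \<rightarrow>\<^sub>M X"
    and act_one: "x \<in> space X \<Longrightarrow> act \<one> x = x"
    and act_mult: "\<lbrakk>m \<in> carrier M; n \<in> carrier M; x \<in> space X\<rbrakk>
                    \<Longrightarrow> act (m \<otimes> n) x = act m (act n x)"

definition bounded_to_one ::
    "('m, 'b) monoid_scheme \<Rightarrow> ('m \<Rightarrow> 'x \<Rightarrow> 'x) \<Rightarrow> 'x measure \<Rightarrow> bool" where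
  "bounded_to_one M act X \<longleftrightarrow>
     (\<forall>m\<in>carrier M. \<exists>k::nat. \<forall>y\<in>space X.
        finite {x \<in> space X. act m x = y} \<and> card {x \<in> space X. act m x = y} \<le> k)"


section \<open>Graphs and asymptotic dimension\<close>

text \<open>A graph on a vertex set is represented by its symmetric irreflexive set of (ordered)
  adjacent pairs.\<close>

definition schreier_graph :: "'m set \<Rightarrow> ('m \<Rightarrow> 'x \<Rightarrow> 'x) \<Rightarrow> 'x set \<Rightarrow> ('x \<times> 'x) set" where
  "schreier_graph R act V =
     {(x, y) \<in> V \<times> V. x \<noteq> y \<and> (\<exists>r\<in>R. y = act r x \<or> x = act r y)}"

definition path_dist :: "('x \<times> 'x) set \<Rightarrow> 'x \<Rightarrow> 'x \<Rightarrow> enat" where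
  "path_dist E x y = (if \<exists>n. (x, y) \<in> E ^^ n then enat (LEAST n. (x, y) \<in> E ^^ n) else \<infinity>)"

definition graph_ball :: "'x set \<Rightarrow> ('x \<times> 'x) set \<Rightarrow> 'x \<Rightarrow> nat \<Rightarrow> 'x set" where
  "graph_ball V E x s = {y \<in> V. path_dist E x y \<le> enat s}"

text \<open>The finiteness clause is part of the cardinality bound: \<^const>\<open>card\<close> is 0 on infinite sets.\<close>

definition uncolored_witness ::
    "'x set \<Rightarrow> ('x \<times> 'x) set \<Rightarrow> nat \<Rightarrow> nat \<Rightarrow> ('x \<Rightarrow> 'x) \<Rightarrow> bool" where
  "uncolored_witness V E d s f \<longleftrightarrow>
     f \<in> V \<rightarrow> V \<and> (SUP x\<in>V. path_dist E x (f x)) < \<infinity> \<and>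
     (\<forall>x\<in>V. finite (f ` graph_ball V E x s) \<and> card (f ` graph_ball V E x s) \<le> d + 1)"

definition least_enat :: "(nat \<Rightarrow> bool) \<Rightarrow> enat" where
  "least_enat P = (if \<exists>d. P d then enat (LEAST d. P d) else \<infinity>)"

text \<open>Both notions are meant for locally finite graphs.\<close>

definition asdim :: "'x set \<Rightarrow> ('x \<times> 'x) set \<Rightarrow> enat" where
  "asdim V E = least_enat (\<lambda>d. \<forall>s. \<exists>f. uncolored_witness V E d s f)"

definition borel_asdim :: "'x measure \<Rightarrow> ('x \<times> 'x) set \<Rightarrow> enat" where
  "borel_asdim X E =
     least_enat (\<lambda>d. \<forall>s. \<exists>f. f \<in> X \<rightarrow>\<^sub>M X \<and> uncolored_witness (space X) E d s f)"

text \<open>For an action, an arbitrary finite generating set is chosen; the lemmas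
  \<open>asdim_action_eq\<close> and \<open>borel_asdim_action_eq\<close> below show that, for Borel actions, every finite generating set
  gives the same value.\<close>

definition asdim_action ::
    "('m, 'b) monoid_scheme \<Rightarrow> ('m \<Rightarrow> 'x \<Rightarrow> 'x) \<Rightarrow> 'x measure \<Rightarrow> enat" where
  "asdim_action M act X =
     asdim (space X) (schreier_graph (SOME R. finitely_generates M R) act (space X))"

definition borel_asdim_action ::
    "('m, 'b) monoid_scheme \<Rightarrow> ('m \<Rightarrow> 'x \<Rightarrow> 'x) \<Rightarrow> 'x measure \<Rightarrow> enat" where
  "borel_asdim_action M act X =
     borel_asdim X (schreier_graph (SOME R. finitely_generates M R) act (space X))"


section \<open>Independence of the generating set\<close>

lemma path_dist_le_iff: "path_dist E x y \<le> enat n \<longleftrightarrow> (\<exists>k\<le>n. (x, y) \<in> E ^^ k)"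
proof
  assume "path_dist E x y \<le> enat n"
  then have ex: "\<exists>k. (x, y) \<in> E ^^ k" and "(LEAST k. (x, y) \<in> E ^^ k) \<le> n"
    by (auto simp: path_dist_def split: if_splits)
  then show "\<exists>k\<le>n. (x, y) \<in> E ^^ k" using LeastI_ex[OF ex] by blast
next
  assume "\<exists>k\<le>n. (x, y) \<in> E ^^ k"
  then obtain k where "k \<le> n" "(x, y) \<in> E ^^ k" by blast
  then show "path_dist E x y \<le> enat n"
    using Least_le[of "\<lambda>k. (x, y) \<in> E ^^ k" k] by (auto simp: path_dist_def)
qed

lemma relpow_coarse:
  fixes E E' :: "('x \<times> 'x) set"
  assumes "\<And>x y. (x, y) \<in> E' \<Longrightarrow> \<exists>k\<le>C. (x, y) \<in> E ^^ k"
  shows "(x, y) \<in> E' ^^ n \<Longrightarrow> \<exists>k\<le>C * n. (x, y) \<in> E ^^ k"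
proof (induction n arbitrary: y)
  case 0
  then show ?case by auto
next
  case (Suc n)
  then obtain z where "(x, z) \<in> E' ^^ n" "(z, y) \<in> E'" by auto
  then obtain k l where "k \<le> C * n" "(x, z) \<in> E ^^ k" "l \<le> C" "(z, y) \<in> E ^^ l"
    using Suc.IH assms by blast
  then show ?case
    by (intro exI[of _ "k + l"]) (auto simp: relpow_add)
qed

lemma SUP_enat_finite_iff: "(SUP x\<in>V. g x) < (\<infinity>::enat) \<longleftrightarrow> (\<exists>c. \<forall>x\<in>V. g x \<le> enat c)"
proof
  assume "(SUP x\<in>V. g x) < \<infinity>"
  then obtain c where c: "(SUP x\<in>V. g x) = enat c" by (metis enat_ord_simps(4) not_enat_eq)
  have "\<forall>x\<in>V. g x \<le> enat c" unfolding c[symmetric] by (simp add: SUP_upper)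
  then show "\<exists>c. \<forall>x\<in>V. g x \<le> enat c" ..
next
  assume "\<exists>c. \<forall>x\<in>V. g x \<le> enat c"
  then obtain c where "\<forall>x\<in>V. g x \<le> enat c" ..
  then have "(SUP x\<in>V. g x) \<le> enat c" by (simp add: SUP_least)
  then show "(SUP x\<in>V. g x) < \<infinity>" using order.strict_trans1 enat_ord_simps(4) by blast
qed

lemma uncolored_witness_coarse:
  fixes E E' :: "('x \<times> 'x) set"
  assumes EE': "\<And>x y. (x, y) \<in> E \<Longrightarrow> \<exists>k\<le>D. (x, y) \<in> E' ^^ k"
    and E'E: "\<And>x y. (x, y) \<in> E' \<Longrightarrow> \<exists>k\<le>C. (x, y) \<in> E ^^ k"
    and f: "uncolored_witness V E d (C * s) f"
  shows "uncolored_witness V E' d s f"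
proof -
  have tr: "path_dist E' x y \<le> enat (D * n)" if le: "path_dist E x y \<le> enat n" for x y n
  proof -
    obtain k where k: "k \<le> n" "(x, y) \<in> E ^^ k" using le by (auto simp: path_dist_le_iff)
    obtain l where "l \<le> D * k" "(x, y) \<in> E' ^^ l" using relpow_coarse[OF EE' k(2)] by blast
    then show ?thesis using k(1) by (meson mult_le_mono2 order_trans path_dist_le_iff)
  qed
  have tr': "path_dist E x y \<le> enat (C * n)" if le: "path_dist E' x y \<le> enat n" for x y n
  proof -
    obtain k where k: "k \<le> n" "(x, y) \<in> E' ^^ k" using le by (auto simp: path_dist_le_iff)
    obtain l where "l \<le> C * k" "(x, y) \<in> E ^^ l" using relpow_coarse[OF E'E k(2)] by blast
    then show ?thesis using k(1) by (meson mult_le_mono2 order_trans path_dist_le_iff)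
  qed
  have sub: "graph_ball V E' x s \<subseteq> graph_ball V E x (C * s)" for x
    using tr' by (auto simp: graph_ball_def)
  obtain c where "\<forall>x\<in>V. path_dist E x (f x) \<le> enat c"
    using f unfolding uncolored_witness_def SUP_enat_finite_iff by blast
  then have "\<forall>x\<in>V. path_dist E' x (f x) \<le> enat (D * c)" using tr by blast
  then have "(SUP x\<in>V. path_dist E' x (f x)) < \<infinity>" using SUP_enat_finite_iff by blast
  moreover have "finite (f ` graph_ball V E' x s) \<and> card (f ` graph_ball V E' x s) \<le> d + 1"
    if "x \<in> V" for x
  proof -
    have "finite (f ` graph_ball V E x (C * s))" "card (f ` graph_ball V E x (C * s)) \<le> d + 1"
      using f that by (auto simp: uncolored_witness_def)
    then show ?thesis
      using image_mono[OF sub] by (meson card_mono finite_subset order_trans)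
  qed
  ultimately show ?thesis using f unfolding uncolored_witness_def by blast
qed

context borel_monoid_set
begin

lemma act_space: "\<lbrakk>m \<in> carrier M; x \<in> space X\<rbrakk> \<Longrightarrow> act m x \<in> space X"
  using act_measurable measurable_space by metis

lemma schreier_sym: "sym (schreier_graph R act (space X))"
  by (auto simp: sym_def schreier_graph_def)

lemma relpow_sym: "sym E \<Longrightarrow> (x, y) \<in> E ^^ n \<Longrightarrow> (y, x) \<in> E ^^ n"
proof (induction n arbitrary: y)
  case (Suc n)
  then obtain z where "(x, z) \<in> E ^^ n" "(z, y) \<in> E" by auto
  then show ?case using Suc by (meson relpow_Suc_I2 symD)
qed auto

lemma act_bounded_displacement:
  assumes "finitely_generates M R" and "m \<in> carrier M"
  shows "\<exists>n. \<forall>x\<in>space X. \<exists>k\<le>n. (x, act m x) \<in> schreier_graph R act (space X) ^^ k"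
proof -
  let ?E = "schreier_graph R act (space X)"
  let ?H = "{m \<in> carrier M. \<exists>n. \<forall>x\<in>space X. \<exists>k\<le>n. (x, act m x) \<in> ?E ^^ k}"
  have "submonoid ?H M"
  proof
    show "?H \<subseteq> carrier M" by auto
    show "\<one> \<in> ?H" by (auto simp: act_one intro!: exI[of _ 0])
    fix a b assume "a \<in> ?H" "b \<in> ?H"
    then obtain p q where a: "a \<in> carrier M" "\<forall>x\<in>space X. \<exists>k\<le>p. (x, act a x) \<in> ?E ^^ k"
      and b: "b \<in> carrier M" "\<forall>x\<in>space X. \<exists>k\<le>q. (x, act b x) \<in> ?E ^^ k" by auto
    have "\<exists>k\<le>q + p. (x, act (a \<otimes> b) x) \<in> ?E ^^ k" if x: "x \<in> space X" for x
    proof -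
      obtain k where k: "k \<le> q" "(x, act b x) \<in> ?E ^^ k" using b x by blast
      obtain l where l: "l \<le> p" "(act b x, act a (act b x)) \<in> ?E ^^ l"
        using a act_space[OF b(1) x] by blast
      show ?thesis using k l a b x act_mult
        by (intro exI[of _ "k + l"]) (auto simp: relpow_add)
    qed
    then show "a \<otimes> b \<in> ?H" using a b by auto
  qed
  moreover have "R \<subseteq> ?H"
  proof
    fix r assume r: "r \<in> R"
    then have rM: "r \<in> carrier M" using assms by (auto simp: finitely_generates_def)
    have "\<exists>k\<le>1. (x, act r x) \<in> ?E ^^ k" if x: "x \<in> space X" for x
    proof (cases "act r x = x")
      case True
      then show ?thesis by (intro exI[of _ 0]) auto
    next
      case False
      then have "(x, act r x) \<in> ?E" using r x act_space[OF rM x]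
        by (auto simp: schreier_graph_def)
      then show ?thesis by (intro exI[of _ 1]) auto
    qed
    then show "r \<in> ?H" using rM by blast
  qed
  ultimately have "carrier M \<subseteq> ?H"
    using assms(1) unfolding finitely_generates_def by blast
  then show ?thesis using assms(2) by blast
qed

lemma schreier_coarse:
  assumes R: "finitely_generates M R" and R': "finitely_generates M R'"
  shows "\<exists>C. \<forall>x y. (x, y) \<in> schreier_graph R' act (space X) \<longrightarrow>
           (\<exists>k\<le>C. (x, y) \<in> schreier_graph R act (space X) ^^ k)"
proof -
  let ?E = "schreier_graph R act (space X)"
  have R'M: "R' \<subseteq> carrier M" and fin: "finite R'"
    using R' by (auto simp: finitely_generates_def)
  have "\<forall>r\<in>R'. \<exists>n. \<forall>x\<in>space X. \<exists>k\<le>n. (x, act r x) \<in> ?E ^^ k"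
    using act_bounded_displacement[OF R] R'M by blast
  then obtain N where N: "\<And>r x. r \<in> R' \<Longrightarrow> x \<in> space X \<Longrightarrow> \<exists>k\<le>N r. (x, act r x) \<in> ?E ^^ k"
    by metis
  have le: "N r \<le> sum N R'" if "r \<in> R'" for r
    using fin that by (simp add: member_le_sum)
  have "\<exists>k\<le>sum N R'. (x, y) \<in> ?E ^^ k" if xy: "(x, y) \<in> schreier_graph R' act (space X)" for x y
  proof -
    obtain r where r: "r \<in> R'" "y = act r x \<or> x = act r y" "x \<in> space X" "y \<in> space X"
      using xy by (auto simp: schreier_graph_def)
    then have "(\<exists>k\<le>N r. (x, y) \<in> ?E ^^ k) \<or> (\<exists>k\<le>N r. (y, x) \<in> ?E ^^ k)"
      using N by blast
    then show ?thesis
      using le[OF r(1)] relpow_sym[OF schreier_sym] by (meson order_trans)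
  qed
  then show ?thesis by blast
qed

lemma witness_transfer:
  assumes "finitely_generates M R" "finitely_generates M R'"
    and "\<forall>s. \<exists>f. P f \<and> uncolored_witness (space X) (schreier_graph R act (space X)) d s f"
  shows "\<forall>s. \<exists>f. P f \<and> uncolored_witness (space X) (schreier_graph R' act (space X)) d s f"
proof -
  obtain C D where
    "\<And>x y. (x, y) \<in> schreier_graph R' act (space X) \<Longrightarrow>
       \<exists>k\<le>C. (x, y) \<in> schreier_graph R act (space X) ^^ k"
    "\<And>x y. (x, y) \<in> schreier_graph R act (space X) \<Longrightarrow>
       \<exists>k\<le>D. (x, y) \<in> schreier_graph R' act (space X) ^^ k"
    using schreier_coarse assms(1,2) by metis
  then show ?thesis using assms(3) uncolored_witness_coarse by blast
qed

lemma asdim_schreier_indep: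
  assumes "finitely_generates M R" "finitely_generates M R'"
  shows "asdim (space X) (schreier_graph R act (space X)) =
         asdim (space X) (schreier_graph R' act (space X))"
  unfolding asdim_def
  using witness_transfer[OF assms, of "\<lambda>_. True"] witness_transfer[OF assms(2,1), of "\<lambda>_. True"]
  by (intro arg_cong[where f = least_enat]) auto

lemma borel_asdim_schreier_indep:
  assumes "finitely_generates M R" "finitely_generates M R'"
  shows "borel_asdim X (schreier_graph R act (space X)) =
         borel_asdim X (schreier_graph R' act (space X))"
  unfolding borel_asdim_def
  using witness_transfer[OF assms, of "\<lambda>f. f \<in> X \<rightarrow>\<^sub>M X"]
        witness_transfer[OF assms(2,1), of "\<lambda>f. f \<in> X \<rightarrow>\<^sub>M X"]
  by (intro arg_cong[where f = least_enat]) auto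

lemma asdim_action_eq:
  assumes "finitely_generates M R"
  shows "asdim_action M act X = asdim (space X) (schreier_graph R act (space X))"
  unfolding asdim_action_def
  using asdim_schreier_indep[OF someI[of "finitely_generates M", OF assms] assms] .

lemma borel_asdim_action_eq:
  assumes "finitely_generates M R"
  shows "borel_asdim_action M act X = borel_asdim X (schreier_graph R act (space X))"
  unfolding borel_asdim_action_def
  using borel_asdim_schreier_indep[OF someI[of "finitely_generates M", OF assms] assms] .

end

end

theory Submission
  imports Defs "HOL-Algebra.FiniteProduct"
begin

text \<open>
  Two facts combine. If the Borel asymptotic dimension is finite, it equals the asymptotic
  dimension (\<open>borel_witness_of_witness\<close>); and for \<open>n\<close> commuting bounded-to-one maps it is at most
  \<open>3 ^ n - 1\<close> (\<open>borel_witness_exists\<close>).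

  For the first fact, a witness that takes at most \<open>d + 1\<close> values on balls is the same, up to a change of
  scale, as a coloring with \<open>d + 1\<close> colors whose monochromatic components at a given scale are
  bounded. Finite Borel dimension splits the space into finitely many Borel sets whose
  components at a huge scale are bounded, hence finite. On each such component a \<open>(d + 1)\<close>-coloring that
  exists for arbitrary reasons can be replaced by the first admissible one in a finite list
  (\<open>borel_recoloring\<close>), and colorings of two sets merge without new colors if the second one is
  chosen at a much larger scale (\<open>components_bounded_Un\<close>).

  For the second fact, commutativity moves a whole ball of radius \<open>s\<close>, which may have exponentially many
  points because of the preimages, by one and the same monomial into the forward orbit \<open>A j x\<close> of its centre,
  where \<open>j\<close> ranges over a box of exponent vectors of polynomial size. Inside forward orbits a greedy
  algorithm, guided by a finite Borel coloring, selects a Borel set that is sparse and still within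
  reach of each point (\<open>stage_sparse\<close>, \<open>stage_cover\<close>); moving to the first selected point is
  the witness.

  Both parts use that graph neighbourhoods of Borel sets are Borel, which requires images of Borel
  sets under bounded-to-one Borel maps to be Borel (\<open>bounded_to_one_image_borel\<close>). This is deduced from
  the theorems of Lusin and Souslin on separation and injective images, applied to tuples of preimages.
  Their proof here replaces topology by countable covers for which every branch of pieces with nonempty finite
  intersections has a common point; such covers exist for every Borel set and can decide
  membership in countably many Borel sets at once (\<open>borel_complete_cover\<close>).
\<close>


section \<open>Complete covers of Borel sets\<close>

text \<open>A branch \<open>\<alpha>\<close> picks one piece of each level. That a branch whose finite intersections are
  nonempty has a common point is what completeness of a metric gives for closed pieces of vanishing
  diameter; in this form, without a topology, the property passes to all Borel sets.\<close>

definition complete_cover :: "'x set \<Rightarrow> (nat \<Rightarrow> nat \<Rightarrow> 'x set) \<Rightarrow> bool" where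
  "complete_cover A P \<longleftrightarrow> (\<forall>l. (\<Union>j. P l j) = A) \<and>
     (\<forall>\<alpha>. (\<forall>n. (\<Inter>i\<le>n. P i (\<alpha> i)) \<noteq> {}) \<longrightarrow> (\<Inter>i. P i (\<alpha> i)) \<noteq> {})"

definition decides :: "'x set \<Rightarrow> 'x set \<Rightarrow> bool" where
  "decides S W \<longleftrightarrow> S \<subseteq> W \<or> S \<inter> W = {}"

lemma decides_subset: "decides S W \<Longrightarrow> S' \<subseteq> S \<Longrightarrow> decides S' W"
  by (auto simp: decides_def)

lemma decides_iff: "decides S W \<Longrightarrow> x \<in> S \<Longrightarrow> y \<in> S \<Longrightarrow> x \<in> W \<longleftrightarrow> y \<in> W"
  by (auto simp: decides_def)

lemma complete_coverD1: "complete_cover A P \<Longrightarrow> (\<Union>j. P l j) = A"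
  by (auto simp: complete_cover_def)

lemma complete_cover_sub: "complete_cover A P \<Longrightarrow> P l j \<subseteq> A"
  by (auto simp: complete_cover_def)

lemma complete_coverD2:
  assumes "complete_cover A P" "\<And>n. \<exists>x. \<forall>i\<le>n. x \<in> P i (\<alpha> i)"
  shows "\<exists>x. \<forall>i. x \<in> P i (\<alpha> i)"
proof -
  have "(\<Inter>i\<le>n. P i (\<alpha> i)) \<noteq> {}" for n
  proof -
    obtain x where "\<forall>i\<le>n. x \<in> P i (\<alpha> i)" using assms(2) by blast
    then have "x \<in> (\<Inter>i\<le>n. P i (\<alpha> i))" by simp
    then show ?thesis by blast
  qed
  then have "(\<Inter>i. P i (\<alpha> i)) \<noteq> {}" using assms(1) by (auto simp: complete_cover_def)
  then show ?thesis by auto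
qed

lemma complete_coverI:
  assumes "\<And>l. (\<Union>j. P l j) = A"
    and "\<And>\<alpha>. (\<And>n. \<exists>x. \<forall>i\<le>n. x \<in> P i (\<alpha> i)) \<Longrightarrow> \<exists>x. \<forall>i. x \<in> P i (\<alpha> i)"
  shows "complete_cover A P"
  unfolding complete_cover_def
proof (intro conjI allI impI)
  fix \<alpha> assume *: "\<forall>n. (\<Inter>i\<le>n. P i (\<alpha> i)) \<noteq> {}"
  have "\<exists>x. \<forall>i\<le>n. x \<in> P i (\<alpha> i)" for n
  proof -
    obtain x where "x \<in> (\<Inter>i\<le>n. P i (\<alpha> i))" using * by blast
    then show ?thesis by auto
  qed
  then obtain x where "\<forall>i. x \<in> P i (\<alpha> i)" using assms(2) by blast
  then show "(\<Inter>i. P i (\<alpha> i)) \<noteq> {}" by blast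
qed (rule assms(1))

text \<open>Level \<open>l\<close> of the cover settles membership in the \<open>l\<close>-th set of a separating sequence, so a
  branch has at most one common point. Completeness of the cover replaces completeness of a metric.\<close>

locale souslin_space =
  fixes X :: "'x measure" and V :: "nat \<Rightarrow> 'x set" and P0 :: "nat \<Rightarrow> nat \<Rightarrow> 'x set"
  assumes sets_gen: "sets X = sigma_sets (space X) (range V)"
    and separating: "\<lbrakk>x \<in> space X; y \<in> space X; \<And>k. x \<in> V k \<longleftrightarrow> y \<in> V k\<rbrakk> \<Longrightarrow> x = y"
    and cover: "complete_cover (space X) P0"
    and cover_sets: "P0 l j \<in> sets X"
    and cover_decides: "decides (P0 l j) (V l)"
begin

definition resolving_cover :: "'x set \<Rightarrow> (nat \<Rightarrow> nat \<Rightarrow> 'x set) \<Rightarrow> bool" where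
  "resolving_cover A P \<longleftrightarrow> complete_cover A P \<and> (\<forall>l j. P l j \<in> sets X \<and> decides (P l j) (V l))"

lemma V_sets: "V k \<in> sets X" by (auto simp: sets_gen)

lemma resolving_cover_space: "resolving_cover (space X) P0"
  using cover cover_sets cover_decides by (auto simp: resolving_cover_def)

text \<open>Each level of a branch pins down membership in one \<open>V k\<close>, so two branches that keep meeting
  describe the same point.\<close>

lemma resolving_cover_point_unique:
  assumes P: "resolving_cover A P" "\<And>l. x \<in> P l (\<alpha> l)"
    and Q: "resolving_cover B Q" "\<And>l. y \<in> Q l (\<beta> l)"
    and meet: "\<And>l. \<exists>z. z \<in> P l (\<alpha> l) \<and> z \<in> Q l (\<beta> l)"
  shows "x = y"
proof (rule separating)
  show "x \<in> space X" "y \<in> space X"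
    using P Q sets.sets_into_space unfolding resolving_cover_def by blast+
  fix k
  obtain z where z: "z \<in> P k (\<alpha> k)" "z \<in> Q k (\<beta> k)" using meet by blast
  have "x \<in> V k \<longleftrightarrow> z \<in> V k" using P z by (intro decides_iff[of "P k (\<alpha> k)"]) (auto simp: resolving_cover_def)
  moreover have "y \<in> V k \<longleftrightarrow> z \<in> V k" using Q z by (intro decides_iff[of "Q k (\<beta> k)"]) (auto simp: resolving_cover_def)
  ultimately show "x \<in> V k \<longleftrightarrow> y \<in> V k" by simp
qed

text \<open>A branch settles membership in \<open>V k\<close>; the common point of a branch that keeps meeting \<open>V k\<close>,
  or its complement, therefore lies there as well.\<close>

lemma resolving_cover_Int_V:
  assumes "W = V k \<or> W = space X - V k"
  shows "resolving_cover W (\<lambda>l j. P0 l j \<inter> W)"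
  unfolding resolving_cover_def
proof (intro conjI allI)
  have W: "W \<subseteq> space X" "W \<in> sets X" using assms V_sets sets.sets_into_space by auto
  show "complete_cover W (\<lambda>l j. P0 l j \<inter> W)"
  proof (rule complete_coverI)
    show "(\<Union>j. P0 l j \<inter> W) = W" for l using complete_coverD1[OF cover, of l] W by auto
    fix \<alpha> assume fin: "\<And>n. \<exists>x. \<forall>i\<le>n. x \<in> P0 i (\<alpha> i) \<inter> W"
    then have "\<And>n. \<exists>x. \<forall>i\<le>n. x \<in> P0 i (\<alpha> i)" by (meson IntD1)
    then obtain x where x: "\<And>i. x \<in> P0 i (\<alpha> i)" using complete_coverD2[OF cover, of \<alpha>] by blast
    obtain z where z: "z \<in> P0 k (\<alpha> k) \<inter> W" using fin by blast
    have "z \<in> V k \<longleftrightarrow> x \<in> V k" using x z cover_decides by (intro decides_iff[of "P0 k (\<alpha> k)"]) auto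
    moreover have "x \<in> space X" using x cover_sets sets.sets_into_space by blast
    ultimately have "x \<in> W" using z assms by auto
    then show "\<exists>x. \<forall>i. x \<in> P0 i (\<alpha> i) \<inter> W" using x by blast
  qed
  show "P0 l j \<inter> W \<in> sets X" "decides (P0 l j \<inter> W) (V l)" for l j
    using cover_sets W decides_subset[OF cover_decides, of "P0 l j \<inter> W" l j] by auto
qed

text \<open>The covers of all \<open>A i\<close> are run in parallel: level \<open>(i, k)\<close> of the new cover uses level \<open>k\<close> of
  the \<open>i\<close>-th one. A branch then has a common point for each \<open>i\<close> separately, and these points agree because
  the branches keep meeting. The second conclusion says that nothing decided by one of the
  given covers is lost.\<close>

lemma resolving_cover_INT:
  assumes P: "\<And>i::nat. resolving_cover (A i) (P i)"
  shows "\<exists>Q. resolving_cover (\<Inter>i. A i) Q \<and> (\<forall>i l. \<exists>l'. \<forall>j'. \<exists>j. Q l' j' \<subseteq> P i l j)"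
proof -
  define B where "B = (\<Inter>i. A i)"
  define a where "a l = fst (prod_decode l)" for l
  define b where "b l = snd (prod_decode l)" for l
  \<comment> \<open>The factor from \<open>P 0\<close> is there to make level \<open>l\<close> decide \<open>V l\<close>.\<close>
  define Q where "Q l j = P (a l) (b l) (a j) \<inter> P 0 l (b j) \<inter> B" for l j
  have cc: "complete_cover (A i) (P i)" for i using P by (auto simp: resolving_cover_def)
  have ab: "a (prod_encode (i, k)) = i" "b (prod_encode (i, k)) = k" for i k by (auto simp: a_def b_def)
  have complete: "complete_cover B Q"
  proof (rule complete_coverI)
    fix l
    have "x \<in> (\<Union>j. Q l j)" if "x \<in> B" for x
    proof -
      have "x \<in> A (a l)" "x \<in> A 0" using that by (auto simp: B_def)
      then have "x \<in> (\<Union>j. P (a l) (b l) j)" "x \<in> (\<Union>j. P 0 l j)"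
        using complete_coverD1[OF cc[of "a l"], of "b l"] complete_coverD1[OF cc[of 0], of l] by simp_all
      then obtain i j where "x \<in> P (a l) (b l) i" "x \<in> P 0 l j" by blast
      then have "x \<in> Q l (prod_encode (i, j))" using that by (auto simp: Q_def ab)
      then show ?thesis by blast
    qed
    then show "(\<Union>j. Q l j) = B" by (auto simp: Q_def)
  next
    fix \<alpha> assume fin: "\<And>n. \<exists>x. \<forall>i\<le>n. x \<in> Q i (\<alpha> i)"
    define \<beta> where "\<beta> i k = a (\<alpha> (prod_encode (i, k)))" for i k
    define \<gamma> where "\<gamma> l = b (\<alpha> l)" for l
    have meet: "\<exists>z. z \<in> P i k (\<beta> i k) \<and> z \<in> P 0 l (\<gamma> l)" for i k l
    proof -
      obtain z where "\<forall>m\<le>max (prod_encode (i, k)) l. z \<in> Q m (\<alpha> m)" using fin by blast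
      then have "z \<in> Q (prod_encode (i, k)) (\<alpha> (prod_encode (i, k)))" "z \<in> Q l (\<alpha> l)" by auto
      then show ?thesis by (auto simp: Q_def ab \<beta>_def \<gamma>_def)
    qed
    have "\<exists>x. \<forall>k. x \<in> P i k (\<beta> i k)" for i
    proof -
      have "\<exists>x. \<forall>k\<le>n. x \<in> P i k (\<beta> i k)" for n
      proof -
        obtain z where z: "\<forall>m\<le>Max ((\<lambda>k. prod_encode (i, k)) ` {..n}). z \<in> Q m (\<alpha> m)" using fin by blast
        have "z \<in> P i k (\<beta> i k)" if "k \<le> n" for k
        proof -
          have "prod_encode (i, k) \<le> Max ((\<lambda>k. prod_encode (i, k)) ` {..n})" using that by auto
          then have "z \<in> Q (prod_encode (i, k)) (\<alpha> (prod_encode (i, k)))" using z by blast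
          then show ?thesis by (auto simp: Q_def ab \<beta>_def)
        qed
        then show ?thesis by blast
      qed
      then show ?thesis using complete_coverD2[OF cc[of i], of "\<beta> i"] by blast
    qed
    then obtain x where x: "\<And>i k. x i \<in> P i k (\<beta> i k)" by metis
    have "\<exists>x. \<forall>k\<le>n. x \<in> P 0 k (\<gamma> k)" for n
      using fin[of n] by (auto simp: Q_def \<gamma>_def)
    then obtain y where y: "\<And>l. y \<in> P 0 l (\<gamma> l)"
      using complete_coverD2[OF cc[of 0], of \<gamma>] by blast
    have "x i = y" for i
      using resolving_cover_point_unique[OF P x P y] meet by blast
    then have y': "y \<in> P i k (\<beta> i k)" for i k using x by metis
    have "y \<in> A i" for i using y'[of i 0] complete_cover_sub[OF cc] by blast
    then have "y \<in> B" by (auto simp: B_def)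
    then have "y \<in> Q l (\<alpha> l)" for l
      using y' [of "a l" "b l"] y[of l] by (auto simp: Q_def \<beta>_def \<gamma>_def a_def b_def)
    then show "\<exists>x. \<forall>i. x \<in> Q i (\<alpha> i)" by blast
  qed
  have Ai: "A i \<in> sets X" for i
  proof -
    have "(\<Union>j. P i 0 j) \<in> sets X" using P by (auto simp: resolving_cover_def)
    then show ?thesis using complete_coverD1[OF cc] by simp
  qed
  then have "B \<in> sets X" unfolding B_def by auto
  then have "Q l j \<in> sets X \<and> decides (Q l j) (V l)" for l j
    using P decides_subset[of "P 0 l (b j)" "V l" "Q l j"] unfolding resolving_cover_def Q_def by blast
  with complete have "resolving_cover (\<Inter>i. A i) Q" by (auto simp: resolving_cover_def B_def)
  moreover have "\<exists>l'. \<forall>j'. \<exists>j. Q l' j' \<subseteq> P i l j" for i l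
    by (intro exI[of _ "prod_encode (i, l)"]) (auto simp: Q_def ab)
  ultimately show ?thesis by blast
qed

lemma resolving_cover_disjoint_UN:
  assumes P: "\<And>i::nat. resolving_cover (A i) (P i)" and disj: "\<And>i j. i \<noteq> j \<Longrightarrow> A i \<inter> A j = {}"
  shows "\<exists>Q. resolving_cover (\<Union>i. A i) Q \<and> (\<forall>l j. \<exists>i. Q l j \<subseteq> A i)"
proof -
  define a where "a l = fst (prod_decode l)" for l
  define b where "b l = snd (prod_decode l)" for l
  have ab: "a (prod_encode (i, k)) = i" "b (prod_encode (i, k)) = k" for i k by (auto simp: a_def b_def)
  define Q where "Q l j = P (a j) l (b j)" for l j
  have cc: "complete_cover (A i) (P i)" for i using P by (auto simp: resolving_cover_def)
  have sub: "\<exists>i. Q l j \<subseteq> A i" for l j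
    unfolding Q_def by (rule exI[of _ "a j"]) (rule complete_cover_sub[OF cc])
  have "complete_cover (\<Union>i. A i) Q"
  proof (rule complete_coverI)
    fix l
    have "x \<in> (\<Union>j. Q l j)" if "x \<in> A i" for x i
    proof -
      have "x \<in> (\<Union>j. P i l j)" using that complete_coverD1[OF cc[of i], of l] by simp
      then obtain j where "x \<in> P i l j" by blast
      then have "x \<in> Q l (prod_encode (i, j))" by (simp add: Q_def ab)
      then show ?thesis by blast
    qed
    then have "(\<Union>i. A i) \<subseteq> (\<Union>j. Q l j)" by auto
    moreover have "(\<Union>j. Q l j) \<subseteq> (\<Union>i. A i)" using sub[of l] by (meson UN_least UN_upper order_trans UNIV_I)
    ultimately show "(\<Union>j. Q l j) = (\<Union>i. A i)" by simp
  next
    fix \<alpha> assume fin: "\<And>n. \<exists>x. \<forall>i\<le>n. x \<in> Q i (\<alpha> i)"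
    \<comment> \<open>All pieces of the branch meet its first piece, so disjointness puts them in one \<open>A i\<close>.\<close>
    define i where "i = a (\<alpha> 0)"
    have same: "a (\<alpha> l) = i" for l
    proof -
      obtain z where "\<forall>i\<le>l. z \<in> Q i (\<alpha> i)" using fin by blast
      then have "z \<in> Q l (\<alpha> l)" "z \<in> Q 0 (\<alpha> 0)" by auto
      then have "z \<in> A (a (\<alpha> l))" "z \<in> A (a (\<alpha> 0))"
        unfolding Q_def using complete_cover_sub[OF cc, THEN subsetD] by simp_all
      then show ?thesis using disj unfolding i_def by blast
    qed
    have "\<exists>x. \<forall>k\<le>n. x \<in> P i k (b (\<alpha> k))" for n
      using fin[of n] by (auto simp: Q_def same)
    then obtain x where "\<And>k. x \<in> P i k (b (\<alpha> k))"
      using complete_coverD2[OF cc[of i], of "\<lambda>k. b (\<alpha> k)"] by blast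
    then have "\<forall>i. x \<in> Q i (\<alpha> i)" by (auto simp: Q_def same)
    then show "\<exists>x. \<forall>i. x \<in> Q i (\<alpha> i)" by blast
  qed
  then have "resolving_cover (\<Union>i. A i) Q" using P by (auto simp: resolving_cover_def Q_def)
  then show ?thesis using sub by blast
qed

text \<open>The sets that have a resolving cover together with their complements form a \<open>\<sigma>\<close>-algebra
  containing every \<open>V k\<close>. A union is first made disjoint, which costs only complements and
  countable intersections.\<close>

lemma resolving_cover_borel_aux:
  assumes "A \<in> sigma_sets (space X) (range V)"
  shows "(\<exists>P. resolving_cover A P) \<and> (\<exists>P. resolving_cover (space X - A) P)"
  using assms
proof (induction rule: sigma_sets.induct)
  case (Basic A)
  then obtain k where "A = V k" by auto
  then show ?case using resolving_cover_Int_V[of A k] resolving_cover_Int_V[of "space X - A" k]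
    by auto
next
  case Empty
  have "resolving_cover {} (\<lambda>_ _. {})"
    by (auto simp: resolving_cover_def complete_cover_def decides_def)
  then show ?case using resolving_cover_space by auto
next
  case (Compl A)
  then have "A \<subseteq> space X" using sets_gen sets.sets_into_space by blast
  then show ?case using Compl by (simp add: double_diff)
next
  case (Union A)
  define C where "C i m = (if m < i then space X - A m else A i)" for i m
  define D where "D i = (\<Inter>m. C i m)" for i
  have "\<exists>P. resolving_cover (D i) P" for i
  proof -
    have "\<exists>P. \<forall>m. resolving_cover (C i m) (P m)"
      using Union.IH by (intro choice) (auto simp: C_def)
    then obtain P where P: "\<And>m. resolving_cover (C i m) (P m)" by blast
    show ?thesis unfolding D_def using resolving_cover_INT[where A = "C i" and P = P, OF P] by blast
  qed
  then have "\<exists>P. \<forall>i. resolving_cover (D i) (P i)" by (intro choice) blast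
  then obtain P where P: "\<And>i. resolving_cover (D i) (P i)" by blast
  have D: "D i = (A i - (\<Union>m<i. A m)) \<inter> space X" for i
  proof -
    have "A i \<subseteq> space X" using Union.hyps sets_gen sets.sets_into_space by blast
    then show ?thesis by (auto simp: D_def C_def split: if_splits)
  qed
  have disj: "D i \<inter> D j = {}" if "i \<noteq> j" for i j
    using that by (cases "i < j") (auto simp: D)
  obtain Q where "resolving_cover (\<Union>i. D i) Q"
    using resolving_cover_disjoint_UN[where A = D and P = P, OF P disj] by blast
  moreover have "(\<Union>i. D i) = (\<Union>i. A i)"
  proof -
    have "x \<in> (\<Union>i. D i)" if "x \<in> A i" for x i
    proof -
      define n where "n = (LEAST i. x \<in> A i)"
      have "x \<in> A n" unfolding n_def by (rule LeastI, rule that)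
      moreover have "x \<notin> A m" if "m < n" for m using that not_less_Least unfolding n_def by blast
      moreover have "x \<in> space X" using \<open>x \<in> A n\<close> Union.hyps sets_gen sets.sets_into_space by blast
      ultimately have "x \<in> D n" by (auto simp: D)
      then show ?thesis by blast
    qed
    moreover have "D i \<subseteq> A i" for i by (auto simp: D)
    ultimately show ?thesis by blast
  qed
  ultimately have 1: "\<exists>P. resolving_cover (\<Union>i. A i) P" by auto
  have "\<exists>P. \<forall>i. resolving_cover (space X - A i) (P i)" using Union.IH by (intro choice) blast
  then obtain P where P': "\<And>i. resolving_cover (space X - A i) (P i)" by blast
  obtain Q where "resolving_cover (\<Inter>i. space X - A i) Q"
    using resolving_cover_INT[where A = "\<lambda>i. space X - A i" and P = P, OF P'] by blast
  moreover have "(\<Inter>i. space X - A i) = space X - (\<Union>i. A i)" by auto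
  ultimately show ?case using 1 by auto
qed

lemma resolving_cover_borel:
  assumes "A \<in> sets X"
  shows "\<exists>P. resolving_cover A P"
  using resolving_cover_borel_aux assms sets_gen by simp

text \<open>The partition of the space into \<open>W k\<close> and its complement has a cover that decides \<open>W k\<close>; a cover
  of \<open>A\<close> is intersected with all of these. In a change of topology, this step would make all \<open>W k\<close>
  open and closed.\<close>

proposition borel_complete_cover:
  assumes A: "A \<in> sets X" and W: "\<And>k::nat. W k \<in> sets X"
  shows "\<exists>P. complete_cover A P \<and> (\<forall>l j. P l j \<in> sets X) \<and> (\<forall>k. \<exists>l. \<forall>j. decides (P l j) (W k))"
proof -
  have "\<exists>Q. resolving_cover (space X) Q \<and> (\<forall>l j. decides (Q l j) (W k))" for k
  proof -
    define A' where "A' i = (if i = 0 then W k else if i = 1 then space X - W k else {})" for i :: nat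
    have "A' i \<in> sets X" for i using W by (auto simp: A'_def)
    then have "\<exists>P. \<forall>i. resolving_cover (A' i) (P i)"
      using resolving_cover_borel by (intro choice) blast
    then obtain P where P: "\<And>i. resolving_cover (A' i) (P i)" by blast
    have disj: "A' i \<inter> A' j = {}" if "i \<noteq> j" for i j using that by (auto simp: A'_def)
    obtain Q where Q: "resolving_cover (\<Union>i. A' i) Q" "\<And>l j. \<exists>i. Q l j \<subseteq> A' i"
      using resolving_cover_disjoint_UN[where A = A' and P = P, OF P disj] by blast
    have "W k \<subseteq> space X" using W sets.sets_into_space by blast
    then have "(\<Union>i. A' i) = space X" by (auto simp: A'_def split: if_splits)
    moreover have "decides (Q l j) (W k)" for l j
      using Q(2)[of l j] by (auto simp: A'_def decides_def split: if_splits)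
    ultimately show ?thesis using Q(1) by auto
  qed
  then have "\<exists>Q. \<forall>k. resolving_cover (space X) (Q k) \<and> (\<forall>l j. decides (Q k l j) (W k))"
    by (intro choice) blast
  then obtain Q where Q: "\<And>k. resolving_cover (space X) (Q k)" "\<And>k l j. decides (Q k l j) (W k)"
    by blast
  obtain P where P: "resolving_cover A P" using resolving_cover_borel A by blast
  define A' where "A' i = (if i = 0 then A else space X)" for i :: nat
  define P' where "P' i = (if i = 0 then P else Q (i - 1))" for i :: nat
  have P': "resolving_cover (A' i) (P' i)" for i using P Q by (auto simp: A'_def P'_def)
  obtain S where S: "resolving_cover (\<Inter>i. A' i) S" "\<And>i l. \<exists>l'. \<forall>j'. \<exists>j. S l' j' \<subseteq> P' i l j"
    using resolving_cover_INT[where A = A' and P = P', OF P'] by blast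
  have "(\<Inter>i. A' i) = A"
    using sets.sets_into_space[OF A] by (auto simp: A'_def split: if_splits)
  moreover have "\<exists>l. \<forall>j. decides (S l j) (W k)" for k
  proof -
    obtain l where l: "\<And>j'. \<exists>j. S l j' \<subseteq> P' (Suc k) 0 j" using S(2) by blast
    have "decides (S l j') (W k)" for j'
    proof -
      obtain j where "S l j' \<subseteq> Q k 0 j" using l[of j'] by (auto simp: P'_def)
      then show ?thesis using Q(2) decides_subset by blast
    qed
    then show ?thesis by blast
  qed
  ultimately show ?thesis using S(1) by (intro exI[of _ S]) (simp add: resolving_cover_def)
qed

end


section \<open>Separation and injective images\<close>

definition borel_separated :: "'y measure \<Rightarrow> 'y set \<Rightarrow> 'y set \<Rightarrow> bool" where
  "borel_separated Y S T \<longleftrightarrow> (\<exists>C\<in>sets Y. S \<subseteq> C \<and> C \<inter> T = {})"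

lemma borel_separatedI: "C \<in> sets Y \<Longrightarrow> S \<subseteq> C \<Longrightarrow> C \<inter> T = {} \<Longrightarrow> borel_separated Y S T"
  by (auto simp: borel_separated_def)

lemma borel_separated_UN_left:
  assumes "\<And>i::nat. borel_separated Y (S i) T"
  shows "borel_separated Y (\<Union>i. S i) T"
proof -
  have "\<exists>C. \<forall>i. C i \<in> sets Y \<and> S i \<subseteq> C i \<and> C i \<inter> T = {}"
    using assms unfolding borel_separated_def by (intro choice) blast
  then obtain C where "\<And>i. C i \<in> sets Y \<and> S i \<subseteq> C i \<and> C i \<inter> T = {}" by blast
  then show ?thesis by (intro borel_separatedI[of "\<Union>i. C i"]) auto
qed

lemma borel_separated_UN_right:
  assumes "\<And>i::nat. borel_separated Y S (T i)"
  shows "borel_separated Y S (\<Union>i. T i)"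
proof -
  have "\<exists>C. \<forall>i. C i \<in> sets Y \<and> S \<subseteq> C i \<and> C i \<inter> T i = {}"
    using assms unfolding borel_separated_def by (intro choice) blast
  then obtain C where "\<And>i. C i \<in> sets Y \<and> S \<subseteq> C i \<and> C i \<inter> T i = {}" by blast
  then show ?thesis by (intro borel_separatedI[of "\<Inter>i. C i"]) auto
qed

definition separates_points :: "'y measure \<Rightarrow> (nat \<Rightarrow> 'y set) \<Rightarrow> bool" where
  "separates_points Y U \<longleftrightarrow> (\<forall>k. U k \<in> sets Y) \<and>
     (\<forall>x\<in>space Y. \<forall>y\<in>space Y. (\<forall>k. x \<in> U k \<longleftrightarrow> y \<in> U k) \<longrightarrow> x = y)"

lemma separates_pointsD:
  assumes "separates_points Y U" "x \<in> space Y" "y \<in> space Y" "x \<noteq> y"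
  obtains k where "x \<in> U k \<longleftrightarrow> y \<notin> U k"
  using assms unfolding separates_points_def by blast

lemma (in souslin_space) separates_points_V: "separates_points X V"
  using V_sets separating by (auto simp: separates_points_def)

lemma equalizer_sets:
  assumes U: "separates_points Y U" and g: "g \<in> Z \<rightarrow>\<^sub>M Y" and h: "h \<in> Z \<rightarrow>\<^sub>M Y"
  shows "{w \<in> space Z. g w = h w} \<in> sets Z"
proof -
  have [measurable]: "U k \<in> sets Y" for k using U by (auto simp: separates_points_def)
  note [measurable] = g h
  have "{w \<in> space Z. g w = h w} = {w \<in> space Z. \<forall>k. g w \<in> U k \<longleftrightarrow> h w \<in> U k}"
    using U measurable_space[OF g] measurable_space[OF h] by (auto simp: separates_points_def)
  also have "\<dots> \<in> sets Z" by measurable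
  finally show ?thesis .
qed

context souslin_space
begin

text \<open>This is Lusin's separation theorem. Were the images inseparable, then, as every level has only
  countably many pieces, one could choose nested pieces of \<open>A\<close> and of \<open>B\<close> whose images stay
  inseparable. Both branches have common points \<open>x\<close> and \<open>y\<close> with \<open>f x \<noteq> f y\<close>, some \<open>U k\<close> tells
  \<open>f x\<close> from \<open>f y\<close>, and once both covers have decided the preimage of \<open>U k\<close>, that set separates
  the images.\<close>

theorem image_separation:
  assumes U: "separates_points Y U" and f: "f \<in> X \<rightarrow>\<^sub>M Y"
    and A: "A \<in> sets X" and B: "B \<in> sets X" and disj: "f ` A \<inter> f ` B = {}"
  shows "borel_separated Y (f ` A) (f ` B)"
proof (rule ccontr)
  assume contr: "\<not> borel_separated Y (f ` A) (f ` B)"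
  define W where "W k = f -` U k \<inter> space X" for k
  have W: "W k \<in> sets X" for k
    using U measurable_sets[OF f] by (auto simp: W_def separates_points_def)
  obtain P where P: "complete_cover A P" "\<And>l j. P l j \<in> sets X" "\<And>k. \<exists>l. \<forall>j. decides (P l j) (W k)"
    using borel_complete_cover[where A = A and W = W, OF A W] by blast
  obtain Q where Q: "complete_cover B Q" "\<And>l j. Q l j \<in> sets X" "\<And>k. \<exists>l. \<forall>j. decides (Q l j) (W k)"
    using borel_complete_cover[where A = B and W = W, OF B W] by blast
  have step: "\<exists>i j. \<not> borel_separated Y (f ` (S \<inter> P n i)) (f ` (T \<inter> Q n j))"
    if ST: "S \<subseteq> A" "T \<subseteq> B" "\<not> borel_separated Y (f ` S) (f ` T)" for S T n
  proof (rule ccontr)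
    assume "\<not> ?thesis"
    then have *: "borel_separated Y (f ` (S \<inter> P n i)) (f ` (T \<inter> Q n j))" for i j by blast
    have "f ` S = (\<Union>i. f ` (S \<inter> P n i))" using complete_coverD1[OF P(1), of n] ST(1) by blast
    moreover have "f ` T = (\<Union>j. f ` (T \<inter> Q n j))" using complete_coverD1[OF Q(1), of n] ST(2) by blast
    moreover have "borel_separated Y (\<Union>i. f ` (S \<inter> P n i)) (\<Union>j. f ` (T \<inter> Q n j))"
      by (intro borel_separated_UN_left borel_separated_UN_right *)
    ultimately show False using ST(3) by simp
  qed
  define R :: "nat \<Rightarrow> nat \<times> nat \<times> 'x set \<times> 'x set \<Rightarrow> bool" where
    "R n = (\<lambda>(i, j, S, T). S \<subseteq> P n i \<and> T \<subseteq> Q n j \<and> S \<subseteq> A \<and> T \<subseteq> B \<and> \<not> borel_separated Y (f ` S) (f ` T))" for n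
  define D :: "nat \<Rightarrow> nat \<times> nat \<times> 'x set \<times> 'x set \<Rightarrow> nat \<times> nat \<times> 'x set \<times> 'x set \<Rightarrow> bool" where
    "D n = (\<lambda>(i, j, S, T) (i', j', S', T'). S' \<subseteq> S \<and> T' \<subseteq> T)" for n
  have "\<exists>F. \<forall>n. R n (F n) \<and> D n (F n) (F (Suc n))"
  proof (rule dependent_nat_choice)
    obtain i j where "\<not> borel_separated Y (f ` (A \<inter> P 0 i)) (f ` (B \<inter> Q 0 j))"
      using step[OF order_refl order_refl contr] by blast
    then have "R 0 (i, j, A \<inter> P 0 i, B \<inter> Q 0 j)" by (auto simp: R_def)
    then show "\<exists>x. R 0 x" ..
  next
    fix x n assume x: "R n x"
    obtain i j S T where x_eq: "x = (i, j, S, T)" by (cases x)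
    have ST: "S \<subseteq> A" "T \<subseteq> B" "\<not> borel_separated Y (f ` S) (f ` T)" using x by (auto simp: R_def x_eq)
    obtain i' j' where "\<not> borel_separated Y (f ` (S \<inter> P (Suc n) i')) (f ` (T \<inter> Q (Suc n) j'))"
      using step[OF ST] by blast
    then have "R (Suc n) (i', j', S \<inter> P (Suc n) i', T \<inter> Q (Suc n) j')"
      using ST by (auto simp: R_def)
    moreover have "D n x (i', j', S \<inter> P (Suc n) i', T \<inter> Q (Suc n) j')" by (auto simp: D_def x_eq)
    ultimately show "\<exists>y. R (Suc n) y \<and> D n x y" by blast
  qed
  then obtain F where F: "\<And>n. R n (F n)" "\<And>n. D n (F n) (F (Suc n))" by blast
  define \<alpha> where "\<alpha> n = fst (F n)" for n
  define \<beta> where "\<beta> n = fst (snd (F n))" for n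
  define S where "S n = fst (snd (snd (F n)))" for n
  define T where "T n = snd (snd (snd (F n)))" for n
  have F_eq: "F n = (\<alpha> n, \<beta> n, S n, T n)" for n by (simp add: \<alpha>_def \<beta>_def S_def T_def)
  have Rn: "S n \<subseteq> P n (\<alpha> n)" "T n \<subseteq> Q n (\<beta> n)" "\<not> borel_separated Y (f ` S n) (f ` T n)"
      "S n \<subseteq> A" "T n \<subseteq> B" for n
    using F(1)[of n] by (auto simp: F_eq R_def)
  have "S (Suc n) \<subseteq> S n" "T (Suc n) \<subseteq> T n" for n using F(2)[of n] by (auto simp: F_eq D_def)
  then have dec: "S n \<subseteq> S m" "T n \<subseteq> T m" if "m \<le> n" for m n
    using that lift_Suc_antimono_le[of S m n] lift_Suc_antimono_le[of T m n] by simp_all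
  have ne: "S n \<noteq> {}" "T n \<noteq> {}" for n
  proof -
    have fA: "f ` A \<subseteq> space Y"
      using sets.sets_into_space[OF A] measurable_space[OF f] by blast
    show "S n \<noteq> {}" using Rn(3)[of n] borel_separatedI[of "{}" Y "f ` S n" "f ` T n"] by auto
    show "T n \<noteq> {}"
    proof
      assume "T n = {}"
      moreover have "f ` S n \<subseteq> space Y" using fA Rn(4)[of n] by blast
      ultimately have "borel_separated Y (f ` S n) (f ` T n)"
        by (intro borel_separatedI[of "space Y"]) auto
      then show False using Rn(3) by blast
    qed
  qed
  have "\<exists>x. \<forall>i\<le>n. x \<in> P i (\<alpha> i)" for n
  proof -
    obtain x where "x \<in> S n" using ne by blast
    then have "\<forall>i\<le>n. x \<in> P i (\<alpha> i)" using dec(1) Rn(1) by blast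
    then show ?thesis ..
  qed
  then obtain x where x: "\<And>i. x \<in> P i (\<alpha> i)" using complete_coverD2[OF P(1), of \<alpha>] by blast
  have "\<exists>x. \<forall>i\<le>n. x \<in> Q i (\<beta> i)" for n
  proof -
    obtain x where "x \<in> T n" using ne by blast
    then have "\<forall>i\<le>n. x \<in> Q i (\<beta> i)" using dec(2) Rn(2) by blast
    then show ?thesis ..
  qed
  then obtain y where y: "\<And>i. y \<in> Q i (\<beta> i)" using complete_coverD2[OF Q(1), of \<beta>] by blast
  have xA: "x \<in> A" using complete_cover_sub[OF P(1), THEN subsetD, OF x[of 0]] .
  have yB: "y \<in> B" using complete_cover_sub[OF Q(1), THEN subsetD, OF y[of 0]] .
  have xy: "x \<in> space X" "y \<in> space X" using xA yB A B sets.sets_into_space by blast+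
  have "f x \<noteq> f y" using xA yB disj by blast
  then obtain k where k: "f x \<in> U k \<longleftrightarrow> f y \<notin> U k"
    using separates_pointsD[OF U measurable_space[OF f xy(1)] measurable_space[OF f xy(2)]] by blast
  obtain l where l: "\<And>j. decides (P l j) (W k)" using P(3) by blast
  obtain l' where l': "\<And>j. decides (Q l' j) (W k)" using Q(3) by blast
  define n where "n = max l l'"
  have xW: "z \<in> W k \<longleftrightarrow> x \<in> W k" if "z \<in> S n" for z
    by (rule decides_iff[OF l[of "\<alpha> l"]]) (use that dec(1)[of l n] Rn(1)[of l] x n_def in auto)
  have yW: "z \<in> W k \<longleftrightarrow> y \<in> W k" if "z \<in> T n" for z
    by (rule decides_iff[OF l'[of "\<beta> l'"]]) (use that dec(2)[of l' n] Rn(2)[of l'] y n_def in auto)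
  have sub: "S n \<subseteq> space X" "T n \<subseteq> space X"
    using Rn(4,5) sets.sets_into_space[OF A] sets.sets_into_space[OF B] by blast+
  have Uk: "U k \<in> sets Y" using U by (auto simp: separates_points_def)
  have "borel_separated Y (f ` S n) (f ` T n)"
  proof (cases "f x \<in> U k")
    case True
    have "f ` S n \<subseteq> U k" using xW sub True xy by (auto simp: W_def)
    moreover have "U k \<inter> f ` T n = {}" using yW sub True k xy by (auto simp: W_def)
    ultimately show ?thesis using Uk by (intro borel_separatedI)
  next
    case False
    have "f ` S n \<subseteq> space Y - U k"
      using xW sub False xy measurable_space[OF f] by (auto simp: W_def)
    moreover have "(space Y - U k) \<inter> f ` T n = {}" using yW sub False k xy by (auto simp: W_def)
    ultimately show ?thesis using Uk by (intro borel_separatedI) auto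
  qed
  then show False using Rn(3) by blast
qed

text \<open>This is the Lusin--Souslin theorem. By injectivity the disjoint pieces \<open>P' l j\<close> of one level
  have disjoint images, which separation encloses in disjoint Borel sets \<open>B l j\<close>. A point \<open>y\<close> that
  is in some \<open>B l (\<alpha> l)\<close> for each \<open>l\<close> selects a branch. Removing the sets \<open>bad s\<close>, which
  come from finitely many pieces without a common point, ensures that the branch has a common point
  \<open>x\<close>, and the sets \<open>E l j k\<close> make \<open>y\<close> agree with \<open>f x\<close> about every \<open>U k\<close>.\<close>

theorem injective_image_borel:
  assumes U: "separates_points Y U" and f: "f \<in> X \<rightarrow>\<^sub>M Y"
    and A: "A \<in> sets X" and inj: "inj_on f A"
  shows "f ` A \<in> sets Y"
proof -
  define W where "W k = f -` U k \<inter> space X" for k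
  have Uk: "U k \<in> sets Y" for k using U by (auto simp: separates_points_def)
  have W: "W k \<in> sets X" for k
    using Uk measurable_sets[OF f] by (auto simp: W_def)
  obtain P where P: "complete_cover A P" "\<And>l j. P l j \<in> sets X" "\<And>k. \<exists>l. \<forall>j. decides (P l j) (W k)"
    using borel_complete_cover[where A = A and W = W, OF A W] by blast
  define P' where "P' l j = P l j - (\<Union>i<j. P l i)" for l j
  have P'_sets: "P' l j \<in> sets X" for l j using P(2) by (auto simp: P'_def)
  have P'_sub: "P' l j \<subseteq> P l j" for l j by (auto simp: P'_def)
  have P'_disj: "P' l j \<inter> P' l j' = {}" if "j \<noteq> j'" for l j j'
    using that by (cases "j < j'") (auto simp: P'_def)
  have P'_A: "P' l j \<subseteq> A" for l j using complete_cover_sub[OF P(1), of l j] P'_sub[of l j] by blast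
  have P'_cov: "\<exists>j. x \<in> P' l j" if "x \<in> A" for x l
  proof -
    have ex: "\<exists>j. x \<in> P l j" using complete_coverD1[OF P(1), of l] that by blast
    define j where "j = (LEAST j. x \<in> P l j)"
    have "x \<in> P l j" unfolding j_def by (rule LeastI_ex[OF ex])
    moreover have "x \<notin> P l i" if "i < j" for i using that not_less_Least unfolding j_def by blast
    ultimately have "x \<in> P' l j" by (auto simp: P'_def)
    then show ?thesis ..
  qed
  have sep: "\<exists>C. C \<in> sets Y \<and> f ` P' l j \<subseteq> C \<and> (j \<noteq> j' \<longrightarrow> C \<inter> f ` P' l j' = {})" for l j j'
  proof (cases "j = j'")
    case True
    have "f ` P' l j \<subseteq> space Y"
      using sets.sets_into_space[OF P'_sets] measurable_space[OF f] by blast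
    then show ?thesis using True by auto
  next
    case False
    have "f ` P' l j \<inter> f ` P' l j' = {}"
    proof -
      have False if "x \<in> P' l j" "y \<in> P' l j'" "f x = f y" for x y
      proof -
        have "x = y" using that inj P'_A by (meson inj_onD subsetD)
        then show False using that P'_disj[OF False] by blast
      qed
      then show ?thesis by blast
    qed
    then have "borel_separated Y (f ` P' l j) (f ` P' l j')"
      by (intro image_separation[OF U f] P'_sets)
    then show ?thesis by (auto simp: borel_separated_def)
  qed
  define C where "C l j j' = (SOME C. C \<in> sets Y \<and> f ` P' l j \<subseteq> C \<and> (j \<noteq> j' \<longrightarrow> C \<inter> f ` P' l j' = {}))" for l j j'
  have C: "C l j j' \<in> sets Y" "f ` P' l j \<subseteq> C l j j'" "j \<noteq> j' \<Longrightarrow> C l j j' \<inter> f ` P' l j' = {}" for l j j'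
    using someI_ex[OF sep[of l j j']] unfolding C_def by blast+
  define B0 where "B0 l j = (\<Inter>j'. if j' = j then space Y else C l j j' - C l j' j)" for l j
  have B0_sets: "B0 l j \<in> sets Y" for l j unfolding B0_def using C(1) by (intro sets.countable_INT) auto
  have B0_disj: "j = j'" if "y \<in> B0 l j" "y \<in> B0 l j'" for y l j j'
  proof (rule ccontr)
    assume "j \<noteq> j'"
    then have "y \<in> C l j j' - C l j' j" "y \<in> C l j' j - C l j j'"
      using that unfolding B0_def by (auto dest!: INT_D[of _ _ _ j] INT_D[of _ _ _ j'])
    then show False by blast
  qed
  have B0_sup: "f x \<in> B0 l j" if "x \<in> P' l j" for x l j
  proof -
    have "x \<in> space X" using that sets.sets_into_space[OF P'_sets] by blast
    then have "f x \<in> space Y" using measurable_space[OF f] by blast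
    moreover have "f x \<in> C l j j' - C l j' j" if "j' \<noteq> j" for j'
      using C(2)[of l j j'] C(3)[of j' j l] that \<open>x \<in> P' l j\<close> by blast
    ultimately show ?thesis by (auto simp: B0_def)
  qed
  define E where "E l j k = (if P' l j \<subseteq> W k then U k else if P' l j \<inter> W k = {} then space Y - U k else space Y)" for l j k
  have E_sets: "E l j k \<in> sets Y" for l j k using Uk by (auto simp: E_def)
  define B where "B l j = B0 l j \<inter> (\<Inter>k. E l j k)" for l j
  have B_sets: "B l j \<in> sets Y" for l j
    unfolding B_def using B0_sets E_sets by (intro sets.Int sets.countable_INT) auto
  have B_sup: "f x \<in> B l j" if "x \<in> P' l j" for x l j
  proof -
    have xX: "x \<in> space X" using that sets.sets_into_space[OF P'_sets] by blast
    have "f x \<in> E l j k" for k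
      using that xX measurable_space[OF f xX] by (auto simp: E_def W_def)
    then show ?thesis using B0_sup[OF that] by (auto simp: B_def)
  qed
  define bad where "bad s = (if \<exists>x. \<forall>i<length s. x \<in> P' i (s ! i) then {}
      else space Y \<inter> (\<Inter>i\<in>{..<length s}. B i (s ! i)))" for s
  have bad_sets: "bad s \<in> sets Y" for s
  proof (cases "s = []")
    case True then show ?thesis by (simp add: bad_def)
  next
    case False
    then have "(\<Inter>i\<in>{..<length s}. B i (s ! i)) \<in> sets Y"
      using B_sets by (intro sets.finite_INT) auto
    then show ?thesis by (auto simp: bad_def)
  qed
  have "f ` A = (\<Inter>l. \<Union>j. B l j) - (\<Union>s. bad s)"
  proof (intro equalityI subsetI)
    fix y assume "y \<in> f ` A"
    then obtain x where x: "x \<in> A" "y = f x" by blast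
    obtain \<alpha> where \<alpha>: "\<And>l. x \<in> P' l (\<alpha> l)" using P'_cov[OF x(1)] by metis
    have B: "y \<in> B l (\<alpha> l)" for l using B_sup \<alpha> x(2) by blast
    have "y \<notin> bad s" for s
    proof
      assume "y \<in> bad s"
      then have none: "\<not> (\<exists>x. \<forall>i<length s. x \<in> P' i (s ! i))" and "\<And>i. i < length s \<Longrightarrow> y \<in> B i (s ! i)"
        by (auto simp: bad_def split: if_splits)
      then have "s ! i = \<alpha> i" if "i < length s" for i
        using that B0_disj[of y i "s ! i" "\<alpha> i"] B[of i] by (auto simp: B_def)
      then have "\<forall>i<length s. x \<in> P' i (s ! i)" using \<alpha> by simp
      then show False using none by blast
    qed
    then show "y \<in> (\<Inter>l. \<Union>j. B l j) - (\<Union>s. bad s)" using B by blast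
  next
    fix y assume y: "y \<in> (\<Inter>l. \<Union>j. B l j) - (\<Union>s. bad s)"
    then have "\<forall>l. \<exists>j. y \<in> B l j" by blast
    then obtain \<alpha> where \<alpha>: "\<And>l. y \<in> B l (\<alpha> l)" by metis
    have yY: "y \<in> space Y" using \<alpha>[of 0] sets.sets_into_space[OF B_sets] by blast
    have fin: "\<exists>x. \<forall>i\<le>n. x \<in> P' i (\<alpha> i)" for n
    proof -
      define s where "s = map \<alpha> [0..<Suc n]"
      have s: "length s = Suc n" "\<And>i. i < Suc n \<Longrightarrow> s ! i = \<alpha> i"
        unfolding s_def by (simp_all del: upt_Suc)
      have "y \<notin> bad s" using y by blast
      moreover have "y \<in> space Y \<inter> (\<Inter>i\<in>{..<length s}. B i (s ! i))" using yY \<alpha> s by auto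
      ultimately obtain x where "\<forall>i<length s. x \<in> P' i (s ! i)"
        unfolding bad_def by (auto split: if_splits)
      then have "\<forall>i\<le>n. x \<in> P' i (\<alpha> i)" using s by auto
      then show ?thesis ..
    qed
    have "\<exists>x. \<forall>i\<le>n. x \<in> P i (\<alpha> i)" for n using fin[of n] P'_sub by blast
    then obtain x where x: "\<And>i. x \<in> P i (\<alpha> i)" using complete_coverD2[OF P(1), of \<alpha>] by blast
    have xA: "x \<in> A" using complete_cover_sub[OF P(1), THEN subsetD, OF x[of 0]] .
    then have xX: "x \<in> space X" using sets.sets_into_space[OF A] by blast
    have "f x \<in> U k \<longleftrightarrow> y \<in> U k" for k
    proof -
      obtain l where l: "\<And>j. decides (P l j) (W k)" using P(3) by blast
      obtain z where z: "z \<in> P' l (\<alpha> l)" using fin[of l] by blast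
      have yE: "y \<in> E l (\<alpha> l) k" using \<alpha>[of l] by (auto simp: B_def)
      show ?thesis
      proof (cases "P l (\<alpha> l) \<subseteq> W k")
        case True
        then have "P' l (\<alpha> l) \<subseteq> W k" "x \<in> W k" using P'_sub[of l "\<alpha> l"] x[of l] by blast+
        then show ?thesis using yE by (auto simp: E_def W_def)
      next
        case False
        then have dis: "P l (\<alpha> l) \<inter> W k = {}" using l[of "\<alpha> l"] by (auto simp: decides_def)
        then have "P' l (\<alpha> l) \<inter> W k = {}" "x \<notin> W k" using P'_sub[of l "\<alpha> l"] x[of l] by blast+
        moreover have "\<not> P' l (\<alpha> l) \<subseteq> W k" using z calculation by blast
        ultimately have "y \<in> space Y - U k" "x \<notin> W k" using yE by (simp_all add: E_def)
        then show ?thesis using xX by (auto simp: W_def)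
      qed
    qed
    then have "f x = y"
      using U measurable_space[OF f xX] yY by (auto simp: separates_points_def)
    then show "y \<in> f ` A" using xA by blast
  qed
  moreover have "(\<Inter>l. \<Union>j. B l j) - (\<Union>s. bad s) \<in> sets Y"
    using B_sets bad_sets by (intro sets.Diff sets.countable_INT sets.countable_UN) auto
  ultimately show ?thesis by simp
qed

end


section \<open>Images under bounded-to-one maps\<close>

text \<open>Isolating a point from finitely many others at once, rather than from one other point, is what
  the coloring of locally finite graphs and the separation of several preimages rely on.\<close>

locale standard_space = souslin_space +
  assumes isolating: "\<lbrakk>x \<in> space X; finite F; x \<notin> F\<rbrakk> \<Longrightarrow> \<exists>k. x \<in> V k \<and> V k \<inter> F = {}"

text \<open>For a complete metric and a dense sequence, \<open>V\<close> enumerates the balls about the dense points of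
  radii \<open>1 / Suc q\<close>. The pieces of level \<open>l\<close> are closed and lie in balls of radius \<open>1 / Suc l\<close>; to decide
  the open set \<open>V l\<close> with closed pieces, it is exhausted by smaller closed balls.\<close>

lemma standard_borel_imp_standard_space:
  assumes "standard_borel X"
  shows "\<exists>V P. standard_space X V P"
proof -
  obtain T where T: "topspace T = space X" "completely_metrizable_space T" "separable_space T"
      "sets X = sigma_sets (space X) {U. openin T U}"
    using assms unfolding standard_borel_def by blast
  obtain M d where Md: "Metric_space M d" "Metric_space.mcomplete M d" "T = Metric_space.mtopology M d"
    using T(2) unfolding completely_metrizable_space_def by blast
  interpret Metric_space M d by (rule Md(1))
  have MX: "space X = M" using T(1) Md(3) by simp
  show ?thesis
  proof (cases "M = {}")
    case True
    have "{U. openin T U} = {{}}" using True MX T(1) openin_subset[of T] by auto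
    then have "standard_space X (\<lambda>_. {}) (\<lambda>_ _. {})"
      using T(4) True MX
      by unfold_locales (auto simp: complete_cover_def decides_def)
    then show ?thesis by blast
  next
    case False
    obtain C where C: "countable C" "C \<subseteq> M" "mtopology closure_of C = M"
      using T(3) Md(3) unfolding separable_space_def by auto
    have "C \<noteq> {}" using C(3) False by auto
    then obtain c :: "nat \<Rightarrow> 'a" where c: "range c = C"
      using C(1) by (metis range_from_nat_into)
    have cM: "c i \<in> M" for i using c C(2) by blast
    have dense: "\<exists>i. d (c i) x < r" if "x \<in> M" "r > 0" for x r
    proof -
      have "x \<in> mtopology closure_of C" using C(3) that(1) by simp
      then obtain y where "y \<in> C" "y \<in> mball x r"
        using \<open>r > 0\<close> unfolding metric_closure_of by blast
      then show ?thesis using c by (auto simp: commute)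
    qed
    define a where "a l = fst (prod_decode l)" for l
    define b where "b l = snd (prod_decode l)" for l
    have ab: "a (prod_encode (i, k)) = i" "b (prod_encode (i, k)) = k" for i k by (auto simp: a_def b_def)
    define V where "V k = mball (c (a k)) (1 / Suc (b k))" for k
    have openV: "openin mtopology (V k)" for k by (auto simp: V_def)
    have base: "\<exists>k. x \<in> V k \<and> V k \<subseteq> U" if U: "openin mtopology U" "x \<in> U" for x U
    proof -
      obtain r where r: "r > 0" "mball x r \<subseteq> U" using U openin_mtopology by blast
      have xM: "x \<in> M" using U openin_mtopology by blast
      obtain q where q: "inverse (real (Suc q)) < r / 2" using reals_Archimedean[of "r / 2"] r(1) by auto
      obtain i where i: "d (c i) x < 1 / Suc q" using dense[OF xM, of "1 / Suc q"] by auto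
      have "mball (c i) (1 / Suc q) \<subseteq> mball x r"
      proof
        fix z assume z: "z \<in> mball (c i) (1 / Suc q)"
        then have "d x z \<le> d x (c i) + d (c i) z" using xM cM by (intro triangle) auto
        also have "\<dots> < r" using z i q by (simp add: commute inverse_eq_divide)
        finally show "z \<in> mball x r" using z xM by auto
      qed
      then show ?thesis using i r xM cM
        by (intro exI[of _ "prod_encode (i, q)"]) (auto simp: V_def ab)
    qed
    have gen: "sets X = sigma_sets M (range V)"
      unfolding T(4) MX
    proof (rule sigma_sets_eqI)
      fix U assume "U \<in> {U. openin T U}"
      then have U: "openin mtopology U" using Md(3) by simp
      have "U = (\<Union>k. if V k \<subseteq> U then V k else {})"
        using base[OF U] by (auto split: if_splits)
      moreover have "(\<Union>k. if V k \<subseteq> U then V k else {}) \<in> sigma_sets M (range V)"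
        by (intro sigma_sets.Union) (auto intro: sigma_sets.Empty sigma_sets.Basic)
      ultimately show "U \<in> sigma_sets M (range V)" by simp
    qed (use openV Md(3) in auto)
    have iso: "\<exists>k. x \<in> V k \<and> V k \<inter> F = {}" if xF: "x \<in> M" "finite F" "x \<notin> F" for x F
    proof -
      have "closedin mtopology (F \<inter> M)"
        using xF(2) Hausdorff_imp_t1_space[OF Hausdorff_space_mtopology]
        unfolding t1_space_closedin_finite by simp
      then have "openin mtopology (M - F \<inter> M)" by (simp add: closedin_def)
      from base[OF this, of x] obtain k where "x \<in> V k" "V k \<subseteq> M - F \<inter> M"
        using xF by blast
      then show ?thesis by blast
    qed
    define P where "P l j = mcball (c (a j)) (1 / Suc l) \<inter>
        (if b j = 0 then M - V l else mcball (c (a l)) (1 / Suc (b l) - 1 / b j))" for l j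
    have closedP: "closedin mtopology (P l j)" for l j
    proof -
      have "closedin mtopology (M - V l)" using openV by (simp add: closedin_def openV openin_subset Diff_Diff_Int Int_absorb1)
        (metis inf.absorb_iff2 openV openin_subset topspace_mtopology)
      then show ?thesis unfolding P_def by (auto intro!: closedin_Int)
    qed
    have PM: "P l j \<subseteq> M" for l j using closedP closedin_subset by fastforce
    have setsP: "P l j \<in> sets X" for l j
    proof -
      have "openin T (M - P l j)" using closedP[of l j] Md(3) by (simp add: closedin_def)
      then have "M - (M - P l j) \<in> sigma_sets M {U. openin T U}" by (intro sigma_sets.Compl sigma_sets.Basic) simp
      then show ?thesis using PM[of l j] T(4) MX by (simp add: double_diff)
    qed
    have "standard_space X V P"
    proof unfold_locales
      show "sets X = sigma_sets (space X) (range V)" using gen MX by simp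
      show "\<exists>k. x \<in> V k \<and> V k \<inter> F = {}" if "x \<in> space X" "finite F" "x \<notin> F" for x F
        using iso that MX by blast
      show "x = y" if xy: "x \<in> space X" "y \<in> space X" "\<And>k. x \<in> V k \<longleftrightarrow> y \<in> V k" for x y
      proof (rule ccontr)
        assume "x \<noteq> y"
        then obtain k where "x \<in> V k" "V k \<inter> {y} = {}" using iso[of x "{y}"] xy(1) MX by auto
        then show False using xy(3)[of k] by blast
      qed
      show "P l j \<in> sets X" for l j by (rule setsP)
      show "decides (P l j) (V l)" for l j
      proof (cases "b j = 0")
        case True then show ?thesis by (auto simp: P_def decides_def)
      next
        case False
        then have "1 / Suc (b l) - 1 / b j < 1 / Suc (b l)" by simp
        from mcball_subset_mball_concentric[OF this] have "P l j \<subseteq> V l" using False by (auto simp: P_def V_def)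
        then show ?thesis by (simp add: decides_def)
      qed
      show "complete_cover (space X) P"
      proof (rule complete_coverI)
        fix l
        have "\<exists>j. x \<in> P l j" if x: "x \<in> M" for x
        proof -
          obtain i where i: "d (c i) x < 1 / Suc l" using dense[OF x, of "1 / Suc l"] by auto
          have "\<exists>m. x \<in> (if m = 0 then M - V l else mcball (c (a l)) (1 / Suc (b l) - 1 / real m))"
          proof (cases "x \<in> V l")
            case False then show ?thesis using x by (intro exI[of _ 0]) auto
          next
            case True
            then have lt: "d (c (a l)) x < 1 / Suc (b l)" by (auto simp: V_def)
            then obtain m where "inverse (real (Suc m)) < 1 / Suc (b l) - d (c (a l)) x"
              using reals_Archimedean[of "1 / Suc (b l) - d (c (a l)) x"] by auto
            then show ?thesis using x cM by (intro exI[of _ "Suc m"]) (auto simp: inverse_eq_divide)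
          qed
          then obtain m where "x \<in> (if m = 0 then M - V l else mcball (c (a l)) (1 / Suc (b l) - 1 / real m))" ..
          then show ?thesis using i x cM
            by (intro exI[of _ "prod_encode (i, m)"]) (auto simp: P_def ab split: if_splits)
        qed
        then show "(\<Union>j. P l j) = space X" using PM MX by auto
      next
        fix \<alpha> assume fin: "\<And>n. \<exists>x. \<forall>i\<le>n. x \<in> P i (\<alpha> i)"
        define K where "K n = (\<Inter>i\<le>n. P i (\<alpha> i))" for n
        have "(\<Inter>n. K n) \<noteq> {}"
        proof (rule mcomplete_nest[THEN iffD1, OF Md(2), rule_format], intro conjI allI impI)
          show "closedin mtopology (K n)" for n
            unfolding K_def using closedP by (intro closedin_INT) auto
          show "K n \<noteq> {}" for n
          proof -
            obtain x where "\<forall>i\<le>n. x \<in> P i (\<alpha> i)" using fin by blast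
            then have "x \<in> K n" by (simp add: K_def)
            then show ?thesis by blast
          qed
          show "decseq K" by (auto simp: decseq_def K_def)
          fix e :: real assume "e > 0"
          then obtain n where n: "inverse (real (Suc n)) < e" using reals_Archimedean by blast
          have "K n \<subseteq> P n (\<alpha> n)" by (auto simp: K_def)
          also have "\<dots> \<subseteq> mcball (c (a (\<alpha> n))) (1 / Suc n)" by (auto simp: P_def)
          also have "\<dots> \<subseteq> mcball (c (a (\<alpha> n))) e"
            using n by (intro mcball_subset_concentric) (simp add: inverse_eq_divide)
          finally show "\<exists>n a. K n \<subseteq> mcball a e" by blast
        qed
        then obtain x where "\<And>n. x \<in> K n" by blast
        then have "\<forall>i. x \<in> P i (\<alpha> i)" unfolding K_def by blast
        then show "\<exists>x. \<forall>i. x \<in> P i (\<alpha> i)" by blast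
      qed
    qed
    then show ?thesis by blast
  qed
qed

context souslin_space
begin

text \<open>The product \<open>\<sigma>\<close>-algebra on \<open>(n + 1)\<close>-tuples, given by countably many generators so that it is
  visibly a Souslin space again.\<close>

definition power_space :: "nat \<Rightarrow> (nat \<Rightarrow> 'x) measure" where
  "power_space n = sigma ({..n} \<rightarrow>\<^sub>E space X)
     (\<Union>i\<in>{..n}. range (\<lambda>m. {w \<in> {..n} \<rightarrow>\<^sub>E space X. w i \<in> V m}))"

lemma space_power_space: "space (power_space n) = {..n} \<rightarrow>\<^sub>E space X"
  unfolding power_space_def by (intro space_measure_of) auto

lemma sets_power_space: "sets (power_space n) =
    sigma_sets ({..n} \<rightarrow>\<^sub>E space X) (\<Union>i\<in>{..n}. range (\<lambda>m. {w \<in> {..n} \<rightarrow>\<^sub>E space X. w i \<in> V m}))"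
  unfolding power_space_def by (intro sets_measure_of) auto

lemma power_space_component:
  assumes "i \<le> n"
  shows "(\<lambda>w. w i) \<in> power_space n \<rightarrow>\<^sub>M X"
proof (rule measurable_sigma_sets[OF sets_gen])
  show "range V \<subseteq> Pow (space X)" using V_sets sets.sets_into_space by blast
  show "(\<lambda>w. w i) \<in> space (power_space n) \<rightarrow> space X"
    using assms by (auto simp: space_power_space)
  fix y assume "y \<in> range V"
  then obtain m where m: "y = V m" by blast
  have "(\<lambda>w. w i) -` y \<inter> space (power_space n) = {w \<in> {..n} \<rightarrow>\<^sub>E space X. w i \<in> V m}"
    by (auto simp: m space_power_space)
  also have "\<dots> \<in> sets (power_space n)"
    unfolding sets_power_space using assms by (intro sigma_sets.Basic) auto
  finally show "(\<lambda>w. w i) -` y \<inter> space (power_space n) \<in> sets (power_space n)" .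
qed

lemma power_space_souslin: "\<exists>V' P. souslin_space (power_space n) V' P"
proof -
  define \<Omega> where "\<Omega> = {..n} \<rightarrow>\<^sub>E space X"
  define a where "a l = fst (prod_decode l)" for l
  define b where "b l = snd (prod_decode l)" for l
  have ab: "a (prod_encode (i, k)) = i" "b (prod_encode (i, k)) = k" for i k by (auto simp: a_def b_def)
  define V' where "V' k = (if a k \<le> n then {w \<in> \<Omega>. w (a k) \<in> V (b k)} else {})" for k
  define P where "P k j = (if a k \<le> n then {w \<in> \<Omega>. w (a k) \<in> P0 (b k) j} else \<Omega>)" for k j
  have sp: "space (power_space n) = \<Omega>" by (simp add: \<Omega>_def space_power_space)
  have pre: "{w \<in> \<Omega>. w i \<in> S} \<in> sets (power_space n)" if "i \<le> n" "S \<in> sets X" for i S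
  proof -
    have "(\<lambda>w. w i) -` S \<inter> space (power_space n) \<in> sets (power_space n)"
      using measurable_sets[OF power_space_component[OF that(1)] that(2)] .
    moreover have "(\<lambda>w. w i) -` S \<inter> space (power_space n) = {w \<in> \<Omega>. w i \<in> S}" by (auto simp: sp)
    ultimately show ?thesis by simp
  qed
  have "souslin_space (power_space n) V' P"
  proof
    show "sets (power_space n) = sigma_sets (space (power_space n)) (range V')"
      unfolding sets_power_space sp \<Omega>_def[symmetric]
    proof (rule sigma_sets_eqI)
      fix S assume "S \<in> (\<Union>i\<in>{..n}. range (\<lambda>m. {w \<in> \<Omega>. w i \<in> V m}))"
      then obtain i m where "i \<le> n" "S = {w \<in> \<Omega>. w i \<in> V m}" by auto
      then have "S = V' (prod_encode (i, m))" by (simp add: V'_def ab)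
      then show "S \<in> sigma_sets \<Omega> (range V')" by (auto intro: sigma_sets.Basic)
    next
      fix S assume "S \<in> range V'"
      then obtain k where k: "S = V' k" by blast
      show "S \<in> sigma_sets \<Omega> (\<Union>i\<in>{..n}. range (\<lambda>m. {w \<in> \<Omega>. w i \<in> V m}))"
      proof (cases "a k \<le> n")
        case True
        then show ?thesis unfolding k V'_def by (intro sigma_sets.Basic) auto
      next
        case False
        then show ?thesis by (simp add: k V'_def sigma_sets.Empty)
      qed
    qed
  next
    fix w w' assume w: "w \<in> space (power_space n)" "w' \<in> space (power_space n)"
      "\<And>k. w \<in> V' k \<longleftrightarrow> w' \<in> V' k"
    have "w i = w' i" if i: "i \<le> n" for i
    proof (rule separating)
      show "w i \<in> space X" "w' i \<in> space X" using w i by (auto simp: sp \<Omega>_def)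
      show "w i \<in> V k \<longleftrightarrow> w' i \<in> V k" for k
        using w(3)[of "prod_encode (i, k)"] w(1,2) i by (simp add: V'_def ab sp)
    qed
    then show "w = w'" using w(1,2) unfolding sp \<Omega>_def by (intro PiE_ext) auto
  next
    show "P l j \<in> sets (power_space n)" for l j
    proof (cases "a l \<le> n")
      case True then show ?thesis unfolding P_def using pre[OF True cover_sets] by simp
    next
      case False then show ?thesis unfolding P_def using sp sets.top by metis
    qed
    show "decides (P l j) (V' l)" for l j
      using cover_decides[of "b l" j] by (auto simp: P_def V'_def decides_def)
    show "complete_cover (space (power_space n)) P"
      unfolding sp
    proof (rule complete_coverI)
      fix l
      show "(\<Union>j. P l j) = \<Omega>"
      proof (cases "a l \<le> n")
        case True
        have "w (a l) \<in> (\<Union>j. P0 (b l) j)" if "w \<in> \<Omega>" for w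
          using that True complete_coverD1[OF cover, of "b l"] by (auto simp: \<Omega>_def)
        then show ?thesis using True by (auto simp: P_def)
      next
        case False then show ?thesis by (simp add: P_def)
      qed
    next
      fix \<alpha> assume fin: "\<And>m. \<exists>w. \<forall>i\<le>m. w \<in> P i (\<alpha> i)"
      have "\<exists>x. \<forall>l. x \<in> P0 l (\<alpha> (prod_encode (i, l)))" if i: "i \<le> n" for i
      proof (rule complete_coverD2[OF cover])
        fix m
        define N where "N = Max ((\<lambda>l. prod_encode (i, l)) ` {..m})"
        obtain w where w: "\<forall>k\<le>N. w \<in> P k (\<alpha> k)" using fin by blast
        have "w i \<in> P0 l (\<alpha> (prod_encode (i, l)))" if "l \<le> m" for l
        proof -
          have "prod_encode (i, l) \<le> N" using that by (auto simp: N_def)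
          then have "w \<in> P (prod_encode (i, l)) (\<alpha> (prod_encode (i, l)))" using w by blast
          then show ?thesis using i by (simp add: P_def ab)
        qed
        then show "\<exists>x. \<forall>l\<le>m. x \<in> P0 l (\<alpha> (prod_encode (i, l)))" by blast
      qed
      then obtain x where x: "\<And>i l. i \<le> n \<Longrightarrow> x i \<in> P0 l (\<alpha> (prod_encode (i, l)))" by metis
      define w where "w = restrict x {..n}"
      have "x i \<in> space X" if "i \<le> n" for i
        using complete_cover_sub[OF cover, THEN subsetD, OF x[OF that]] .
      then have "w \<in> \<Omega>" by (auto simp: w_def \<Omega>_def)
      moreover have "w (a k) \<in> P0 (b k) (\<alpha> k)" if "a k \<le> n" for k
        using x[OF that, of "b k"] that by (simp add: w_def a_def b_def)
      ultimately have "\<forall>k. w \<in> P k (\<alpha> k)" by (auto simp: P_def)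
      then show "\<exists>w. \<forall>k. w \<in> P k (\<alpha> k)" by blast
    qed
  qed
  then show ?thesis by blast
qed

end

context standard_space
begin

text \<open>The points with \<open>k + 1\<close> preimages are the image of Borel sets \<open>Z s\<close> of tuples of preimages
  whose entries lie in prescribed disjoint sets. As there are no further preimages, the tuple is
  determined by its image, so the Lusin--Souslin theorem applies. Away from these points the map is
  \<open>k\<close>-to-one, and induction finishes the proof.\<close>

theorem bounded_to_one_image_borel:
  assumes f: "f \<in> X \<rightarrow>\<^sub>M X" and A: "A \<in> sets X"
    and bound: "\<And>y. y \<in> space X \<Longrightarrow> finite {x \<in> A. f x = y} \<and> card {x \<in> A. f x = y} \<le> k"
  shows "f ` A \<in> sets X"
  using A bound
proof (induction k arbitrary: A)
  case 0
  have "x \<notin> A" for x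
  proof
    assume x: "x \<in> A"
    then have "x \<in> space X" using sets.sets_into_space[OF 0(1)] by blast
    then have "f x \<in> space X" using measurable_space[OF f] by blast
    then have "{x' \<in> A. f x' = f x} = {}" using 0(2)[of "f x"] card_0_eq by auto
    then show False using x by blast
  qed
  then have "A = {}" by blast
  then show ?case by simp
next
  case (Suc k)
  have AX: "A \<subseteq> space X" using sets.sets_into_space[OF Suc.prems(1)] .
  define piece where "piece s i = A \<inter> V (s ! i) - (\<Union>j\<in>{..k} - {i}. V (s ! j))" for s i
  define Z where "Z s = {w \<in> space (power_space k). \<forall>i\<in>{..k}. w i \<in> piece s i \<and> f (w i) = f (w 0)}" for s
  have piece_sets: "piece s i \<in> sets X" for s i
    unfolding piece_def using V_sets Suc.prems(1) by (intro sets.Diff sets.Int sets.finite_UN) auto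
  have piece_disj: "piece s i \<inter> piece s j = {}" if "i \<le> k" "j \<le> k" "i \<noteq> j" for s i j
    using that by (auto simp: piece_def)
  have Z_sets: "Z s \<in> sets (power_space k)" for s
  proof -
    have 1: "{w \<in> space (power_space k). w i \<in> piece s i} \<in> sets (power_space k)" if "i \<in> {..k}" for i
      using measurable_sets[OF power_space_component piece_sets[of s i], of i k] that
      by (simp add: vimage_def Int_def conj_commute)
    have 2: "{w \<in> space (power_space k). f (w i) = f (w 0)} \<in> sets (power_space k)" if "i \<in> {..k}" for i
      using that measurable_compose[OF power_space_component f]
      by (intro equalizer_sets[OF separates_points_V]) auto
    have "Z s = (\<Inter>i\<in>{..k}. {w \<in> space (power_space k). w i \<in> piece s i} \<inter>
        {w \<in> space (power_space k). f (w i) = f (w 0)})"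
      using atMost_iff[of 0 k] unfolding Z_def by blast
    also have "\<dots> \<in> sets (power_space k)" using 1 2 by (intro sets.finite_INT sets.Int) auto
    finally show ?thesis .
  qed
  define g where "g w = f (w 0)" for w :: "nat \<Rightarrow> 'a"
  have g: "g \<in> power_space k \<rightarrow>\<^sub>M X"
    unfolding g_def using measurable_compose[OF power_space_component f] by simp
  have wA: "w i \<in> A" "f (w i) = g w" if "w \<in> Z s" "i \<le> k" for w s i
    using that unfolding Z_def piece_def g_def by blast+
  have Z_piece: "w i \<in> piece s i" if "w \<in> Z s" "i \<le> k" for w s i
    using that unfolding Z_def by blast
  have Z_space: "w \<in> space (power_space k)" if "w \<in> Z s" for w s
    using that unfolding Z_def by blast
  have inj: "inj_on g (Z s)" for s
  proof (rule inj_onI)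
    fix w w' assume w: "w \<in> Z s" and w': "w' \<in> Z s" and eq: "g w = g w'"
    have gX: "g w \<in> space X" using Z_space[OF w] measurable_space[OF g] by blast
    have inj_w: "inj_on w {..k}"
    proof (rule inj_onI)
      fix i j assume ij: "i \<in> {..k}" "j \<in> {..k}" "w i = w j"
      then have "w i \<in> piece s i" "w i \<in> piece s j"
        using Z_piece[OF w, of i] Z_piece[OF w, of j] by simp_all
      then show "i = j" using piece_disj[of i j s] ij by blast
    qed
    have "w i = w' i" if i: "i \<le> k" for i
    proof (rule ccontr)
      assume ne: "w i \<noteq> w' i"
      have "w' i \<notin> w ` {..k}"
      proof
        assume "w' i \<in> w ` {..k}"
        then obtain j where j: "j \<le> k" "w' i = w j" by auto
        then have "w' i \<in> piece s i" "w' i \<in> piece s j"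
          using Z_piece[OF w' i] Z_piece[OF w j(1)] by simp_all
        then have "i = j" using piece_disj[of i j s] i j by blast
        then show False using j ne by simp
      qed
      then have "card (insert (w' i) (w ` {..k})) = Suc (Suc k)"
        using inj_w by (simp add: card_image)
      moreover have "insert (w' i) (w ` {..k}) \<subseteq> {x \<in> A. f x = g w}"
        using wA[OF w] wA[OF w' i] eq by auto
      ultimately have "Suc (Suc k) \<le> card {x \<in> A. f x = g w}"
        using Suc.prems(2)[OF gX] by (metis card_mono)
      then show False using Suc.prems(2)[OF gX] by simp
    qed
    then show "w = w'" using Z_space[OF w] Z_space[OF w'] unfolding space_power_space
      by (intro PiE_ext[of w "{..k}" "\<lambda>_. space X" w']) auto
  qed
  define Y where "Y = (\<Union>s::nat list. g ` Z s)"
  obtain V' P' where S: "souslin_space (power_space k) V' P'" using power_space_souslin by blast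
  have "g ` Z s \<in> sets X" for s
    by (rule souslin_space.injective_image_borel[OF S separates_points_V g Z_sets inj])
  then have Y: "Y \<in> sets X" unfolding Y_def by (intro sets.countable_UN) auto
  have YA: "Y \<subseteq> f ` A" using wA[of _ _ 0] unfolding Y_def by (auto simp: image_iff) (metis)
  define A' where "A' = A - (f -` Y \<inter> space X)"
  have A': "A' \<in> sets X" unfolding A'_def using Suc.prems(1) measurable_sets[OF f Y] by auto
  have "f ` A' \<in> sets X"
  proof (rule Suc.IH[OF A'])
    fix y assume y: "y \<in> space X"
    have sub: "{x \<in> A'. f x = y} \<subseteq> {x \<in> A. f x = y}" by (auto simp: A'_def)
    have fin: "finite {x \<in> A. f x = y}" using Suc.prems(2)[OF y] by blast
    have "card {x \<in> A'. f x = y} \<le> k"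
    proof (cases "y \<in> Y")
      case True
      then have "{x \<in> A'. f x = y} = {}" using AX by (auto simp: A'_def)
      then show ?thesis by (metis card.empty le0)
    next
      case False
      \<comment> \<open>With \<open>k + 1\<close> preimages, isolating neighbourhoods would place \<open>y\<close> in \<open>Y\<close>.\<close>
      have "card {x \<in> A. f x = y} \<le> k"
      proof (rule ccontr)
        assume "\<not> ?thesis"
        then have "card {x \<in> A. f x = y} = Suc k" using Suc.prems(2)[OF y] by simp
        then obtain h where h: "bij_betw h {..<Suc k} {x \<in> A. f x = y}"
          using fin by (metis ex_bij_betw_nat_finite atLeast0LessThan)
        have hA: "h i \<in> A" "f (h i) = y" if "i \<le> k" for i
          using bij_betwE[OF h] that by (auto simp: less_Suc_eq_le)
        have h_inj: "h i \<noteq> h j" if "i \<le> k" "j \<le> k" "i \<noteq> j" for i j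
          using bij_betw_imp_inj_on[OF h] that by (auto simp: inj_on_def less_Suc_eq_le)
        have "\<exists>m. h i \<in> V m \<and> V m \<inter> (h ` ({..k} - {i})) = {}" if "i \<le> k" for i
          using hA[OF that] AX h_inj[OF that] by (intro isolating) auto
        then obtain m where m: "\<And>i. i \<le> k \<Longrightarrow> h i \<in> V (m i)"
            "\<And>i. i \<le> k \<Longrightarrow> V (m i) \<inter> (h ` ({..k} - {i})) = {}" by metis
        define s where "s = map m [0..<Suc k]"
        have s: "s ! i = m i" if "i \<le> k" for i
          using that unfolding s_def by (simp del: upt_Suc)
        have "h i \<in> piece s i" if "i \<le> k" for i
        proof -
          have "h i \<notin> V (m j)" if "j \<le> k" "j \<noteq> i" for j
            using m(2)[OF that(1)] \<open>i \<le> k\<close> that by blast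
          then show ?thesis using hA(1)[OF that] m(1)[OF that] s that by (auto simp: piece_def)
        qed
        then have "restrict h {..k} \<in> Z s"
          using hA AX by (auto simp: Z_def space_power_space)
        moreover have "g (restrict h {..k}) = y" using hA(2)[of 0] by (simp add: g_def)
        ultimately have "y \<in> Y" unfolding Y_def by blast
        then show False using False by blast
      qed
      then show ?thesis using card_mono[OF fin sub] by simp
    qed
    then show "finite {x \<in> A'. f x = y} \<and> card {x \<in> A'. f x = y} \<le> k"
      using finite_subset[OF sub fin] by blast
  qed
  moreover have "f ` A = Y \<union> f ` A'" using YA by (auto simp: A'_def dest: subsetD[OF AX])
  ultimately show ?case using Y by (simp add: sets.Un)
qed

end


section \<open>Components, colorings and witnesses\<close>

text \<open>\<open>N k\<close> stands for the pairs of points at distance at most \<open>k\<close>; the arguments about asymptotic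
  dimension need these relations only.\<close>

locale ball_relations =
  fixes V :: "'x set" and N :: "nat \<Rightarrow> 'x rel"
  assumes ball_sub: "(x, y) \<in> N k \<Longrightarrow> x \<in> V \<and> y \<in> V"
    and ball_refl: "x \<in> V \<Longrightarrow> (x, x) \<in> N k"
    and ball_sym: "(x, y) \<in> N k \<Longrightarrow> (y, x) \<in> N k"
    and ball_trans: "\<lbrakk>(x, y) \<in> N a; (y, z) \<in> N b\<rbrakk> \<Longrightarrow> (x, z) \<in> N (a + b)"
    and ball_mono: "\<lbrakk>a \<le> b; (x, y) \<in> N a\<rbrakk> \<Longrightarrow> (x, y) \<in> N b"
begin

text \<open>The classes of this equivalence relation on \<open>Y\<close> are the \<open>s\<close>-components of \<open>Y\<close>.\<close>

definition chain :: "nat \<Rightarrow> 'x set \<Rightarrow> 'x rel" where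
  "chain s Y = (N s \<inter> Y \<times> Y)\<^sup>*"

definition components_bounded :: "nat \<Rightarrow> nat \<Rightarrow> 'x set \<Rightarrow> bool" where
  "components_bounded s R Y \<longleftrightarrow> (\<forall>x\<in>Y. \<forall>y. (x, y) \<in> chain s Y \<longrightarrow> (x, y) \<in> N R)"

definition coloring_bounded :: "nat \<Rightarrow> nat \<Rightarrow> nat \<Rightarrow> 'x set \<Rightarrow> ('x \<Rightarrow> nat) \<Rightarrow> bool" where
  "coloring_bounded d s R Y c \<longleftrightarrow>
     (\<forall>x\<in>V. c x \<le> d) \<and> (\<forall>i. components_bounded s R {x \<in> Y. c x = i})"

definition witness :: "nat \<Rightarrow> nat \<Rightarrow> ('x \<Rightarrow> 'x) \<Rightarrow> bool" where
  "witness d s f \<longleftrightarrow> (\<exists>b. \<forall>x\<in>V. (x, f x) \<in> N b) \<and>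
     (\<forall>x\<in>V. finite (f ` (N s `` {x})) \<and> card (f ` (N s `` {x})) \<le> d + 1)"

lemma components_boundedD:
  "components_bounded s R Y \<Longrightarrow> x \<in> Y \<Longrightarrow> (x, y) \<in> chain s Y \<Longrightarrow> (x, y) \<in> N R"
  by (auto simp: components_bounded_def)

lemma chain_refl: "(x, x) \<in> chain s Y"
  by (simp add: chain_def)

lemma chain_trans: "(x, y) \<in> chain s Y \<Longrightarrow> (y, z) \<in> chain s Y \<Longrightarrow> (x, z) \<in> chain s Y"
  unfolding chain_def by (rule rtrancl_trans)

lemma chain_step: "(x, y) \<in> N s \<Longrightarrow> x \<in> Y \<Longrightarrow> y \<in> Y \<Longrightarrow> (x, y) \<in> chain s Y"
  unfolding chain_def by blast

lemma chain_sym: "(x, y) \<in> chain s Y \<Longrightarrow> (y, x) \<in> chain s Y"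
proof -
  have "sym (N s \<inter> Y \<times> Y)" using ball_sym by (auto intro!: symI)
  then show "(x, y) \<in> chain s Y \<Longrightarrow> (y, x) \<in> chain s Y"
    unfolding chain_def using sym_rtrancl symD by metis
qed

lemma chain_induct [consumes 1, case_names refl step]:
  assumes "(x, y) \<in> chain s Y" "P x"
    and "\<And>y z. \<lbrakk>(x, y) \<in> chain s Y; (y, z) \<in> N s; y \<in> Y; z \<in> Y; P y\<rbrakk> \<Longrightarrow> P z"
  shows "P y"
  using assms(1) unfolding chain_def
proof (induction rule: rtrancl_induct)
  case (step y z)
  then show ?case using assms(3)[of y z] by (auto simp: chain_def)
qed (rule assms(2))

lemma chain_in: "(x, y) \<in> chain s Y \<Longrightarrow> x \<in> Y \<Longrightarrow> y \<in> Y"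
  by (induction rule: chain_induct) auto

lemma chain_mono:
  assumes "(x, y) \<in> chain s Y" "s \<le> t" "Y \<subseteq> Z"
  shows "(x, y) \<in> chain t Z"
  using assms(1)
proof (induction rule: chain_induct)
  case refl
  show ?case by (rule chain_refl)
next
  case (step y z)
  have "(y, z) \<in> chain t Z"
    using step assms(2,3) ball_mono by (intro chain_step) auto
  then show ?case using step.IH chain_trans by blast
qed

lemma components_bounded_mono:
  assumes "components_bounded t R Z" "s \<le> t" "Y \<subseteq> Z"
  shows "components_bounded s R Y"
  using assms chain_mono unfolding components_bounded_def by blast

text \<open>Between two consecutive visits to \<open>B\<close>, an \<open>s\<close>-chain in \<open>A \<union> B\<close> moves by at most
  \<open>R + 2 * s\<close>. Hence all its visits to \<open>B\<close> lie in one \<open>(R + 2 * s)\<close>-component of \<open>B\<close>, and only the parts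
  before the first and after the last visit add to the diameter. This merges colorings of two pieces
  without using new colors.\<close>

lemma components_bounded_Un:
  assumes A: "components_bounded s R A" "A \<subseteq> V"
    and B: "components_bounded (R + 2 * s) Q B" "B \<subseteq> V"
  shows "components_bounded s (Q + 2 * (s + R)) (A \<union> B)"
  unfolding components_bounded_def
proof (intro ballI allI impI)
  fix x y assume x: "x \<in> A \<union> B" and xy: "(x, y) \<in> chain s (A \<union> B)"
  \<comment> \<open>\<open>inA y\<close>: the chain from \<open>x\<close> to \<open>y\<close> has stayed in \<open>A\<close>; \<open>viaB y\<close>: it first meets \<open>B\<close> near \<open>x\<close>,
    at \<open>b\<close>, and has met \<open>B\<close> most recently at \<open>b'\<close>.\<close>
  define inA where "inA y \<longleftrightarrow> x \<in> A \<and> (x, y) \<in> chain s A" for y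
  define viaB where "viaB y \<longleftrightarrow> (\<exists>b\<in>B. \<exists>b'\<in>B. (x, b) \<in> N (s + R) \<and> (b, b') \<in> chain (R + 2 * s) B \<and>
      (y = b' \<or> (\<exists>a\<in>A. (b', a) \<in> N s \<and> (a, y) \<in> chain s A)))" for y
  have "inA y \<or> viaB y" using xy
  proof (induction rule: chain_induct)
    case refl
    show ?case
    proof (cases "x \<in> A")
      case True then show ?thesis by (simp add: inA_def chain_refl)
    next
      case False
      then have "x \<in> B" using x by blast
      then have "viaB x" unfolding viaB_def using B(2) ball_refl chain_refl by blast
      then show ?thesis ..
    qed
  next
    case (step y z)
    from step.IH show ?case
    proof
      assume y: "inA y"
      then have yA: "y \<in> A" using chain_in inA_def by blast
      have xyR: "(x, y) \<in> N R" using y components_boundedD[OF A(1)] inA_def by blast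
      show ?thesis
      proof (cases "z \<in> A")
        case True
        then have "inA z" using y yA step.hyps chain_step chain_trans unfolding inA_def by blast
        then show ?thesis ..
      next
        case False
        then have zB: "z \<in> B" using step.hyps by blast
        have "(x, z) \<in> N (s + R)" using ball_trans[OF xyR step.hyps(2)] by (simp add: add.commute)
        then have "viaB z" using zB chain_refl unfolding viaB_def by blast
        then show ?thesis ..
      qed
    next
      assume "viaB y"
      then obtain b b' where b: "b \<in> B" "b' \<in> B" "(x, b) \<in> N (s + R)" "(b, b') \<in> chain (R + 2 * s) B"
        and y: "y = b' \<or> (\<exists>a\<in>A. (b', a) \<in> N s \<and> (a, y) \<in> chain s A)" unfolding viaB_def by blast
      have "viaB z"
      proof (cases "z \<in> B")
        case True
        have "(b', z) \<in> N (R + 2 * s)" using y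
        proof
          assume "y = b'"
          then show ?thesis using ball_mono[of s "R + 2 * s" b' z] step.hyps by simp
        next
          assume "\<exists>a\<in>A. (b', a) \<in> N s \<and> (a, y) \<in> chain s A"
          then obtain a where a: "a \<in> A" "(b', a) \<in> N s" "(a, y) \<in> chain s A" by blast
          have "(a, y) \<in> N R" using components_boundedD[OF A(1)] a by blast
          from ball_trans[OF ball_trans[OF a(2) this] step.hyps(2)] show ?thesis
            by (rule ball_mono[rotated]) simp
        qed
        then have "(b', z) \<in> chain (R + 2 * s) B" using b(2) True by (intro chain_step)
        then have "(b, z) \<in> chain (R + 2 * s) B" using b(4) chain_trans by blast
        then show ?thesis unfolding viaB_def using True b by blast
      next
        case False
        then have zA: "z \<in> A" using step.hyps by blast
        show ?thesis using y
        proof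
          assume "y = b'"
          then show ?thesis unfolding viaB_def using b zA step.hyps chain_refl by blast
        next
          assume "\<exists>a\<in>A. (b', a) \<in> N s \<and> (a, y) \<in> chain s A"
          then obtain a where a: "a \<in> A" "(b', a) \<in> N s" "(a, y) \<in> chain s A" by blast
          have "y \<in> A" using a chain_in by blast
          then have "(a, z) \<in> chain s A" using chain_trans[OF a(3) chain_step[OF step.hyps(2)]] zA by blast
          then show ?thesis unfolding viaB_def using b a by blast
        qed
      qed
      then show ?thesis ..
    qed
  qed
  then show "(x, y) \<in> N (Q + 2 * (s + R))"
  proof
    assume "inA y"
    then have "(x, y) \<in> N R" using components_boundedD[OF A(1)] unfolding inA_def by blast
    then show ?thesis by (rule ball_mono[rotated]) simp
  next
    assume "viaB y"
    then obtain b b' where b: "b \<in> B" "b' \<in> B" "(x, b) \<in> N (s + R)" "(b, b') \<in> chain (R + 2 * s) B"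
      and y: "y = b' \<or> (\<exists>a\<in>A. (b', a) \<in> N s \<and> (a, y) \<in> chain s A)" unfolding viaB_def by blast
    have "(b, b') \<in> N Q" using components_boundedD[OF B(1)] b by blast
    then have xb': "(x, b') \<in> N (s + R + Q)" using ball_trans b(3) by blast
    have "(b', y) \<in> N (s + R)" using y
    proof
      assume "y = b'"
      then show ?thesis using b(2) B(2) ball_refl by blast
    next
      assume "\<exists>a\<in>A. (b', a) \<in> N s \<and> (a, y) \<in> chain s A"
      then obtain a where a: "a \<in> A" "(b', a) \<in> N s" "(a, y) \<in> chain s A" by blast
      then have "(a, y) \<in> N R" using components_boundedD[OF A(1)] by blast
      then show ?thesis using ball_trans a(2) by blast
    qed
    from ball_trans[OF xb' this] show ?thesis by (rule ball_mono[rotated]) simp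
  qed
qed

text \<open>At the largest \<open>j \<le> d\<close> for which \<open>f\<close> takes \<open>j + 1\<close> values on the ball of radius \<open>j * r\<close>, the
  set of values cannot grow when the radius increases by \<open>r\<close>.\<close>

definition witness_color :: "nat \<Rightarrow> nat \<Rightarrow> ('x \<Rightarrow> 'x) \<Rightarrow> 'x \<Rightarrow> nat" where
  "witness_color d r f x = Max {j. j \<le> d \<and> j + 1 \<le> card (f ` (N (j * r) `` {x}))}"

lemma witness_color_spec:
  assumes f: "witness d ((d + 1) * r) f" and x: "x \<in> V"
  defines "j \<equiv> witness_color d r f x"
  shows "j \<le> d" "card (f ` (N (j * r) `` {x})) = j + 1" "finite (f ` (N (j * r) `` {x}))"
    "f ` (N ((j + 1) * r) `` {x}) = f ` (N (j * r) `` {x})"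
proof -
  define S where "S = {j. j \<le> d \<and> j + 1 \<le> card (f ` (N (j * r) `` {x}))}"
  have fin: "finite (f ` (N (i * r) `` {x}))" if "i \<le> d + 1" for i
  proof (rule finite_subset)
    show "f ` (N (i * r) `` {x}) \<subseteq> f ` (N ((d + 1) * r) `` {x})"
      using ball_mono[of "i * r" "(d + 1) * r" x] mult_le_mono1[OF that, of r] by blast
    show "finite (f ` (N ((d + 1) * r) `` {x}))" using f x by (auto simp: witness_def)
  qed
  have "x \<in> N (0 * r) `` {x}" using ball_refl[OF x] by simp
  then have "f ` (N (0 * r) `` {x}) \<noteq> {}" by blast
  then have "1 \<le> card (f ` (N (0 * r) `` {x}))" using fin[of 0] by (simp add: Suc_le_eq card_gt_0_iff)
  then have "0 \<in> S" by (simp add: S_def)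
  moreover have finS: "finite S" by (simp add: S_def)
  ultimately have "j \<in> S" unfolding j_def witness_color_def S_def[symmetric] using Max_in by blast
  then have j: "j \<le> d" "j + 1 \<le> card (f ` (N (j * r) `` {x}))" by (auto simp: S_def)
  have "card (f ` (N ((j + 1) * r) `` {x})) \<le> j + 1"
  proof (cases "j = d")
    case True then show ?thesis using f x by (auto simp: witness_def)
  next
    case False
    have "j + 1 \<notin> S"
    proof
      assume "j + 1 \<in> S"
      then have "j + 1 \<le> j" unfolding j_def witness_color_def S_def[symmetric] using finS by (rule Max_ge[rotated])
      then show False by simp
    qed
    then show ?thesis using False j(1) by (auto simp: S_def)
  qed
  moreover have sub: "f ` (N (j * r) `` {x}) \<subseteq> f ` (N ((j + 1) * r) `` {x})"
    using ball_mono[of "j * r" "(j + 1) * r" x] by auto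
  ultimately have eq: "f ` (N (j * r) `` {x}) = f ` (N ((j + 1) * r) `` {x})"
    using j fin[of "j + 1"] by (intro card_seteq) auto
  then show "f ` (N ((j + 1) * r) `` {x}) = f ` (N (j * r) `` {x})" by simp
  show "j \<le> d" "finite (f ` (N (j * r) `` {x}))" using j fin[of j] by auto
  show "card (f ` (N (j * r) `` {x})) = j + 1"
    using eq j(2) \<open>card (f ` (N ((j + 1) * r) `` {x})) \<le> j + 1\<close> by simp
qed

text \<open>Neighbours of the same color \<open>j\<close> have the same set of values on their balls of radius \<open>j * r\<close>:
  each ball lies in the next larger ball about the other point, which has no new values, and both
  sets have \<open>j + 1\<close> elements. So along a monochromatic chain this set is constant, and every point of the
  chain is near each of its elements.\<close>

lemma witness_color_bounded:
  assumes f: "witness d ((d + 1) * r) f"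
  shows "\<exists>R. coloring_bounded d r R V (witness_color d r f)"
proof -
  define c where "c = witness_color d r f"
  define F where "F j x = f ` (N (j * r) `` {x})" for j x
  obtain b where b: "\<And>x. x \<in> V \<Longrightarrow> (x, f x) \<in> N b" using f by (auto simp: witness_def)
  have step: "F j x = F j y" if "(x, y) \<in> N r" "c x = j" "c y = j" for x y j
  proof -
    have V: "x \<in> V" "y \<in> V" using that ball_sub by blast+
    have sub: "F j y \<subseteq> F (j + 1) x"
    proof -
      have "(x, z) \<in> N ((j + 1) * r)" if "(y, z) \<in> N (j * r)" for z
        using ball_trans[OF \<open>(x, y) \<in> N r\<close> that] by (simp add: algebra_simps)
      then show ?thesis unfolding F_def by blast
    qed
    have "F (j + 1) x = F j x" "finite (F j x)" "card (F j x) = j + 1"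
      using witness_color_spec[OF f V(1)] that(2) by (simp_all add: F_def c_def)
    moreover have "card (F j y) = j + 1"
      using witness_color_spec[OF f V(2)] that(3) by (simp_all add: F_def c_def)
    ultimately show ?thesis using sub card_subset_eq by metis
  qed
  define R where "R = 2 * (d * r + b)"
  have "components_bounded r R {x \<in> V. c x = j}" for j
    unfolding components_bounded_def
  proof (intro ballI allI impI)
    fix x y assume x: "x \<in> {x \<in> V. c x = j}" and xy: "(x, y) \<in> chain r {x \<in> V. c x = j}"
    have eq: "F j x = F j y" using xy
    proof (induction rule: chain_induct)
      case (step y z)
      then show ?case using \<open>\<And>x y j. \<lbrakk>(x, y) \<in> N r; c x = j; c y = j\<rbrakk> \<Longrightarrow> F j x = F j y\<close>[of y z j] by simp
    qed simp
    have y: "y \<in> V" using chain_in[OF xy x] by simp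
    have jd: "j \<le> d" using witness_color_spec(1)[OF f, of x] x by (simp add: c_def)
    have near: "(u, w) \<in> N (d * r + b)" if w: "w \<in> F j u" for u w
    proof -
      obtain z where z: "(u, z) \<in> N (j * r)" "w = f z" using w unfolding F_def by blast
      have "(u, z) \<in> N (d * r)" using ball_mono[OF _ z(1)] jd by simp
      moreover have "(z, w) \<in> N b" using b z ball_sub by blast
      ultimately show ?thesis by (rule ball_trans)
    qed
    have "f x \<in> F j x" using ball_refl x unfolding F_def by blast
    then have "(x, f x) \<in> N (d * r + b)" "(y, f x) \<in> N (d * r + b)" using near eq by blast+
    from ball_trans[OF this(1) ball_sym[OF this(2)]] show "(x, y) \<in> N R"
      unfolding R_def by (rule ball_mono[rotated]) simp
  qed
  moreover have "\<forall>x\<in>V. c x \<le> d" using witness_color_spec(1)[OF f] by (simp add: c_def)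
  ultimately show ?thesis unfolding coloring_bounded_def c_def by blast
qed

end


section \<open>Finite Borel colorings\<close>

text \<open>Greedy constructions stay Borel because neighbourhoods of Borel sets are Borel; they end after
  finitely many steps because the degrees are bounded.\<close>

locale borel_balls = ball_relations "space X" N
  for X :: "'x measure" and N :: "nat \<Rightarrow> 'x rel" +
  fixes U :: "nat \<Rightarrow> 'x set"
  assumes ball_borel: "B \<in> sets X \<Longrightarrow> N k `` B \<in> sets X"
    and ball_finite: "\<exists>K. \<forall>x\<in>space X. finite (N k `` {x}) \<and> card (N k `` {x}) \<le> K"
    and U_sets: "U n \<in> sets X"
    and U_isolating: "\<lbrakk>x \<in> space X; finite F; x \<notin> F\<rbrakk> \<Longrightarrow> \<exists>n. x \<in> U n \<and> U n \<inter> F = {}"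
begin

definition borel_coloring :: "('x \<Rightarrow> nat) \<Rightarrow> bool" where
  "borel_coloring c \<longleftrightarrow> (\<forall>j. {x \<in> space X. c x = j} \<in> sets X)"

lemma separates_points_U: "separates_points X U"
  unfolding separates_points_def
proof (intro conjI allI ballI impI)
  fix x y assume xy: "x \<in> space X" "y \<in> space X" "\<forall>k. x \<in> U k \<longleftrightarrow> y \<in> U k"
  show "x = y"
  proof (rule ccontr)
    assume "x \<noteq> y"
    then obtain n where "x \<in> U n" "U n \<inter> {y} = {}" using U_isolating[OF xy(1), of "{y}"] by auto
    then show False using xy(3) by blast
  qed
qed (rule U_sets)

lemma punctured_ball_borel:
  assumes "B \<in> sets X"
  shows "(N k - Id) `` B \<in> sets X"
proof -
  have "(N k - Id) `` B = (\<Union>n. N k `` (B \<inter> U n) - U n)"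
  proof (intro equalityI subsetI)
    fix y assume "y \<in> (N k - Id) `` B"
    then obtain x where x: "x \<in> B" "(x, y) \<in> N k" "x \<noteq> y" by blast
    then obtain n where "x \<in> U n" "U n \<inter> {y} = {}" using U_isolating[of x "{y}"] ball_sub by blast
    then show "y \<in> (\<Union>n. N k `` (B \<inter> U n) - U n)" using x by blast
  qed blast
  also have "\<dots> \<in> sets X"
    using ball_borel assms U_sets by (intro sets.countable_UN) auto
  finally show ?thesis .
qed

text \<open>Each point is isolated from its neighbours by some \<open>U n\<close>, so the independent sets \<open>A n\<close> cover
  the space. They are processed in turn, adding the points of \<open>A n\<close> that have no neighbour among the
  points already chosen.\<close>

lemma borel_maximal_independent:
  assumes Y: "Y \<in> sets X"
  shows "\<exists>I\<in>sets X. I \<subseteq> Y \<and> (\<forall>x\<in>I. \<forall>y\<in>I. (x, y) \<notin> N k - Id) \<and> Y \<subseteq> I \<union> (N k - Id) `` I"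
proof -
  define G where "G = N k - Id"
  have G_sym: "(y, x) \<in> G" if "(x, y) \<in> G" for x y using that ball_sym by (auto simp: G_def)
  have G_borel: "G `` B \<in> sets X" if "B \<in> sets X" for B
    using punctured_ball_borel[OF that] by (simp add: G_def)
  define A where "A n = U n - G `` U n" for n
  have A_sets: "A n \<in> sets X" for n unfolding A_def using U_sets G_borel by auto
  have A_indep: "(x, y) \<notin> G" if "x \<in> A n" "y \<in> A n" for x y n
    using that by (auto simp: A_def)
  have A_cover: "\<exists>n. x \<in> A n" if x: "x \<in> space X" for x
  proof -
    have "finite (G `` {x})"
      using ball_finite[of k] x by (auto simp: G_def intro: finite_subset[of _ "N k `` {x}"])
    moreover have "x \<notin> G `` {x}" by (auto simp: G_def)
    ultimately obtain n where "x \<in> U n" "U n \<inter> G `` {x} = {}" using U_isolating[OF x] by blast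
    then have "x \<in> A n" using G_sym by (auto simp: A_def)
    then show ?thesis ..
  qed
  define I where "I = rec_nat {} (\<lambda>n I. I \<union> ((A n \<inter> Y) - G `` I))"
  have I0: "I 0 = {}" and IS: "I (Suc n) = I n \<union> ((A n \<inter> Y) - G `` I n)" for n by (simp_all add: I_def)
  have I_sets: "I n \<in> sets X" for n
    by (induction n) (use A_sets Y G_borel in \<open>auto simp: I0 IS\<close>)
  have I_Y: "I n \<subseteq> Y" for n by (induction n) (auto simp: I0 IS)
  have I_indep: "(x, y) \<notin> G" if "x \<in> I n" "y \<in> I n" for x y n
    using that
  proof (induction n arbitrary: x y)
    case (Suc n)
    then show ?case using A_indep[of x n y] G_sym[of x y] by (auto simp: IS)
  qed (simp add: I0)
  have I_mono: "I m \<subseteq> I n" if "m \<le> n" for m n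
    using lift_Suc_mono_le[of I m n] that by (simp add: IS)
  show ?thesis unfolding G_def[symmetric]
  proof (intro bexI[of _ "\<Union>n. I n"] conjI ballI)
    show "(\<Union>n. I n) \<in> sets X" using I_sets by auto
    show "(\<Union>n. I n) \<subseteq> Y" using I_Y by blast
    fix x y assume "x \<in> (\<Union>n. I n)" "y \<in> (\<Union>n. I n)"
    then obtain m n where "x \<in> I m" "y \<in> I n" by blast
    then have "x \<in> I (max m n)" "y \<in> I (max m n)"
      using I_mono[of m "max m n"] I_mono[of n "max m n"] by auto
    then show "(x, y) \<notin> G" by (rule I_indep)
  next
    show "Y \<subseteq> (\<Union>n. I n) \<union> G `` (\<Union>n. I n)"
    proof
      fix y assume y: "y \<in> Y"
      then obtain n where "y \<in> A n" using A_cover sets.sets_into_space[OF Y] by blast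
      then have "y \<in> I (Suc n) \<or> y \<in> G `` I n" using y by (auto simp: IS)
      then show "y \<in> (\<Union>n. I n) \<union> G `` (\<Union>n. I n)" by blast
    qed
  qed
qed

text \<open>This is the theorem of Kechris, Solecki and Todorcevic for bounded degree: each color class is a
  maximal independent set among the points not yet colored.\<close>

proposition finite_borel_coloring:
  obtains e p where "borel_coloring e" "\<And>x. x \<in> space X \<Longrightarrow> e x < p"
    "\<And>x y. (x, y) \<in> N k \<Longrightarrow> e x = e y \<Longrightarrow> x = y"
proof -
  define M where "M Y = (SOME I. I \<in> sets X \<and> I \<subseteq> Y \<and>
    (\<forall>x\<in>I. \<forall>y\<in>I. (x, y) \<notin> N k - Id) \<and> Y \<subseteq> I \<union> (N k - Id) `` I)" for Y
  have M: "M Y \<in> sets X" "M Y \<subseteq> Y" "\<And>x y. x \<in> M Y \<Longrightarrow> y \<in> M Y \<Longrightarrow> (x, y) \<notin> N k - Id"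
    "Y \<subseteq> M Y \<union> (N k - Id) `` M Y" if Y: "Y \<in> sets X" for Y
  proof -
    have "\<exists>I. I \<in> sets X \<and> I \<subseteq> Y \<and>
      (\<forall>x\<in>I. \<forall>y\<in>I. (x, y) \<notin> N k - Id) \<and> Y \<subseteq> I \<union> (N k - Id) `` I"
      using borel_maximal_independent[OF Y, of k] by blast
    from someI_ex[OF this] show "M Y \<in> sets X" "M Y \<subseteq> Y"
      "\<And>x y. x \<in> M Y \<Longrightarrow> y \<in> M Y \<Longrightarrow> (x, y) \<notin> N k - Id" "Y \<subseteq> M Y \<union> (N k - Id) `` M Y"
      unfolding M_def[symmetric] by blast+
  qed
  define Y where "Y = rec_nat (space X) (\<lambda>_ Y. Y - M Y)"
  have Y0: "Y 0 = space X" and YS: "Y (Suc n) = Y n - M (Y n)" for n by (simp_all add: Y_def)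
  have Y_sets: "Y n \<in> sets X" for n by (induction n) (auto simp: Y0 YS M(1))
  have Y_anti: "Y n \<subseteq> Y m" if "m \<le> n" for m n
    using lift_Suc_antimono_le[of Y m n] that by (simp add: YS Diff_subset)
  define I where "I n = M (Y n)" for n
  have I_sets: "I n \<in> sets X" for n using M(1)[OF Y_sets] by (simp add: I_def)
  have I_less: "I m \<inter> I n = {}" if "m < n" for m n
    using Y_anti[of "Suc m" n] M(2)[OF Y_sets[of n]] that by (auto simp: I_def YS)
  have I_disj: "m = n" if "x \<in> I m" "x \<in> I n" for x m n
    using that I_less[of m n] I_less[of n m] by (cases m n rule: linorder_cases) auto
  obtain K where K: "\<And>x. x \<in> space X \<Longrightarrow> finite (N k `` {x}) \<and> card (N k `` {x}) \<le> K"
    using ball_finite[of k] by blast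
  \<comment> \<open>A point outside the first \<open>K + 1\<close> independent sets has a neighbour in each of them.\<close>
  have ex: "\<exists>n<K + 1. x \<in> I n" if x: "x \<in> space X" for x
  proof (rule ccontr)
    assume not: "\<not> ?thesis"
    have xY: "x \<in> Y n" if "n \<le> K + 1" for n
      using that by (induction n) (use x not in \<open>auto simp: Y0 YS I_def\<close>)
    have "\<exists>z. z \<in> I n \<and> (x, z) \<in> N k" if "n < K + 1" for n
    proof -
      have "x \<in> Y n" "x \<notin> I n" using xY[of n] not that by auto
      then have "x \<in> (N k - Id) `` I n" using M(4)[OF Y_sets[of n]] by (auto simp: I_def)
      then show ?thesis using ball_sym by blast
    qed
    then obtain z where z: "\<And>n. n < K + 1 \<Longrightarrow> z n \<in> I n \<and> (x, z n) \<in> N k" by metis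
    have "inj_on z {..<K + 1}"
    proof (rule inj_onI)
      fix m n assume "m \<in> {..<K + 1}" "n \<in> {..<K + 1}" "z m = z n"
      then show "m = n" using z[of m] z[of n] I_disj[of "z m" m n] by simp
    qed
    then have "card (z ` {..<K + 1}) = K + 1" by (simp add: card_image)
    moreover have "z ` {..<K + 1} \<subseteq> N k `` {x}" using z by auto
    ultimately have "K + 1 \<le> card (N k `` {x})" using K[OF x] by (metis card_mono)
    then show False using K[OF x] by simp
  qed
  define e where "e x = (LEAST n. x \<in> I n)" for x
  have e: "e x = n" if "x \<in> I n" for x n
    unfolding e_def using that I_disj[OF that] by (metis LeastI)
  have eI: "x \<in> I (e x)" "e x < K + 1" if "x \<in> space X" for x
    using ex[OF that] e by auto
  show ?thesis
  proof (rule that)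
    have "{x \<in> space X. e x = j} = I j" for j
      using eI e[of _ j] sets.sets_into_space[OF I_sets[of j]] by blast
    then show "borel_coloring e" using I_sets by (simp add: borel_coloring_def)
    show "e x < K + 1" if "x \<in> space X" for x by (rule eI(2)[OF that])
    fix x y assume xy: "(x, y) \<in> N k" "e x = e y"
    have "x \<in> I (e x)" using eI(1) ball_sub[OF xy(1)] by blast
    moreover have "y \<in> I (e x)" unfolding xy(2) using eI(1) ball_sub[OF xy(1)] by blast
    ultimately have "(x, y) \<notin> N k - Id" using M(3)[OF Y_sets] unfolding I_def by blast
    then show "x = y" using xy(1) by blast
  qed
qed

end


section \<open>Finite Borel dimension equals dimension\<close>

context borel_balls
begin

lemma chain_borel:
  assumes Y: "Y \<in> sets X" and B: "B \<in> sets X"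
  shows "chain s Y `` B \<in> sets X"
proof -
  define L where "L = N s \<inter> Y \<times> Y"
  have L: "L `` C \<in> sets X" if "C \<in> sets X" for C
  proof -
    have "L `` C = Y \<inter> N s `` (Y \<inter> C)" by (auto simp: L_def)
    then show ?thesis using ball_borel Y that by simp
  qed
  have "(L ^^ n) `` B \<in> sets X" for n
    by (induction n) (use B L in \<open>simp_all add: relcomp_Image\<close>)
  moreover have "chain s Y `` B = (\<Union>n. (L ^^ n) `` B)"
    by (auto simp: chain_def L_def rtrancl_is_UN_relpow)
  ultimately show ?thesis by auto
qed

lemma borel_coloring_preimage:
  assumes "borel_coloring e" "\<And>x. x \<in> space X \<Longrightarrow> e x < p"
  shows "{x \<in> space X. P (e x)} \<in> sets X"
proof -
  have "{x \<in> space X. P (e x)} = (\<Union>j\<in>{j. j < p \<and> P j}. {x \<in> space X. e x = j})"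
    using assms(2) by auto
  then show ?thesis using assms(1) by (auto simp: borel_coloring_def)
qed

text \<open>Labels that are injective on the relevant sets of values turn cardinalities of these sets into
  conditions on finitely many Borel sets of labels.\<close>

proposition witness_color_borel:
  assumes f: "f \<in> X \<rightarrow>\<^sub>M X" and wit: "witness d s f"
  shows "borel_coloring (witness_color d r f)"
proof -
  obtain b where b: "\<And>x. x \<in> space X \<Longrightarrow> (x, f x) \<in> N b" using wit by (auto simp: witness_def)
  define q where "q = 2 * (d * r + b)"
  obtain e p where e: "borel_coloring e" "\<And>x. x \<in> space X \<Longrightarrow> e x < p"
    "\<And>x y. (x, y) \<in> N q \<Longrightarrow> e x = e y \<Longrightarrow> x = y"
    by (rule finite_borel_coloring[of q]) blast
  define F where "F j x = f ` (N (j * r) `` {x})" for j x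
  have near: "(x, w) \<in> N (d * r + b)" if w: "w \<in> F j x" and j: "j \<le> d" for j x w
  proof -
    obtain z where z: "(x, z) \<in> N (j * r)" "w = f z" using w unfolding F_def by blast
    have "(x, z) \<in> N (d * r)" using ball_mono[OF _ z(1)] j by simp
    moreover have "(z, w) \<in> N b" using b z ball_sub by blast
    ultimately show ?thesis by (rule ball_trans)
  qed
  have inj: "inj_on e (F j x)" if j: "j \<le> d" for j x
  proof (rule inj_onI)
    fix u w assume u: "u \<in> F j x" "w \<in> F j x" "e u = e w"
    have "(u, w) \<in> N q"
      using ball_trans[OF ball_sym[OF near[OF u(1) j]] near[OF u(2) j]] unfolding q_def
      by (rule ball_mono[rotated]) simp
    then show "u = w" using e(3) u(3) by blast
  qed
  define lab where "lab j x = e ` F j x" for j x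
  have lab_sets: "{x \<in> space X. i \<in> lab j x} \<in> sets X" for i j
  proof -
    have "{x \<in> space X. i \<in> lab j x} = N (j * r) `` (f -` {y \<in> space X. e y = i} \<inter> space X)"
    proof (intro equalityI subsetI)
      fix x assume "x \<in> {x \<in> space X. i \<in> lab j x}"
      then obtain z where z: "(x, z) \<in> N (j * r)" "i = e (f z)" unfolding lab_def F_def by blast
      then have "z \<in> space X" "f z \<in> space X" using ball_sub measurable_space[OF f] by blast+
      then show "x \<in> N (j * r) `` (f -` {y \<in> space X. e y = i} \<inter> space X)"
        using z ball_sym by blast
    next
      fix x assume "x \<in> N (j * r) `` (f -` {y \<in> space X. e y = i} \<inter> space X)"
      then obtain z where z: "(z, x) \<in> N (j * r)" "e (f z) = i" by blast
      then have "i \<in> lab j x" unfolding lab_def F_def using ball_sym by blast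
      then show "x \<in> {x \<in> space X. i \<in> lab j x}" using z(1) ball_sub by blast
    qed
    moreover have "f -` {y \<in> space X. e y = i} \<inter> space X \<in> sets X"
    proof (rule measurable_sets[OF f])
      show "{y \<in> space X. e y = i} \<in> sets X" using e(1) unfolding borel_coloring_def by blast
    qed
    ultimately show ?thesis using ball_borel by simp
  qed
  have lab_sub: "lab j x \<subseteq> {..<p}" if x: "x \<in> space X" for j x
  proof -
    have "f z \<in> space X" if "(x, z) \<in> N (j * r)" for z
      using that ball_sub measurable_space[OF f] by blast
    then show ?thesis using e(2) unfolding lab_def F_def by blast
  qed
  have lab_eq: "{x \<in> space X. lab j x = T} \<in> sets X" for j T
  proof (cases "T \<subseteq> {..<p}")
    case True
    have "{x \<in> space X. lab j x = T} = space X \<inter> (\<Inter>i\<in>{..<p}. {x \<in> space X. i \<in> lab j x \<longleftrightarrow> i \<in> T})"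
      using lab_sub[of _ j] True by blast
    moreover have "{x \<in> space X. i \<in> lab j x \<longleftrightarrow> i \<in> T} \<in> sets X" for i
    proof (cases "i \<in> T")
      case True then show ?thesis using lab_sets[of i j] by simp
    next
      case False
      have "{x \<in> space X. i \<in> lab j x \<longleftrightarrow> i \<in> T} = space X - {x \<in> space X. i \<in> lab j x}"
        using False by blast
      then show ?thesis using lab_sets[of i j] by auto
    qed
    ultimately show ?thesis
      by (cases "p = 0") (simp_all add: lessThan_empty_iff sets.Int sets.finite_INT)
  next
    case False
    then have "{x \<in> space X. lab j x = T} = {}" using lab_sub by blast
    then show ?thesis by (metis sets.empty_sets)
  qed
  have card_sets: "{x \<in> space X. m \<le> card (F j x)} \<in> sets X" if j: "j \<le> d" for m j
  proof -
    have "card (F j x) = card (lab j x)" for x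
      unfolding lab_def using inj[OF j] by (simp add: card_image)
    then have "{x \<in> space X. m \<le> card (F j x)} =
        (\<Union>T\<in>{T \<in> Pow {..<p}. m \<le> card T}. {x \<in> space X. lab j x = T})"
      using lab_sub[of _ j] by auto
    also have "\<dots> \<in> sets X" using lab_eq by (intro sets.finite_UN) auto
    finally show ?thesis .
  qed
  define S where "S x = {j. j \<le> d \<and> j + 1 \<le> card (F j x)}" for x
  have "{x \<in> space X. S x = T} \<in> sets X" for T
  proof (cases "T \<subseteq> {..d}")
    case True
    have "{x \<in> space X. S x = T} = (\<Inter>j\<in>{..d}. {x \<in> space X. j + 1 \<le> card (F j x) \<longleftrightarrow> j \<in> T})"
    proof (intro equalityI subsetI)
      fix x assume x: "x \<in> (\<Inter>j\<in>{..d}. {x \<in> space X. j + 1 \<le> card (F j x) \<longleftrightarrow> j \<in> T})"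
      then have "x \<in> space X" by auto
      moreover have "j \<in> S x \<longleftrightarrow> j \<in> T" for j
        using x True by (cases "j \<le> d") (auto simp: S_def)
      ultimately show "x \<in> {x \<in> space X. S x = T}" by blast
    qed (auto simp: S_def)
    moreover have "{x \<in> space X. j + 1 \<le> card (F j x) \<longleftrightarrow> j \<in> T} \<in> sets X" if "j \<le> d" for j
    proof (cases "j \<in> T")
      case True then show ?thesis using card_sets[OF that, of "j + 1"] by simp
    next
      case False
      have "{x \<in> space X. j + 1 \<le> card (F j x) \<longleftrightarrow> j \<in> T} = space X - {x \<in> space X. j + 1 \<le> card (F j x)}"
        using False by blast
      then show ?thesis using card_sets[OF that, of "j + 1"] by (metis sets.compl_sets)
    qed
    ultimately show ?thesis by (simp add: sets.finite_INT)
  next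
    case False
    then have "{x \<in> space X. S x = T} = {}" by (auto simp: S_def)
    then show ?thesis by (metis sets.empty_sets)
  qed
  then have "(\<Union>T\<in>{T \<in> Pow {..d}. Max T = i}. {x \<in> space X. S x = T}) \<in> sets X" for i
    by (intro sets.finite_UN) auto
  moreover have "{x \<in> space X. witness_color d r f x = i} =
      (\<Union>T\<in>{T \<in> Pow {..d}. Max T = i}. {x \<in> space X. S x = T})" for i
  proof -
    have "witness_color d r f x = Max (S x)" for x by (simp add: witness_color_def S_def F_def)
    moreover have "S x \<in> Pow {..d}" for x by (auto simp: S_def)
    ultimately show ?thesis by auto
  qed
  ultimately show ?thesis unfolding borel_coloring_def by simp
qed

text \<open>Each point is sent to the point with the least label in its monochromatic \<open>2 * s\<close>-component. A
  ball of radius \<open>s\<close> meets at most one such component of each color.\<close>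

proposition coloring_to_borel_witness:
  assumes c: "borel_coloring c" and bd: "coloring_bounded d (2 * s) R (space X) c"
  shows "\<exists>f. f \<in> X \<rightarrow>\<^sub>M X \<and> witness d s f"
proof -
  define Y where "Y i = {x \<in> space X. c x = i}" for i
  have Y_sets: "Y i \<in> sets X" for i using c by (auto simp: Y_def borel_coloring_def)
  have Y_bd: "components_bounded (2 * s) R (Y i)" for i using bd by (auto simp: coloring_bounded_def Y_def)
  obtain e p where e: "borel_coloring e" "\<And>x. x \<in> space X \<Longrightarrow> e x < p"
    "\<And>x y. (x, y) \<in> N R \<Longrightarrow> e x = e y \<Longrightarrow> x = y"
    by (rule finite_borel_coloring[of R]) blast
  define C where "C x = {y. (x, y) \<in> chain (2 * s) (Y (c x))}" for x
  define f where "f x = arg_min e (\<lambda>y. y \<in> C x)" for x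
  have C_refl: "x \<in> C x" for x by (simp add: C_def chain_refl)
  have C_near: "(x, y) \<in> N R" if "x \<in> space X" "y \<in> C x" for x y
    using components_boundedD[OF Y_bd, of x "c x" y] that by (auto simp: C_def Y_def)
  have f_C: "f x \<in> C x" and f_min: "y \<in> C x \<Longrightarrow> e (f x) \<le> e y" for x y
    using arg_min_nat_lemma[of "\<lambda>y. y \<in> C x" x e] C_refl by (auto simp: f_def)
  have C_eq: "C x = C y" if "(x, y) \<in> chain (2 * s) (Y (c x))" "c y = c x" for x y
  proof -
    have "(x, z) \<in> chain (2 * s) (Y (c x)) \<longleftrightarrow> (y, z) \<in> chain (2 * s) (Y (c x))" for z
      using that(1) chain_trans chain_sym by blast
    then show ?thesis by (simp add: C_def that(2))
  qed
  have C_in: "c y = c x \<and> y \<in> space X" if "x \<in> space X" "y \<in> C x" for x y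
    using chain_in[of x y "2 * s" "Y (c x)"] that by (auto simp: C_def Y_def)
  have f_space: "f x \<in> space X" if "x \<in> space X" for x using C_in[OF that f_C] by blast
  have labels: "{x \<in> space X. e x = i} \<in> sets X" for i using e(1) by (auto simp: borel_coloring_def)
  have meas: "f -` B \<inter> space X \<in> sets X" if B: "B \<in> sets X" for B
  proof -
    define T where "T i j = Y i \<inter> chain (2 * s) (Y i) `` (B \<inter> {x \<in> space X. e x = j} \<inter> Y i)
        - (\<Union>m<j. chain (2 * s) (Y i) `` ({x \<in> space X. e x = m} \<inter> Y i))" for i j
    have "f -` B \<inter> space X = (\<Union>i. \<Union>j. T i j)"
    proof (intro equalityI subsetI)
      fix x assume x: "x \<in> f -` B \<inter> space X"
      have "x \<in> T (c x) (e (f x))"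
      proof -
        have "(f x, x) \<in> chain (2 * s) (Y (c x))" using f_C[of x] chain_sym by (auto simp: C_def)
        moreover have "f x \<in> Y (c x)" using C_in[OF _ f_C] x by (auto simp: Y_def)
        moreover have "x \<notin> chain (2 * s) (Y (c x)) `` ({y \<in> space X. e y = m} \<inter> Y (c x))"
          if "m < e (f x)" for m
        proof
          assume "x \<in> chain (2 * s) (Y (c x)) `` ({y \<in> space X. e y = m} \<inter> Y (c x))"
          then obtain y where "(y, x) \<in> chain (2 * s) (Y (c x))" "e y = m" by blast
          then have "y \<in> C x" "e y < e (f x)" using chain_sym that by (auto simp: C_def)
          then show False using f_min[of y x] by simp
        qed
        ultimately show ?thesis using x f_space unfolding T_def by (auto simp: Y_def)
      qed
      then show "x \<in> (\<Union>i. \<Union>j. T i j)" by blast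
    next
      fix x assume "x \<in> (\<Union>i. \<Union>j. T i j)"
      then obtain i j where x: "x \<in> T i j" by blast
      then have xi: "x \<in> space X" "c x = i" by (auto simp: T_def Y_def)
      obtain y where y: "y \<in> B" "e y = j" "(y, x) \<in> chain (2 * s) (Y i)" using x by (auto simp: T_def)
      have "y \<in> C x" using y chain_sym xi by (auto simp: C_def)
      then have le: "e (f x) \<le> j" using f_min y by auto
      have "\<not> e (f x) < j"
      proof
        assume "e (f x) < j"
        moreover have "f x \<in> {y \<in> space X. e y = e (f x)} \<inter> Y i"
          using C_in[OF xi(1) f_C] xi by (auto simp: Y_def)
        moreover have "(f x, x) \<in> chain (2 * s) (Y i)" using f_C[of x] chain_sym xi by (auto simp: C_def)
        ultimately show False using x unfolding T_def by blast
      qed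
      then have "e (f x) = e y" using le y(2) by simp
      moreover have "(f x, y) \<in> chain (2 * s) (Y i)"
        using f_C[of x] \<open>y \<in> C x\<close> chain_sym chain_trans xi(2) unfolding C_def by blast
      then have "(f x, y) \<in> N R"
        using components_boundedD[OF Y_bd, of "f x" i y] C_in[OF xi(1) f_C] xi by (auto simp: Y_def)
      ultimately have "f x = y" using e(3) by blast
      then show "x \<in> f -` B \<inter> space X" using y(1) xi by blast
    qed
    moreover have "T i j \<in> sets X" for i j
      unfolding T_def using Y_sets labels B
      by (intro sets.Diff sets.Int sets.finite_UN chain_borel) auto
    ultimately show ?thesis by auto
  qed
  have "f \<in> X \<rightarrow>\<^sub>M X" using meas f_space by (intro measurableI) auto
  moreover have "witness d s f"
    unfolding witness_def
  proof (intro conjI ballI)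
    show "\<exists>b. \<forall>x\<in>space X. (x, f x) \<in> N b" using C_near f_C by blast
    fix x assume x: "x \<in> space X"
    define h where "h i = f (SOME y. (x, y) \<in> N s \<and> c y = i)" for i
    have sub: "f ` (N s `` {x}) \<subseteq> h ` {..d}"
    proof
      fix w assume "w \<in> f ` (N s `` {x})"
      then obtain y where y: "(x, y) \<in> N s" "w = f y" by blast
      define y' where "y' = (SOME z. (x, z) \<in> N s \<and> c z = c y)"
      have y': "(x, y') \<in> N s" "c y' = c y"
        using someI[of "\<lambda>z. (x, z) \<in> N s \<and> c z = c y" y] y(1) unfolding y'_def by blast+
      have "(y, y') \<in> N (2 * s)" using ball_trans[OF ball_sym[OF y(1)] y'(1)] by (simp add: mult_2)
      then have "(y, y') \<in> chain (2 * s) (Y (c y))"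
        using y' ball_sub by (intro chain_step) (auto simp: Y_def)
      then have "f y = f y'" using C_eq[of y y'] y'(2) by (simp add: f_def)
      then have "w = h (c y)" using y(2) by (simp add: h_def y'_def)
      moreover have "c y \<le> d" using bd y(1) ball_sub by (auto simp: coloring_bounded_def)
      ultimately show "w \<in> h ` {..d}" by blast
    qed
    then show "finite (f ` (N s `` {x}))" by (rule finite_subset) simp
    have "card (f ` (N s `` {x})) \<le> card (h ` {..d})" using sub by (intro card_mono) auto
    also have "\<dots> \<le> card {..d}" by (rule card_image_le) simp
    finally show "card (f ` (N s `` {x})) \<le> d + 1" by simp
  qed
  ultimately show ?thesis by blast
qed

text \<open>Labels are injective on each \<open>L\<close>-component of \<open>Y\<close>, so a coloring of a component is one of
  finitely many functions from labels to colors. Each component uses the first of these functions that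
  has bounded \<open>s\<close>-components there; the arbitrary coloring \<open>c\<close> guarantees that one exists, and which
  functions are admissible is a Borel condition. Chains of step \<open>s \<le> L\<close> do not leave a component, so
  the choices for different components do not interfere.\<close>

proposition borel_recoloring:
  assumes Y: "Y \<in> sets X" and YL: "components_bounded L Q Y" and sL: "s \<le> L"
    and c: "coloring_bounded d s R (space X) c"
  shows "\<exists>c'. borel_coloring c' \<and> coloring_bounded d s R Y c'"
proof -
  have Y_space: "Y \<subseteq> space X" using sets.sets_into_space[OF Y] .
  obtain e p where e: "borel_coloring e" "\<And>x. x \<in> space X \<Longrightarrow> e x < p"
    "\<And>x y. (x, y) \<in> N (Q + R) \<Longrightarrow> e x = e y \<Longrightarrow> x = y"
    by (rule finite_borel_coloring[of "Q + R"]) blast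
  have "finite ({..<p} \<rightarrow>\<^sub>E {..d})" by (intro finite_PiE) auto
  from finite_list[OF this] obtain gs :: "(nat \<Rightarrow> nat) list" where gs: "set gs = {..<p} \<rightarrow>\<^sub>E {..d}" ..
  have labels: "{x \<in> space X. e x = i} \<in> sets X" for i using e(1) by (auto simp: borel_coloring_def)
  define cls where "cls g k = {y \<in> Y. g (e y) = k}" for g :: "nat \<Rightarrow> nat" and k
  have cls_Y: "cls g k \<subseteq> Y" for g k by (auto simp: cls_def)
  have cls_sets: "cls g k \<in> sets X" for g k
  proof -
    have "cls g k = Y \<inter> {x \<in> space X. g (e x) = k}" using Y_space by (auto simp: cls_def)
    then show ?thesis using borel_coloring_preimage[OF e(1,2), of "\<lambda>j. g j = k"] Y by auto
  qed
  \<comment> \<open>\<open>D g k\<close> collects the points from which a monochromatic chain leads too far away.\<close>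
  define D where "D g k = {y \<in> cls g k. \<exists>z. (y, z) \<in> chain s (cls g k) \<and> (y, z) \<notin> N R}" for g k
  have D_sets: "D g k \<in> sets X" for g k
  proof -
    have "D g k = (\<Union>j<p. cls g k \<inter> chain s (cls g k) `` ({x \<in> space X. e x = j} \<inter> cls g k)
        - N R `` {x \<in> space X. e x = j})" (is "_ = ?D")
    proof (intro equalityI subsetI)
      fix y assume y: "y \<in> D g k"
      then obtain z where z: "(y, z) \<in> chain s (cls g k)" "(y, z) \<notin> N R" and yc: "y \<in> cls g k"
        by (auto simp: D_def)
      have zc: "z \<in> cls g k" using chain_in[OF z(1) yc] .
      have zX: "z \<in> space X" using zc cls_Y Y_space by blast
      have "(y, z) \<in> N Q"
        using components_boundedD[OF YL, of y z] chain_mono[OF z(1) sL cls_Y] yc cls_Y by blast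
      have "y \<notin> N R `` {x \<in> space X. e x = e z}"
      proof
        assume "y \<in> N R `` {x \<in> space X. e x = e z}"
        then obtain z' where z': "(z', y) \<in> N R" "e z' = e z" by blast
        have "(z, z') \<in> N (Q + R)"
          using ball_trans[OF ball_sym[OF \<open>(y, z) \<in> N Q\<close>] ball_sym[OF z'(1)]] .
        then have "z = z'" using e(3) z'(2) by simp
        then show False using z' z(2) ball_sym by blast
      qed
      moreover have "(z, y) \<in> chain s (cls g k)" using z(1) by (rule chain_sym)
      ultimately show "y \<in> ?D" using yc zc zX e(2)[OF zX] by blast
    next
      fix y assume "y \<in> ?D"
      then obtain j z where "y \<in> cls g k" "(z, y) \<in> chain s (cls g k)" "e z = j" "z \<in> space X"
          "y \<notin> N R `` {x \<in> space X. e x = j}" by blast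
      moreover from this have "(y, z) \<notin> N R" using ball_sym by blast
      ultimately show "y \<in> D g k" using chain_sym by (auto simp: D_def)
    qed
    also have "\<dots> \<in> sets X"
      using cls_sets labels by (intro sets.finite_UN sets.Diff sets.Int chain_borel ball_borel) auto
    finally show ?thesis .
  qed
  \<comment> \<open>Being bad concerns whole \<open>L\<close>-components, so that the pattern chosen below is constant on them.\<close>
  define bad where "bad g = Y \<inter> chain L Y `` (\<Union>k\<le>d. D g k)" for g
  have bad_sets: "bad g \<in> sets X" for g
    unfolding bad_def using Y D_sets by (intro sets.Int chain_borel sets.finite_UN) auto
  have bad_inv: "x \<in> bad g \<longleftrightarrow> y \<in> bad g" if xy: "(x, y) \<in> chain L Y" "x \<in> Y" for x y g
  proof -
    have y: "y \<in> Y" using chain_in xy by blast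
    have "(u, x) \<in> chain L Y \<longleftrightarrow> (u, y) \<in> chain L Y" for u
      using xy(1) chain_trans chain_sym by blast
    then show ?thesis using xy(2) y by (auto simp: bad_def)
  qed
  define idx where "idx x = (LEAST i. i < length gs \<and> x \<notin> bad (gs ! i))" for x
  \<comment> \<open>Reading the given colouring off the labels of one component yields an admissible pattern.\<close>
  have good_ex: "\<exists>i<length gs. x \<notin> bad (gs ! i)" if x: "x \<in> space X" for x
  proof -
    define g where "g = restrict (\<lambda>j. if \<exists>y\<in>Y. (x, y) \<in> chain L Y \<and> e y = j
        then c (SOME y. y \<in> Y \<and> (x, y) \<in> chain L Y \<and> e y = j) else 0) {..<p}"
    have g_e: "g (e y) = c y" if y: "y \<in> Y" "(x, y) \<in> chain L Y" "x \<in> Y" for y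
    proof -
      define z where "z = (SOME z. z \<in> Y \<and> (x, z) \<in> chain L Y \<and> e z = e y)"
      have z: "z \<in> Y" "(x, z) \<in> chain L Y" "e z = e y"
        using someI[of "\<lambda>z. z \<in> Y \<and> (x, z) \<in> chain L Y \<and> e z = e y" y] y unfolding z_def by blast+
      have "(z, y) \<in> chain L Y" using z(2) y(2) chain_sym chain_trans by blast
      then have "(z, y) \<in> N Q" using components_boundedD[OF YL] z(1) by blast
      then have "(z, y) \<in> N (Q + R)" by (rule ball_mono[rotated]) simp
      then have "z = y" using e(3) z(3) by blast
      moreover have "e y < p" using e(2) y(1) Y_space by blast
      moreover have "\<exists>w\<in>Y. (x, w) \<in> chain L Y \<and> e w = e y" using y by blast
      ultimately show ?thesis by (simp add: g_def z_def)
    qed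
    have "g \<in> {..<p} \<rightarrow>\<^sub>E {..d}"
    proof -
      have "c (SOME y. y \<in> Y \<and> (x, y) \<in> chain L Y \<and> e y = j) \<le> d"
        if "\<exists>y\<in>Y. (x, y) \<in> chain L Y \<and> e y = j" for j
      proof -
        have "(SOME y. y \<in> Y \<and> (x, y) \<in> chain L Y \<and> e y = j) \<in> Y"
          using someI_ex[of "\<lambda>y. y \<in> Y \<and> (x, y) \<in> chain L Y \<and> e y = j"] that by blast
        then show ?thesis using c Y_space by (auto simp: coloring_bounded_def)
      qed
      then show ?thesis by (auto simp: g_def)
    qed
    then obtain i where i: "i < length gs" "gs ! i = g" using gs by (metis in_set_conv_nth)
    have "x \<notin> bad g"
    proof
      assume "x \<in> bad g"
      then obtain y k where y: "x \<in> Y" "y \<in> D g k" "(y, x) \<in> chain L Y" by (auto simp: bad_def)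
      then obtain z where z: "y \<in> cls g k" "(y, z) \<in> chain s (cls g k)" "(y, z) \<notin> N R"
        by (auto simp: D_def)
      have xy: "(x, y) \<in> chain L Y" using y(3) by (rule chain_sym)
      have c_eq: "c w = k" if w: "w \<in> cls g k" "(y, w) \<in> chain s (cls g k)" for w
      proof -
        have "(x, w) \<in> chain L Y" using chain_trans[OF xy chain_mono[OF w(2) sL cls_Y]] .
        then have "g (e w) = c w" using g_e w(1) cls_Y y(1) by blast
        then show ?thesis using w(1) by (simp add: cls_def)
      qed
      have "(y, z) \<in> chain s {x \<in> space X. c x = k}" using z(2)
      proof (induction rule: chain_induct)
        case (step u w)
        have "(y, w) \<in> chain s (cls g k)" using chain_trans[OF step.hyps(1) chain_step[OF step.hyps(2)]] step.hyps by blast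
        then have "u \<in> {x \<in> space X. c x = k}" "w \<in> {x \<in> space X. c x = k}"
          using c_eq step.hyps cls_Y Y_space by blast+
        then show ?case using chain_trans[OF step.IH chain_step[OF step.hyps(2)]] by blast
      qed (rule chain_refl)
      moreover have "y \<in> {x \<in> space X. c x = k}" using c_eq[OF z(1) chain_refl] z(1) cls_Y Y_space by blast
      ultimately have "(y, z) \<in> N R"
        using c components_boundedD[of s R "{x \<in> space X. c x = k}" y z] by (auto simp: coloring_bounded_def)
      then show False using z(3) by blast
    qed
    then show ?thesis using i by blast
  qed
  have idx: "idx x < length gs" "x \<notin> bad (gs ! idx x)" if "x \<in> space X" for x
    using LeastI_ex[OF good_ex[OF that]] unfolding idx_def by blast+
  have idx_inv: "idx x = idx y" if "(x, y) \<in> chain L Y" "x \<in> Y" for x y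
    using bad_inv[OF that] by (simp add: idx_def)
  define c' where "c' x = (gs ! idx x) (e x)" for x
  have c'_le: "c' x \<le> d" if x: "x \<in> space X" for x
  proof -
    have "gs ! idx x \<in> {..<p} \<rightarrow>\<^sub>E {..d}" using idx(1)[OF x] gs nth_mem by blast
    then show ?thesis using e(2)[OF x] unfolding c'_def by (auto simp: PiE_iff)
  qed
  have idx_sets: "{x \<in> space X. idx x = i} \<in> sets X" if i: "i < length gs" for i
  proof -
    have "{x \<in> space X. idx x = i} = space X - bad (gs ! i) - (\<Union>m<i. space X - bad (gs ! m))"
    proof (intro equalityI subsetI)
      fix x assume x: "x \<in> {x \<in> space X. idx x = i}"
      have "x \<in> bad (gs ! m)" if "m < i" for m
        using not_less_Least[of m "\<lambda>i. i < length gs \<and> x \<notin> bad (gs ! i)"] x that i by (auto simp: idx_def)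
      then show "x \<in> space X - bad (gs ! i) - (\<Union>m<i. space X - bad (gs ! m))" using x idx by blast
    next
      fix x assume x: "x \<in> space X - bad (gs ! i) - (\<Union>m<i. space X - bad (gs ! m))"
      have "idx x = i" unfolding idx_def
        by (rule Least_equality) (use x i in \<open>auto simp: not_less[symmetric]\<close>)
      then show "x \<in> {x \<in> space X. idx x = i}" using x by blast
    qed
    moreover have "space X - bad (gs ! i) - (\<Union>m<i. space X - bad (gs ! m)) \<in> sets X"
      using bad_sets by (intro sets.Diff sets.finite_UN) auto
    ultimately show ?thesis by (simp only:)
  qed
  have "borel_coloring c'"
    unfolding borel_coloring_def
  proof
    fix k
    have "{x \<in> space X. c' x = k} =
        (\<Union>i<length gs. {x \<in> space X. idx x = i} \<inter> {x \<in> space X. (gs ! i) (e x) = k})"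
      using idx(1) by (auto simp: c'_def)
    also have "\<dots> \<in> sets X"
      using idx_sets borel_coloring_preimage[OF e(1,2), of "\<lambda>j. (gs ! i) j = k" for i]
      by (intro sets.finite_UN sets.Int) auto
    finally show "{x \<in> space X. c' x = k} \<in> sets X" .
  qed
  moreover have "components_bounded s R {x \<in> Y. c' x = k}" for k
    unfolding components_bounded_def
  proof (intro ballI allI impI)
    fix x y assume x: "x \<in> {x \<in> Y. c' x = k}" and xy: "(x, y) \<in> chain s {x \<in> Y. c' x = k}"
    define g where "g = gs ! idx x"
    have xY: "x \<in> Y" "x \<in> space X" using x Y_space by auto
    have in_cls: "w \<in> cls g k" if w: "w \<in> Y" "c' w = k" "(x, w) \<in> chain L Y" for w
      using idx_inv[OF w(3) xY(1)] w by (simp add: cls_def g_def c'_def)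
    have kd: "k \<le> d" using x c'_le xY by auto
    have L: "(x, w) \<in> chain L Y" if "(x, w) \<in> chain s {x \<in> Y. c' x = k}" for w
      by (rule chain_mono[OF that sL]) blast
    have "(x, y) \<in> chain s (cls g k)" using xy
    proof (induction rule: chain_induct)
      case (step u w)
      have "(x, w) \<in> chain s {x \<in> Y. c' x = k}"
        using chain_trans[OF step.hyps(1) chain_step[OF step.hyps(2)]] step.hyps by blast
      then have "u \<in> cls g k" "w \<in> cls g k" using in_cls L step.hyps by blast+
      then show ?case using chain_trans[OF step.IH chain_step[OF step.hyps(2)]] by blast
    qed (rule chain_refl)
    moreover have "x \<in> cls g k" using in_cls[OF xY(1) _ chain_refl] x by blast
    ultimately have "(x, y) \<notin> N R \<Longrightarrow> x \<in> D g k" by (auto simp: D_def)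
    then have "(x, y) \<notin> N R \<Longrightarrow> x \<in> bad g" using kd xY(1) chain_refl unfolding bad_def by blast
    then show "(x, y) \<in> N R" using idx(2)[OF xY(2)] unfolding g_def by blast
  qed
  ultimately show ?thesis using c'_le unfolding coloring_bounded_def by blast
qed

text \<open>The classes of \<open>b\<close> are recolored one after another and merged with \<open>components_bounded_Un\<close>. The
  bound \<open>R\<close> comes before the quantifier over \<open>b\<close>: the scale at which the next class has to be
  colored, and thus \<open>L\<close>, depends on \<open>R\<close>, while \<open>b\<close> can only be found once \<open>L\<close> is known.\<close>

proposition borel_coloring_below:
  assumes asdim: "\<And>s. \<exists>R c. coloring_bounded d s R (space X) c"
  shows "\<exists>L R. \<forall>b. borel_coloring b \<longrightarrow> (\<forall>i. \<exists>Q. components_bounded L Q {x \<in> space X. b x = i}) \<longrightarrow>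
     (\<exists>c. borel_coloring c \<and> coloring_bounded d s R {x \<in> space X. b x < n} c)"
proof (induction n)
  case 0
  have "borel_coloring (\<lambda>_. 0)" by (auto simp: borel_coloring_def)
  moreover have "coloring_bounded d s 0 {x \<in> space X. b x < 0} (\<lambda>_. 0)" for b :: "'x \<Rightarrow> nat"
    by (auto simp: coloring_bounded_def components_bounded_def)
  ultimately show ?case by blast
next
  case (Suc n)
  then obtain L R where LR: "\<And>b. \<lbrakk>borel_coloring b; \<And>i. \<exists>Q. components_bounded L Q {x \<in> space X. b x = i}\<rbrakk> \<Longrightarrow>
     \<exists>c. borel_coloring c \<and> coloring_bounded d s R {x \<in> space X. b x < n} c" by blast
  obtain R' c' where c': "coloring_bounded d (R + 2 * s) R' (space X) c'" using asdim by blast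
  define L' where "L' = max L (R + 2 * s)"
  show ?case
  proof (rule exI[of _ L'], rule exI[of _ "R' + 2 * (s + R)"], intro allI impI)
    fix b assume b: "borel_coloring b" "\<forall>i. \<exists>Q. components_bounded L' Q {x \<in> space X. b x = i}"
    have "\<exists>Q. components_bounded L Q {x \<in> space X. b x = i}" for i
      using b(2) components_bounded_mono[of L' _ "{x \<in> space X. b x = i}" L "{x \<in> space X. b x = i}"]
      by (auto simp: L'_def)
    then obtain c1 where c1: "borel_coloring c1" "coloring_bounded d s R {x \<in> space X. b x < n} c1"
      using LR[OF b(1)] by blast
    have Yn: "{x \<in> space X. b x = n} \<in> sets X" using b(1) by (auto simp: borel_coloring_def)
    obtain Q where Q: "components_bounded L' Q {x \<in> space X. b x = n}" using b(2) by blast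
    obtain c2 where c2: "borel_coloring c2" "coloring_bounded d (R + 2 * s) R' {x \<in> space X. b x = n} c2"
      using borel_recoloring[OF Yn Q _ c'] by (auto simp: L'_def)
    define c where "c x = (if b x = n then c2 x else c1 x)" for x
    have "borel_coloring c"
      unfolding borel_coloring_def
    proof
      fix k
      have "{x \<in> space X. c x = k} = {x \<in> space X. b x = n} \<inter> {x \<in> space X. c2 x = k} \<union>
          ({x \<in> space X. c1 x = k} - {x \<in> space X. b x = n})"
        by (auto simp: c_def)
      also have "\<dots> \<in> sets X"
        using Yn c1(1) c2(1) unfolding borel_coloring_def by (intro sets.Un sets.Int sets.Diff) auto
      finally show "{x \<in> space X. c x = k} \<in> sets X" .
    qed
    moreover have "coloring_bounded d s (R' + 2 * (s + R)) {x \<in> space X. b x < Suc n} c"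
      unfolding coloring_bounded_def
    proof (intro conjI ballI allI)
      fix x assume "x \<in> space X"
      then show "c x \<le> d" using c1(2) c2(2) by (auto simp: c_def coloring_bounded_def)
    next
      fix k
      define A where "A = {x \<in> {x \<in> space X. b x < n}. c1 x = k}"
      define B where "B = {x \<in> {x \<in> space X. b x = n}. c2 x = k}"
      have "components_bounded s R A" "components_bounded (R + 2 * s) R' B"
        using c1(2) c2(2) by (auto simp: A_def B_def coloring_bounded_def)
      then have "components_bounded s (R' + 2 * (s + R)) (A \<union> B)"
        by (intro components_bounded_Un) (auto simp: A_def B_def)
      moreover have "{x \<in> {x \<in> space X. b x < Suc n}. c x = k} = A \<union> B"
        by (auto simp: A_def B_def c_def less_Suc_eq)
      ultimately show "components_bounded s (R' + 2 * (s + R)) {x \<in> {x \<in> space X. b x < Suc n}. c x = k}"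
        by simp
    qed
    ultimately show "\<exists>c. borel_coloring c \<and>
        coloring_bounded d s (R' + 2 * (s + R)) {x \<in> space X. b x < Suc n} c" by blast
  qed
qed

text \<open>A Borel coloring with \<open>D + 1\<close> colors, at a scale so large that its components can be recolored
  independently, is turned into one with \<open>d + 1\<close> colors.\<close>

theorem borel_witness_of_witness:
  assumes asdim: "\<And>s. \<exists>f. witness d s f"
    and finite_dim: "\<And>s. \<exists>f. f \<in> X \<rightarrow>\<^sub>M X \<and> witness D s f"
  shows "\<exists>f. f \<in> X \<rightarrow>\<^sub>M X \<and> witness d s f"
proof -
  have col: "\<exists>R c. coloring_bounded d s R (space X) c" for s
    using asdim[of "(d + 1) * s"] witness_color_bounded by blast
  obtain L R where LR: "\<And>b. \<lbrakk>borel_coloring b; \<And>i. \<exists>Q. components_bounded L Q {x \<in> space X. b x = i}\<rbrakk> \<Longrightarrow>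
     \<exists>c. borel_coloring c \<and> coloring_bounded d (2 * s) R {x \<in> space X. b x < D + 1} c"
    using borel_coloring_below[OF col, of "2 * s" "D + 1"] by blast
  obtain f where f: "f \<in> X \<rightarrow>\<^sub>M X" "witness D ((D + 1) * L) f" using finite_dim by blast
  define b where "b = witness_color D L f"
  obtain Q where Q: "coloring_bounded D L Q (space X) b"
    using witness_color_bounded[OF f(2)] by (auto simp: b_def)
  have "borel_coloring b" unfolding b_def by (rule witness_color_borel[OF f])
  then obtain c where c: "borel_coloring c" "coloring_bounded d (2 * s) R {x \<in> space X. b x < D + 1} c"
    using LR[of b] Q by (auto simp: coloring_bounded_def)
  moreover have "{x \<in> space X. b x < D + 1} = space X"
    using Q by (auto simp: coloring_bounded_def less_Suc_eq_le)
  ultimately show ?thesis using coloring_to_borel_witness[of c d s R] by simp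
qed

end


section \<open>Commuting maps have finite Borel dimension\<close>

lemma same_block_close:
  fixes a b t :: nat
  assumes "a div (t + 1) = b div (t + 1)"
  shows "a \<le> b + t"
proof -
  have "a = (t + 1) * (b div (t + 1)) + a mod (t + 1)"
    using mult_div_mod_eq[of "t + 1" a] assms by simp
  also have "\<dots> \<le> b + t"
  proof (rule add_mono)
    show "(t + 1) * (b div (t + 1)) \<le> b" by (rule times_div_less_eq_dividend)
    show "a mod (t + 1) \<le> t" using mod_less_divisor[of "t + 1" a] by linarith
  qed
  finally show ?thesis .
qed

text \<open>Exponent vectors \<open>i\<close> act by monomials in commuting generators. Condition \<open>ball_meet\<close>, that
  close points have a common image under small monomials, is a consequence of commutativity.\<close>

locale commuting_action = borel_balls X N U
  for X :: "'x measure" and N :: "nat \<Rightarrow> 'x rel" and U :: "nat \<Rightarrow> 'x set" +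
  fixes R :: "'r set" and A :: "('r \<Rightarrow> nat) \<Rightarrow> 'x \<Rightarrow> 'x"
  assumes R_finite: "finite R"
    and A_measurable: "A i \<in> X \<rightarrow>\<^sub>M X"
    and A_zero: "x \<in> space X \<Longrightarrow> A (\<lambda>_. 0) x = x"
    and A_add: "x \<in> space X \<Longrightarrow> A i (A j x) = A (\<lambda>r. i r + j r) x"
    and A_cong: "\<lbrakk>\<And>r. r \<in> R \<Longrightarrow> i r = j r; x \<in> space X\<rbrakk> \<Longrightarrow> A i x = A j x"
    and A_displacement: "\<exists>b. \<forall>x\<in>space X. (x, A i x) \<in> N b"
    and ball_meet: "(x, y) \<in> N s \<Longrightarrow> \<exists>a b. (\<forall>r\<in>R. a r \<le> s \<and> b r \<le> s) \<and> A a x = A b y"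
begin

lemma A_space: "x \<in> space X \<Longrightarrow> A i x \<in> space X"
  using measurable_space[OF A_measurable] .

lemma A_add_eq:
  assumes "x \<in> space X" "\<And>r. r \<in> R \<Longrightarrow> i r + j r = k r"
  shows "A i (A j x) = A k x"
  using A_add[OF assms(1)] A_cong[OF assms(2) assms(1)] by simp

lemma A_commute_eq:
  assumes "x \<in> space X" "\<And>r. r \<in> R \<Longrightarrow> i r + j r = i' r + j' r"
  shows "A i (A j x) = A i' (A j' x)"
  using A_add_eq[OF assms(1), of i j "\<lambda>r. i' r + j' r"] A_add_eq[OF assms(1), of i' j' "\<lambda>r. i' r + j' r"] assms(2)
  by simp

definition box :: "nat \<Rightarrow> ('r \<Rightarrow> nat) set" where
  "box t = R \<rightarrow>\<^sub>E {..t}"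

lemma box_finite: "finite (box t)"
  unfolding box_def using R_finite by (intro finite_PiE) auto

lemma box_card: "card (box t) = (t + 1) ^ card R"
  unfolding box_def using R_finite by (simp add: card_PiE)

lemma box_le: "i \<in> box t \<Longrightarrow> r \<in> R \<Longrightarrow> i r \<le> t"
  unfolding box_def by auto

lemma restrict_box: "(\<And>r. r \<in> R \<Longrightarrow> i r \<le> t) \<Longrightarrow> restrict i R \<in> box t"
  unfolding box_def by auto

lemma uniform_displacement:
  assumes "finite J"
  shows "\<exists>b. \<forall>i\<in>J. \<forall>x\<in>space X. (x, A i x) \<in> N b"
proof -
  obtain b where b: "\<And>i x. x \<in> space X \<Longrightarrow> (x, A i x) \<in> N (b i)" using A_displacement by metis
  have "(x, A i x) \<in> N (\<Sum>i\<in>J. b i)" if "i \<in> J" "x \<in> space X" for i x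
    using ball_mono[OF _ b[OF that(2)], of i] member_le_sum[OF that(1), of b] assms by simp
  then show ?thesis by blast
qed

text \<open>For a fixed point \<open>x\<close>, consider a greedy algorithm on the exponent vectors: in round \<open>k\<close> it
  selects every vector whose point has color \<open>k\<close>, unless some vector at coordinatewise distance at most
  \<open>t\<close> has been selected in an earlier round and yields a different point. Then \<open>A m x \<in> stage t e k\<close> means that the vector \<open>m + k * t\<close>
  has been selected in the first \<open>k\<close> rounds. The shift by \<open>t\<close> in each round lets the test look
  forward only, never at preimages, of which there may be exponentially many.\<close>

primrec stage :: "nat \<Rightarrow> ('x \<Rightarrow> nat) \<Rightarrow> nat \<Rightarrow> 'x set" where
  "stage t e 0 = {}"
| "stage t e (Suc k) = {y \<in> space X. A (\<lambda>_. t) y \<in> stage t e k} \<union>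
     {y \<in> space X. e (A (\<lambda>_. Suc k * t) y) = k \<and>
        (\<forall>i\<in>box (2 * t). A i y \<in> stage t e k \<longrightarrow> A (\<lambda>r. i r + k * t) y = A (\<lambda>_. Suc k * t) y)}"

lemma stage_borel:
  assumes e: "borel_coloring e"
  shows "stage t e k \<in> sets X"
proof (induction k)
  case 0
  show ?case by simp
next
  case (Suc k)
  have pre: "{y \<in> space X. A i y \<in> B} \<in> sets X" if "B \<in> sets X" for i B
  proof -
    have "A i -` B \<inter> space X \<in> sets X" using measurable_sets[OF A_measurable that] .
    moreover have "A i -` B \<inter> space X = {y \<in> space X. A i y \<in> B}" by blast
    ultimately show ?thesis by simp
  qed
  have eq: "{y \<in> space X. A i y = A j y} \<in> sets X" for i j
    by (rule equalizer_sets[OF separates_points_U A_measurable A_measurable])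
  have "{y \<in> space X. e (A (\<lambda>_. Suc k * t) y) = k} \<in> sets X"
  proof -
    have "{y \<in> space X. e (A (\<lambda>_. Suc k * t) y) = k} =
        {y \<in> space X. A (\<lambda>_. Suc k * t) y \<in> {x \<in> space X. e x = k}}"
      using A_space by blast
    moreover have "{x \<in> space X. e x = k} \<in> sets X" using e unfolding borel_coloring_def by blast
    ultimately show ?thesis using pre by (simp only:)
  qed
  moreover have "{y \<in> space X. A i y \<in> stage t e k \<longrightarrow> A (\<lambda>r. i r + k * t) y = A (\<lambda>_. Suc k * t) y} \<in> sets X" for i
  proof -
    have "{y \<in> space X. A i y \<in> stage t e k \<longrightarrow> A (\<lambda>r. i r + k * t) y = A (\<lambda>_. Suc k * t) y} =
      (space X - {y \<in> space X. A i y \<in> stage t e k}) \<union> {y \<in> space X. A (\<lambda>r. i r + k * t) y = A (\<lambda>_. Suc k * t) y}"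
      by blast
    also have "\<dots> \<in> sets X" by (intro sets.Un sets.Diff sets.top pre eq Suc.IH)
    finally show ?thesis .
  qed
  then have "(\<Inter>i\<in>box (2 * t). {y \<in> space X. A i y \<in> stage t e k \<longrightarrow> A (\<lambda>r. i r + k * t) y = A (\<lambda>_. Suc k * t) y}) \<in> sets X"
    using box_finite restrict_box[of "\<lambda>_. 0"] by (intro sets.finite_INT) auto
  ultimately have "{y \<in> space X. e (A (\<lambda>_. Suc k * t) y) = k} \<inter>
     (\<Inter>i\<in>box (2 * t). {y \<in> space X. A i y \<in> stage t e k \<longrightarrow> A (\<lambda>r. i r + k * t) y = A (\<lambda>_. Suc k * t) y}) \<in> sets X"
    by (rule sets.Int)
  moreover have "{y \<in> space X. e (A (\<lambda>_. Suc k * t) y) = k \<and>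
        (\<forall>i\<in>box (2 * t). A i y \<in> stage t e k \<longrightarrow> A (\<lambda>r. i r + k * t) y = A (\<lambda>_. Suc k * t) y)} =
     {y \<in> space X. e (A (\<lambda>_. Suc k * t) y) = k} \<inter>
     (\<Inter>i\<in>box (2 * t). {y \<in> space X. A i y \<in> stage t e k \<longrightarrow> A (\<lambda>r. i r + k * t) y = A (\<lambda>_. Suc k * t) y})"
    by blast
  ultimately show ?case using pre[OF Suc.IH] by (simp only: stage.simps sets.Un)
qed

text \<open>Selected vectors that are close yield the same point. If one was selected in an earlier round,
  this is the condition under which the other was added; if both were added in the same round, their
  points are close and have the same color.\<close>

lemma stage_sparse:
  assumes e: "\<And>x y. (x, y) \<in> N q \<Longrightarrow> e x = e y \<Longrightarrow> x = y"
    and q: "\<And>a b x. a \<in> box t \<Longrightarrow> b \<in> box t \<Longrightarrow> x \<in> space X \<Longrightarrow> (A a x, A b x) \<in> N q"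
  shows "\<lbrakk>y \<in> space X; \<forall>r\<in>R. m r \<le> m' r + t \<and> m' r \<le> m r + t; A m y \<in> stage t e k; A m' y \<in> stage t e k\<rbrakk>
    \<Longrightarrow> A (\<lambda>r. m r + k * t) y = A (\<lambda>r. m' r + k * t) y"
proof (induction k arbitrary: y m m')
  case 0
  then show ?case by simp
next
  case (Suc k)
  note y = Suc.prems(1)
  define old where "old m \<longleftrightarrow> A (\<lambda>_. t) (A m y) \<in> stage t e k" for m
  define new where "new m \<longleftrightarrow> e (A (\<lambda>_. Suc k * t) (A m y)) = k \<and>
     (\<forall>i\<in>box (2 * t). A i (A m y) \<in> stage t e k \<longrightarrow>
        A (\<lambda>r. i r + k * t) (A m y) = A (\<lambda>_. Suc k * t) (A m y))" for m
  have cases: "old m \<or> new m" "old m' \<or> new m'"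
    using Suc.prems(3,4) by (auto simp: old_def new_def)
  have mixed: "A (\<lambda>r. m r + Suc k * t) y = A (\<lambda>r. m' r + Suc k * t) y"
    if close: "\<forall>r\<in>R. m r \<le> m' r + t \<and> m' r \<le> m r + t" and m: "old m" "new m'" for m m'
  proof -
    \<comment> \<open>The new vector sees the old one at offset \<open>m - m'\<close>, shifted by \<open>t\<close> to become nonnegative.\<close>
    define i where "i = restrict (\<lambda>r. m r + t - m' r) R"
    have i: "i \<in> box (2 * t)" unfolding i_def using close by (intro restrict_box) fastforce
    have ir: "i r + m' r = t + m r" if "r \<in> R" for r using close that by (auto simp: i_def)
    have "A i (A m' y) = A (\<lambda>_. t) (A m y)" using ir by (intro A_commute_eq[OF y]) auto
    then have "A i (A m' y) \<in> stage t e k" using m(1) by (simp add: old_def)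
    then have "A (\<lambda>r. i r + k * t) (A m' y) = A (\<lambda>_. Suc k * t) (A m' y)"
      using m(2) i by (simp add: new_def)
    moreover have "A (\<lambda>r. i r + k * t) (A m' y) = A (\<lambda>r. m r + Suc k * t) y"
      using ir by (intro A_add_eq[OF y]) (auto simp: algebra_simps)
    moreover have "A (\<lambda>_. Suc k * t) (A m' y) = A (\<lambda>r. m' r + Suc k * t) y"
      by (intro A_add_eq[OF y]) simp
    ultimately show ?thesis by simp
  qed
  have close': "\<forall>r\<in>R. m' r \<le> m r + t \<and> m r \<le> m' r + t" using Suc.prems(2) by blast
  consider "old m" "old m'" | "old m" "new m'" | "new m" "old m'" | "new m" "new m'"
    using cases by blast
  then show ?case
  proof cases
    case 1
    define z where "z = A (\<lambda>_. t) y"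
    have z: "z \<in> space X" using A_space[OF y] by (simp add: z_def)
    have sw: "A (\<lambda>_. t) (A n y) = A n z" for n unfolding z_def by (rule A_commute_eq[OF y]) simp
    have "A m z \<in> stage t e k" "A m' z \<in> stage t e k" using 1 by (simp_all only: old_def sw)
    then have "A (\<lambda>r. m r + k * t) z = A (\<lambda>r. m' r + k * t) z" by (rule Suc.IH[OF z Suc.prems(2)])
    moreover have "A (\<lambda>r. n r + k * t) z = A (\<lambda>r. n r + Suc k * t) y" for n
      unfolding z_def by (rule A_add_eq[OF y]) simp
    ultimately show ?thesis by simp
  next
    case 2
    then show ?thesis by (rule mixed[OF Suc.prems(2)])
  next
    case 3
    then show ?thesis using mixed[OF close'] by simp
  next
    case 4
    \<comment> \<open>Both points are images of \<open>z\<close> under exponents in \<open>box t\<close>, hence close to each other.\<close>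
    define z where "z = A (\<lambda>r. min (m r) (m' r) + Suc k * t) y"
    have z: "z \<in> space X" using A_space[OF y] by (simp add: z_def)
    define a where "a = restrict (\<lambda>r. m r - min (m r) (m' r)) R"
    define b where "b = restrict (\<lambda>r. m' r - min (m r) (m' r)) R"
    have ab: "a \<in> box t" "b \<in> box t"
      unfolding a_def b_def using Suc.prems(2) by (force intro!: restrict_box simp: min_def)+
    have "A (\<lambda>_. Suc k * t) (A m y) = A a z" "A (\<lambda>_. Suc k * t) (A m' y) = A b z"
      unfolding z_def by (auto intro!: A_commute_eq[OF y] simp: a_def b_def)
    moreover have "A a z = A b z"
      using 4 calculation e[OF q[OF ab z]] by (simp add: new_def)
    moreover have "A (\<lambda>_. Suc k * t) (A n y) = A (\<lambda>r. n r + Suc k * t) y" for n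
      by (rule A_add_eq[OF y]) simp
    ultimately show ?thesis by simp
  qed
qed

lemma stage_shift:
  "\<lbrakk>z \<in> space X; A (\<lambda>_. j * t) z \<in> stage t e k\<rbrakk> \<Longrightarrow> z \<in> stage t e (k + j)"
proof (induction j arbitrary: z)
  case 0
  then show ?case using A_zero by simp
next
  case (Suc j)
  have "A (\<lambda>_. j * t) (A (\<lambda>_. t) z) = A (\<lambda>_. Suc j * t) z" by (rule A_add_eq[OF Suc.prems(1)]) simp
  then have "A (\<lambda>_. t) z \<in> stage t e (k + j)"
    using Suc.IH[OF A_space[OF Suc.prems(1)], of "\<lambda>_. t"] Suc.prems(2) by simp
  then show ?case using Suc.prems(1) by simp
qed

text \<open>The vector \<open>(p + 1) * t\<close> has a color \<open>k < p\<close>. In round \<open>k\<close> it is selected, unless a selected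
  vector is near.\<close>

lemma stage_cover:
  assumes e: "\<And>x. x \<in> space X \<Longrightarrow> e x < p" and y: "y \<in> space X"
  shows "\<exists>i\<in>box (2 * t). A i y \<in> stage t e p"
proof -
  define k where "k = e (A (\<lambda>_. Suc p * t) y)"
  have k: "k < p" unfolding k_def by (rule e[OF A_space[OF y]])
  define w where "w = A (\<lambda>_. (p - k) * t) y"
  have w: "w \<in> space X" unfolding w_def by (rule A_space[OF y])
  have "A (\<lambda>_. Suc k * t) w = A (\<lambda>_. Suc p * t) y"
    unfolding w_def
  proof (rule A_add_eq[OF y])
    have "Suc k + (p - k) = Suc p" using k by simp
    then show "Suc k * t + (p - k) * t = Suc p * t" by (metis add_mult_distrib)
  qed
  then have ek: "e (A (\<lambda>_. Suc k * t) w) = k" by (simp add: k_def)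
  show ?thesis
  proof (cases "\<exists>i\<in>box (2 * t). A i w \<in> stage t e k")
    case True
    then obtain i where i: "i \<in> box (2 * t)" "A i w \<in> stage t e k" by blast
    have "A i w = A (\<lambda>_. (p - k) * t) (A i y)" unfolding w_def by (rule A_commute_eq[OF y]) simp
    then have "A i y \<in> stage t e (k + (p - k))" using stage_shift[OF A_space[OF y]] i(2) by simp
    then show ?thesis using i(1) k by auto
  next
    case False
    then have "w \<in> stage t e (Suc k)" using w ek by auto
    moreover have "w = A (\<lambda>_. (p - Suc k) * t) (A (\<lambda>_. t) y)"
      unfolding w_def
    proof (rule A_add_eq[OF y, symmetric])
      have "p - Suc k + 1 = p - k" using k by simp
      then show "(p - Suc k) * t + t = (p - k) * t" by (metis add_mult_distrib mult_1)
    qed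
    ultimately have "A (\<lambda>_. t) y \<in> stage t e (Suc k + (p - Suc k))"
      using stage_shift[OF A_space[OF y], of "p - Suc k" t "\<lambda>_. t" e "Suc k"] by simp
    moreover have "Suc k + (p - Suc k) = p" using k by simp
    moreover have "A (restrict (\<lambda>_. t) R) y = A (\<lambda>_. t) y" by (rule A_cong[OF _ y]) simp
    moreover have "restrict (\<lambda>_. t) R \<in> box (2 * t)" by (rule restrict_box) simp
    ultimately show ?thesis by metis
  qed
qed

text \<open>Applying the \<open>s\<close>-th power of every generator sends the ball of radius \<open>s\<close> about \<open>x\<close> to points
  \<open>A j x\<close> with coordinates of \<open>j\<close> at most \<open>t = 2 * s\<close>. From there a point moves on to the first selected
  vector nearby. Up to the common shift by \<open>p * t\<close>, the vectors reached have coordinates at most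
  \<open>3 * t\<close>, hence lie in \<open>3 ^ card R\<close> blocks of side \<open>t + 1\<close>, and by sparseness each block yields
  only one point.\<close>

theorem borel_witness_exists:
  "\<exists>f. f \<in> X \<rightarrow>\<^sub>M X \<and> witness (3 ^ card R - 1) s f"
proof -
  define t where "t = 2 * s"
  obtain b where b: "\<And>i x. i \<in> box t \<Longrightarrow> x \<in> space X \<Longrightarrow> (x, A i x) \<in> N b"
    using uniform_displacement[OF box_finite[of t]] by blast
  have q: "(A i x, A j x) \<in> N (b + b)" if "i \<in> box t" "j \<in> box t" "x \<in> space X" for i j x
    using ball_trans[OF ball_sym[OF b[OF that(1,3)]] b[OF that(2,3)]] .
  obtain e p where e: "borel_coloring e" "\<And>x. x \<in> space X \<Longrightarrow> e x < p"
    "\<And>x y. (x, y) \<in> N (b + b) \<Longrightarrow> e x = e y \<Longrightarrow> x = y"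
    by (rule finite_borel_coloring[of "b + b"]) blast
  define S where "S = stage t e p"
  have S_sets [measurable]: "S \<in> sets X" unfolding S_def by (rule stage_borel[OF e(1)])
  have sparse: "A (\<lambda>r. m r + p * t) x = A (\<lambda>r. m' r + p * t) x"
    if "x \<in> space X" "\<forall>r\<in>R. m r \<le> m' r + t \<and> m' r \<le> m r + t" "A m x \<in> S" "A m' x \<in> S" for x m m'
    using stage_sparse[where e = e and q = "b + b", OF e(3) q that(1,2)] that(3,4) unfolding S_def by blast
  from finite_list[OF box_finite[of "2 * t"]] obtain bs where bs: "set bs = box (2 * t)" ..
  define idx where "idx y = (LEAST n. n < length bs \<and> A (bs ! n) y \<in> S)" for y
  have idx: "idx y < length bs" "A (bs ! idx y) y \<in> S" if y: "y \<in> space X" for y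
  proof -
    obtain i where i: "i \<in> box (2 * t)" "A i y \<in> S"
      using stage_cover[where e = e and p = p and t = t, OF e(2) y] unfolding S_def by blast
    then have "\<exists>n. n < length bs \<and> A (bs ! n) y \<in> S" using bs by (metis in_set_conv_nth)
    from LeastI_ex[OF this] show "idx y < length bs" "A (bs ! idx y) y \<in> S" unfolding idx_def by blast+
  qed
  have idx_box: "bs ! idx y \<in> box (2 * t)" if "y \<in> space X" for y
    using idx(1)[OF that] bs nth_mem by blast
  note [measurable] = A_measurable
  have idx_meas: "idx \<in> X \<rightarrow>\<^sub>M count_space UNIV" unfolding idx_def by measurable
  define f0 where "f0 y = A (\<lambda>r. (bs ! idx y) r + p * t) y" for y
  have f0_meas: "f0 \<in> X \<rightarrow>\<^sub>M X"
    unfolding f0_def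
    using measurable_compose_countable[OF A_measurable idx_meas, of "\<lambda>n r. (bs ! n) r + p * t"] by simp
  define f where "f y = f0 (A (\<lambda>_. s) y)" for y
  have f_meas: "f \<in> X \<rightarrow>\<^sub>M X"
    unfolding f_def using measurable_compose[OF A_measurable f0_meas] .
  have "witness (3 ^ card R - 1) s f"
    unfolding witness_def
  proof (intro conjI ballI)
    obtain b0 where b0: "\<And>x. x \<in> space X \<Longrightarrow> (x, A (\<lambda>_. s) x) \<in> N b0" using A_displacement by blast
    obtain b1 where b1: "\<And>i x. i \<in> (\<lambda>i r. i r + p * t) ` box (2 * t) \<Longrightarrow> x \<in> space X \<Longrightarrow> (x, A i x) \<in> N b1"
      using uniform_displacement[of "(\<lambda>i r. i r + p * t) ` box (2 * t)"] box_finite by blast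
    have "(x, f x) \<in> N (b0 + b1)" if x: "x \<in> space X" for x
    proof -
      have y: "A (\<lambda>_. s) x \<in> space X" by (rule A_space[OF x])
      have "(A (\<lambda>_. s) x, f x) \<in> N b1"
        unfolding f_def f0_def by (rule b1[OF _ y]) (use idx_box[OF y] in blast)
      then show ?thesis using ball_trans b0[OF x] by blast
    qed
    then show "\<exists>b. \<forall>x\<in>space X. (x, f x) \<in> N b" by blast
    fix x assume x: "x \<in> space X"
    define T where "T = {m. (\<forall>r\<in>R. m r \<le> 3 * t) \<and> A m x \<in> S}"
    define v where "v m = A (\<lambda>r. m r + p * t) x" for m
    define block where "block m = restrict (\<lambda>r. m r div (t + 1)) R" for m :: "'r \<Rightarrow> nat"
    have "f y \<in> v ` T" if y: "(x, y) \<in> N s" for y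
    proof -
      have yX: "y \<in> space X" using ball_sub[OF y] by blast
      obtain a c where ac: "\<forall>r\<in>R. a r \<le> s \<and> c r \<le> s" "A a x = A c y" using ball_meet[OF y] by blast
      define j where "j r = s - c r + a r" for r
      have "A (\<lambda>_. s) y = A (\<lambda>r. s - c r) (A c y)"
        by (rule A_add_eq[OF yX, symmetric]) (use ac(1) in auto)
      also have "\<dots> = A j x" unfolding ac(2)[symmetric] by (rule A_add_eq[OF x]) (simp add: j_def)
      finally have jx: "A (\<lambda>_. s) y = A j x" .
      have jt: "j r \<le> t" if "r \<in> R" for r using ac(1) that unfolding j_def t_def by fastforce
      define i where "i = bs ! idx (A j x)"
      have jX: "A j x \<in> space X" by (rule A_space[OF x])
      have i: "i \<in> box (2 * t)" "A i (A j x) \<in> S" using idx_box[OF jX] idx(2)[OF jX] by (simp_all add: i_def)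
      define m where "m r = i r + j r" for r
      have "A i (A j x) = A m x" by (rule A_add_eq[OF x]) (simp add: m_def)
      moreover have "m r \<le> 3 * t" if "r \<in> R" for r
        using box_le[OF i(1) that] jt[OF that] by (simp add: m_def)
      ultimately have "m \<in> T" using i(2) by (simp add: T_def)
      moreover have "f y = v m"
        unfolding f_def f0_def v_def jx i_def[symmetric] by (rule A_add_eq[OF x]) (simp add: m_def)
      ultimately show ?thesis by blast
    qed
    then have sub1: "f ` (N s `` {x}) \<subseteq> v ` T" by blast
    have same: "v m = v m'" if m: "m \<in> T" "m' \<in> T" "block m = block m'" for m m'
      unfolding v_def
    proof (rule sparse[OF x])
      show "A m x \<in> S" "A m' x \<in> S" using m by (auto simp: T_def)
      show "\<forall>r\<in>R. m r \<le> m' r + t \<and> m' r \<le> m r + t"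
      proof
        fix r assume r: "r \<in> R"
        have "m r div (t + 1) = m' r div (t + 1)"
          using fun_cong[OF m(3), of r] r by (simp add: block_def)
        then show "m r \<le> m' r + t \<and> m' r \<le> m r + t"
          using same_block_close[of "m r" t "m' r"] same_block_close[of "m' r" t "m r"] by simp
      qed
    qed
    have "block m \<in> box 2" if "m \<in> T" for m
      unfolding block_def
    proof (rule restrict_box)
      fix r assume "r \<in> R"
      then have "m r < 3 * (t + 1)" using that by (auto simp: T_def)
      then have "m r div (t + 1) < 3" by (rule less_mult_imp_div_less)
      then show "m r div (t + 1) \<le> 2" by simp
    qed
    then have "v ` T \<subseteq> (\<lambda>\<beta>. v (SOME m. m \<in> T \<and> block m = \<beta>)) ` box 2" (is "_ \<subseteq> ?h ` _")
    proof -
      have "v m = ?h (block m)" if m: "m \<in> T" for m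
      proof -
        have "(SOME m'. m' \<in> T \<and> block m' = block m) \<in> T"
          "block (SOME m'. m' \<in> T \<and> block m' = block m) = block m"
          using someI[of "\<lambda>m'. m' \<in> T \<and> block m' = block m" m] m by blast+
        then show ?thesis using same[OF m] by simp
      qed
      then show ?thesis using \<open>\<And>m. m \<in> T \<Longrightarrow> block m \<in> box 2\<close> by blast
    qed
    with sub1 have sub: "f ` (N s `` {x}) \<subseteq> ?h ` box 2" by blast
    have fin: "finite (?h ` box 2)" using box_finite by simp
    show "finite (f ` (N s `` {x}))" using finite_subset[OF sub fin] .
    have "card (f ` (N s `` {x})) \<le> card (?h ` box 2)" by (rule card_mono[OF fin sub])
    also have "\<dots> \<le> card (box 2)" by (rule card_image_le[OF box_finite])
    also have "\<dots> = 3 ^ card R" by (simp add: box_card)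
    finally show "card (f ` (N s `` {x})) \<le> 3 ^ card R - 1 + 1" by simp
  qed
  then show ?thesis using f_meas by blast
qed

end


section \<open>Schreier graphs of commutative monoids\<close>

locale commutative_schreier = borel_monoid_set M act X + comm_monoid M
  for M :: "('m, 'b) monoid_scheme" (structure) and act :: "'m \<Rightarrow> 'x \<Rightarrow> 'x" and X :: "'x measure" +
  fixes R :: "'m set"
  assumes generators: "finitely_generates M R"
    and fibers: "bounded_to_one M act X"
begin

definition E :: "'x rel" where
  "E = schreier_graph R act (space X)"

definition N :: "nat \<Rightarrow> 'x rel" where
  "N k = {(x, y) \<in> space X \<times> space X. path_dist E x y \<le> enat k}"

definition grow :: "'x set \<Rightarrow> 'x set" where
  "grow B = B \<union> (\<Union>r\<in>R. act r ` B \<union> (act r -` B \<inter> space X))"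

definition A :: "('m \<Rightarrow> nat) \<Rightarrow> 'x \<Rightarrow> 'x" where
  "A i = act (finprod M (\<lambda>r. r [^] i r) R)"

lemma R: "finite R" "R \<subseteq> carrier M"
  using generators by (auto simp: finitely_generates_def)

lemma N_iff: "(x, y) \<in> N k \<longleftrightarrow> x \<in> space X \<and> y \<in> space X \<and> (\<exists>j\<le>k. (x, y) \<in> E ^^ j)"
  by (auto simp: N_def path_dist_le_iff)

lemma E_space: "(x, y) \<in> E \<Longrightarrow> x \<in> space X \<and> y \<in> space X"
  by (auto simp: E_def schreier_graph_def)

lemma ball_relations_N: "ball_relations (space X) N"
proof
  show "(x, y) \<in> N k \<Longrightarrow> x \<in> space X \<and> y \<in> space X" for x y k by (simp add: N_iff)
  show "x \<in> space X \<Longrightarrow> (x, x) \<in> N k" for x k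
    unfolding N_iff by (auto intro!: exI[of _ 0])
  show "(y, x) \<in> N k" if "(x, y) \<in> N k" for x y k
    using that relpow_sym[OF schreier_sym] unfolding N_iff E_def by blast
  show "(x, z) \<in> N (a + b)" if xyz: "(x, y) \<in> N a" "(y, z) \<in> N b" for x y z a b
  proof -
    obtain i where i: "i \<le> a" "(x, y) \<in> E ^^ i" "x \<in> space X"
      using xyz(1) unfolding N_iff by blast
    obtain j where j: "j \<le> b" "(y, z) \<in> E ^^ j" "z \<in> space X"
      using xyz(2) unfolding N_iff by blast
    have "(x, z) \<in> E ^^ (i + j)" using relcompI[OF i(2) j(2)] by (simp add: relpow_add)
    moreover have "i + j \<le> a + b" using i(1) j(1) by simp
    ultimately show ?thesis using i(3) j(3) unfolding N_iff by blast
  qed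
  show "(x, y) \<in> N b" if "a \<le> b" "(x, y) \<in> N a" for a b x y
    using that(2) le_trans[OF _ that(1)] unfolding N_iff by blast
qed

lemma act_in: "r \<in> R \<Longrightarrow> x \<in> space X \<Longrightarrow> act r x \<in> space X"
  using act_space R(2) by blast

lemma N_zero: "B \<subseteq> space X \<Longrightarrow> N 0 `` B = B"
  by (auto simp: N_iff Image_iff)

lemma N_Suc:
  assumes B: "B \<subseteq> space X"
  shows "N (Suc k) `` B = grow (N k `` B)"
proof (intro equalityI subsetI)
  fix y assume "y \<in> N (Suc k) `` B"
  then obtain x j where x: "x \<in> B" "x \<in> space X" "y \<in> space X" "j \<le> Suc k" "(x, y) \<in> E ^^ j"
    unfolding N_iff Image_iff by blast
  show "y \<in> grow (N k `` B)"
  proof (cases "j \<le> k")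
    case True
    then have "(x, y) \<in> N k" using x unfolding N_iff by blast
    then show ?thesis using x(1) unfolding grow_def by blast
  next
    case False
    then have "j = Suc k" using x by simp
    then obtain z where z: "(x, z) \<in> E ^^ k" "(z, y) \<in> E" using x(5) by auto
    have zN: "(x, z) \<in> N k" using z x E_space unfolding N_iff by blast
    obtain r where "r \<in> R" "y = act r z \<or> z = act r y"
      using z(2) by (auto simp: E_def schreier_graph_def)
    then show ?thesis using zN x unfolding grow_def by blast
  qed
next
  fix y assume y: "y \<in> grow (N k `` B)"
  have edge: "(x, y) \<in> N (Suc k)" if z: "(x, z) \<in> N k" "y \<in> space X" "r \<in> R" "y = act r z \<or> z = act r y" for x z r
  proof -
    obtain j where j: "j \<le> k" "(x, z) \<in> E ^^ j" "x \<in> space X" "z \<in> space X" using z(1) unfolding N_iff by blast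
    show ?thesis
    proof (cases "z = y")
      case True
      then show ?thesis using j unfolding N_iff by (meson le_SucI)
    next
      case False
      then have "(z, y) \<in> E" using z j by (auto simp: E_def schreier_graph_def)
      then have "(x, y) \<in> E ^^ Suc j" using j by auto
      then show ?thesis using j z(2) unfolding N_iff by (meson Suc_le_mono)
    qed
  qed
  from y consider x where "x \<in> B" "(x, y) \<in> N k"
    | x z r where "x \<in> B" "(x, z) \<in> N k" "r \<in> R" "y = act r z"
    | x r where "x \<in> B" "(x, act r y) \<in> N k" "r \<in> R" "y \<in> space X"
    unfolding grow_def by blast
  then show "y \<in> N (Suc k) `` B"
  proof cases
    case 1
    then have "(x, y) \<in> N (Suc k)" unfolding N_iff by (meson le_SucI)
    then show ?thesis using 1(1) by blast
  next
    case 2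
    have "z \<in> space X" using 2(2) by (simp add: N_iff)
    then have "(x, y) \<in> N (Suc k)" using edge[of x z r] 2 act_in by blast
    then show ?thesis using 2(1) by blast
  next
    case 3
    then have "(x, y) \<in> N (Suc k)" using edge[of x "act r y" r] by blast
    then show ?thesis using 3(1) by blast
  qed
qed

lemma grow_bounded: "\<exists>c. \<forall>F. finite F \<longrightarrow> F \<subseteq> space X \<longrightarrow> finite (grow F) \<and> card (grow F) \<le> c * card F"
proof -
  have "\<forall>r\<in>R. \<exists>k. \<forall>y\<in>space X. finite {x \<in> space X. act r x = y} \<and> card {x \<in> space X. act r x = y} \<le> k"
    using fibers R(2) unfolding bounded_to_one_def by blast
  then obtain k where k: "\<And>r y. r \<in> R \<Longrightarrow> y \<in> space X \<Longrightarrow>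
      finite {x \<in> space X. act r x = y} \<and> card {x \<in> space X. act r x = y} \<le> k r" by metis
  have "finite (grow F) \<and> card (grow F) \<le> (1 + (\<Sum>r\<in>R. 1 + k r)) * card F"
    if F: "finite F" "F \<subseteq> space X" for F
  proof -
    define G where "G r = act r ` F \<union> (act r -` F \<inter> space X)" for r
    have G: "finite (G r) \<and> card (G r) \<le> (1 + k r) * card F" if r: "r \<in> R" for r
    proof -
      have eq: "act r -` F \<inter> space X = (\<Union>y\<in>F. {x \<in> space X. act r x = y})" by blast
      have fin: "finite (act r -` F \<inter> space X)" unfolding eq using F k[OF r] by blast
      have "card (act r -` F \<inter> space X) \<le> (\<Sum>y\<in>F. card {x \<in> space X. act r x = y})"
        unfolding eq by (rule card_UN_le[OF F(1)])
      also have "\<dots> \<le> (\<Sum>y\<in>F. k r)" using k[OF r] F(2) by (intro sum_mono) blast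
      also have "\<dots> = k r * card F" by simp
      finally have "card (act r -` F \<inter> space X) \<le> k r * card F" .
      moreover have "card (act r ` F) \<le> card F" by (rule card_image_le[OF F(1)])
      moreover have "card (G r) \<le> card (act r ` F) + card (act r -` F \<inter> space X)"
        unfolding G_def by (rule card_Un_le)
      ultimately show ?thesis using F(1) fin by (auto simp: G_def)
    qed
    have grow: "grow F = F \<union> (\<Union>r\<in>R. G r)" by (simp add: grow_def G_def)
    have "card (\<Union>r\<in>R. G r) \<le> (\<Sum>r\<in>R. card (G r))" by (rule card_UN_le[OF R(1)])
    also have "\<dots> \<le> (\<Sum>r\<in>R. (1 + k r) * card F)" using G by (intro sum_mono) blast
    also have "\<dots> = (\<Sum>r\<in>R. 1 + k r) * card F" by (simp only: sum_distrib_right)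
    finally have le: "card (\<Union>r\<in>R. G r) \<le> (\<Sum>r\<in>R. 1 + k r) * card F" .
    have "card (grow F) \<le> card F + card (\<Union>r\<in>R. G r)" unfolding grow by (rule card_Un_le)
    also have "\<dots> \<le> card F + (\<Sum>r\<in>R. 1 + k r) * card F" using le by (rule add_left_mono)
    also have "\<dots> = (1 + (\<Sum>r\<in>R. 1 + k r)) * card F" by (simp only: add_mult_distrib mult_1)
    finally show ?thesis using F(1) R(1) G unfolding grow by blast
  qed
  then show ?thesis by blast
qed

lemma N_finite: "\<exists>K. \<forall>x\<in>space X. finite (N k `` {x}) \<and> card (N k `` {x}) \<le> K"
proof (induction k)
  case 0
  then show ?case by (intro exI[of _ 1]) (simp add: N_zero)
next
  case (Suc k)
  then obtain K where K: "\<And>x. x \<in> space X \<Longrightarrow> finite (N k `` {x}) \<and> card (N k `` {x}) \<le> K" by blast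
  obtain c where c: "\<And>F. finite F \<Longrightarrow> F \<subseteq> space X \<Longrightarrow> finite (grow F) \<and> card (grow F) \<le> c * card F"
    using grow_bounded by blast
  have "finite (N (Suc k) `` {x}) \<and> card (N (Suc k) `` {x}) \<le> c * K" if x: "x \<in> space X" for x
  proof -
    have "N k `` {x} \<subseteq> space X" unfolding N_iff Image_def by blast
    then have g: "finite (grow (N k `` {x}))" "card (grow (N k `` {x})) \<le> c * card (N k `` {x})"
      using c K[OF x] by blast+
    have "c * card (N k `` {x}) \<le> c * K" using K[OF x] mult_le_mono2 by blast
    moreover have "N (Suc k) `` {x} = grow (N k `` {x})" using x by (intro N_Suc) simp
    ultimately show ?thesis using g by (metis order_trans)
  qed
  then show ?case by blast
qed

text \<open>Neighbourhoods are built from preimages and images under the generators; that the images are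
  Borel is where boundedness of the fibers is needed.\<close>

lemma ex_borel_balls: "\<exists>U. borel_balls X N U"
proof -
  obtain V P where VP: "standard_space X V P"
    using standard_borel_imp_standard_space[OF standard_borel] by blast
  interpret S: standard_space X V P by (rule VP)
  have grow_borel: "grow B \<in> sets X" if B: "B \<in> sets X" for B
  proof -
    have "act r ` B \<in> sets X" "act r -` B \<inter> space X \<in> sets X" if r: "r \<in> R" for r
    proof -
      have meas: "act r \<in> X \<rightarrow>\<^sub>M X" using act_measurable R(2) r by blast
      then show "act r -` B \<inter> space X \<in> sets X" using B by (rule measurable_sets)
      obtain k where k: "\<And>y. y \<in> space X \<Longrightarrow>
          finite {x \<in> space X. act r x = y} \<and> card {x \<in> space X. act r x = y} \<le> k"
        using fibers R(2) r unfolding bounded_to_one_def by blast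
      show "act r ` B \<in> sets X"
      proof (rule S.bounded_to_one_image_borel[OF meas B])
        fix y assume y: "y \<in> space X"
        have sub: "{x \<in> B. act r x = y} \<subseteq> {x \<in> space X. act r x = y}"
          using sets.sets_into_space[OF B] by blast
        show "finite {x \<in> B. act r x = y} \<and> card {x \<in> B. act r x = y} \<le> k"
          using k[OF y] finite_subset[OF sub] card_mono[OF _ sub] by fastforce
      qed
    qed
    then show ?thesis unfolding grow_def using B R(1) by (intro sets.Un sets.finite_UN) auto
  qed
  have N_borel: "N k `` B \<in> sets X" if B: "B \<in> sets X" for k B
  proof (induction k)
    case 0
    show ?case using N_zero[OF sets.sets_into_space[OF B]] B by simp
  next
    case (Suc k)
    then show ?case using N_Suc[OF sets.sets_into_space[OF B]] grow_borel by simp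
  qed
  interpret ball_relations "space X" N by (rule ball_relations_N)
  have "borel_balls X N V"
    by unfold_locales (use N_borel N_finite S.V_sets S.isolating in blast)+
  then show ?thesis by blast
qed

lemma exponent_closed: "finprod M (\<lambda>r. r [^] (i r :: nat)) R \<in> carrier M"
  using R(2) by (intro finprod_closed) auto

lemma A_in: "x \<in> space X \<Longrightarrow> A i x \<in> space X"
  unfolding A_def by (rule act_space[OF exponent_closed])

lemma A_zero: "x \<in> space X \<Longrightarrow> A (\<lambda>_. 0) x = x"
  unfolding A_def by (simp add: act_one)

lemma A_add: "x \<in> space X \<Longrightarrow> A i (A j x) = A (\<lambda>r. i r + j r) x"
proof -
  assume x: "x \<in> space X"
  have "finprod M (\<lambda>r. r [^] (i r + j r)) R = finprod M (\<lambda>r. r [^] i r \<otimes> r [^] j r) R"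
    using R(2) by (intro finprod_cong') (auto simp: nat_pow_mult)
  also have "\<dots> = finprod M (\<lambda>r. r [^] i r) R \<otimes> finprod M (\<lambda>r. r [^] j r) R"
    using R(2) by (intro finprod_multf) auto
  finally show ?thesis unfolding A_def using act_mult[OF exponent_closed exponent_closed x] by simp
qed

lemma A_cong: "\<lbrakk>\<And>r. r \<in> R \<Longrightarrow> i r = j r\<rbrakk> \<Longrightarrow> A i x = A j x"
proof -
  assume eq: "\<And>r. r \<in> R \<Longrightarrow> i r = j r"
  have "finprod M (\<lambda>r. r [^] i r) R = finprod M (\<lambda>r. r [^] j r) R"
    using R(2) eq by (intro finprod_cong') auto
  then show ?thesis by (simp add: A_def)
qed

lemma A_generator:
  assumes "r \<in> R"
  shows "A (\<lambda>t. if t = r then 1 else 0) x = act r x"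
proof -
  have "finprod M (\<lambda>t. t [^] (if t = r then 1 else 0 :: nat)) R = finprod M (\<lambda>t. if r = t then t else \<one>) R"
    using R(2) by (intro finprod_cong') auto
  also have "\<dots> = r" using finprod_singleton[OF assms R(1), of "\<lambda>t. t"] R(2) by auto
  finally show ?thesis by (simp add: A_def)
qed

text \<open>Each step of a path multiplies one of the two sides by a generator, and commutativity allows
  this multiplication to be done last.\<close>

lemma common_multiple:
  "(x, y) \<in> E ^^ k \<Longrightarrow> x \<in> space X \<Longrightarrow> \<exists>a b. (\<forall>r\<in>R. a r \<le> k \<and> b r \<le> k) \<and> A a x = A b y"
proof (induction k arbitrary: y)
  case 0
  then show ?case by (intro exI[of _ "\<lambda>_. 0"]) auto
next
  case (Suc k)
  then obtain z where z: "(x, z) \<in> E ^^ k" "(z, y) \<in> E" by auto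
  have zy: "z \<in> space X" "y \<in> space X" using E_space[OF z(2)] by auto
  obtain a b where ab: "\<forall>r\<in>R. a r \<le> k \<and> b r \<le> k" "A a x = A b z"
    using Suc.IH[OF z(1) Suc.prems(2)] by blast
  obtain r where r: "r \<in> R" "y = act r z \<or> z = act r y"
    using z(2) by (auto simp: E_def schreier_graph_def)
  define u where "u t = (if t = r then 1 else 0 :: nat)" for t
  have u: "A u w = act r w" for w unfolding u_def by (rule A_generator[OF r(1)])
  have bounds: "\<forall>t\<in>R. u t + a t \<le> Suc k \<and> b t \<le> Suc k" "\<forall>t\<in>R. a t \<le> Suc k \<and> b t + u t \<le> Suc k"
    using ab(1) by (auto simp: u_def le_SucI)
  have pair: ?case if "\<forall>t\<in>R. a' t \<le> Suc k \<and> b' t \<le> Suc k" "A a' x = A b' y" for a' b'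
    using that by blast
  from r(2) show ?case
  proof
    assume y: "y = act r z"
    have "A (\<lambda>t. u t + a t) x = A u (A b z)" using A_add[OF Suc.prems(2), of u a] ab(2) by metis
    also have "\<dots> = A (\<lambda>t. b t + u t) z" using A_add[OF zy(1), of u b] by (simp only: add.commute)
    also have "\<dots> = A b y" using A_add[OF zy(1), of b u] u[of z] y by metis
    finally have "A (\<lambda>t. u t + a t) x = A b y" .
    with bounds(1) show ?thesis by (rule pair)
  next
    assume z': "z = act r y"
    have "A a x = A (\<lambda>t. b t + u t) y" using ab(2) A_add[OF zy(2), of b u] u[of y] z' by metis
    with bounds(2) show ?thesis by (rule pair)
  qed
qed

lemma A_displacement: "\<exists>b. \<forall>x\<in>space X. (x, A i x) \<in> N b"
proof -
  obtain n where "\<forall>x\<in>space X. \<exists>k\<le>n. (x, A i x) \<in> E ^^ k"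
    using act_bounded_displacement[OF generators exponent_closed] unfolding E_def A_def by blast
  then have "\<forall>x\<in>space X. (x, A i x) \<in> N n" using A_in unfolding N_iff by blast
  then show ?thesis ..
qed

lemma ex_commuting_action: "\<exists>U. commuting_action X N U R A"
proof -
  obtain U where U: "borel_balls X N U" using ex_borel_balls by blast
  interpret borel_balls X N U by (rule U)
  have "commuting_action X N U R A"
  proof
    show "finite R" by (rule R(1))
    show "A i \<in> X \<rightarrow>\<^sub>M X" for i unfolding A_def by (rule act_measurable[OF exponent_closed])
    show "x \<in> space X \<Longrightarrow> A (\<lambda>_. 0) x = x" for x by (rule A_zero)
    show "x \<in> space X \<Longrightarrow> A i (A j x) = A (\<lambda>r. i r + j r) x" for x i j by (rule A_add)
    show "A i x = A j x" if "\<And>r. r \<in> R \<Longrightarrow> i r = j r" for i j x using that by (rule A_cong)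
    show "\<exists>b. \<forall>x\<in>space X. (x, A i x) \<in> N b" for i by (rule A_displacement)
    fix x y s assume xy: "(x, y) \<in> N s"
    then obtain j where j: "j \<le> s" "(x, y) \<in> E ^^ j" "x \<in> space X" unfolding N_iff by blast
    obtain a b where "\<forall>r\<in>R. a r \<le> j \<and> b r \<le> j" "A a x = A b y"
      using common_multiple[OF j(2,3)] by blast
    then show "\<exists>a b. (\<forall>r\<in>R. a r \<le> s \<and> b r \<le> s) \<and> A a x = A b y"
      using j(1) by (meson order_trans)
  qed
  then show ?thesis by blast
qed

lemma uncolored_witness_iff:
  "uncolored_witness (space X) E d s f \<longleftrightarrow> ball_relations.witness (space X) N d s f"
proof -
  interpret ball_relations "space X" N by (rule ball_relations_N)
  have ball: "graph_ball (space X) E x s = N s `` {x}" if "x \<in> space X" for x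
    using that by (auto simp: graph_ball_def N_def)
  have disp: "(f \<in> space X \<rightarrow> space X \<and> (SUP x\<in>space X. path_dist E x (f x)) < \<infinity>) \<longleftrightarrow>
      (\<exists>b. \<forall>x\<in>space X. (x, f x) \<in> N b)"
    unfolding SUP_enat_finite_iff by (auto simp: N_def)
  have "uncolored_witness (space X) E d s f \<longleftrightarrow>
      (f \<in> space X \<rightarrow> space X \<and> (SUP x\<in>space X. path_dist E x (f x)) < \<infinity>) \<and>
      (\<forall>x\<in>space X. finite (f ` (N s `` {x})) \<and> card (f ` (N s `` {x})) \<le> d + 1)"
    unfolding uncolored_witness_def using ball by simp
  then show ?thesis unfolding disp witness_def .
qed

theorem borel_asdim_eq_asdim: "borel_asdim X E = asdim (space X) E"
proof -
  obtain U where U: "commuting_action X N U R A" using ex_commuting_action by blast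
  interpret commuting_action X N U R A by (rule U)
  have "\<exists>f. f \<in> X \<rightarrow>\<^sub>M X \<and> witness d s f" if "\<forall>s. \<exists>f. witness d s f" for d s
    by (rule borel_witness_of_witness[OF _ borel_witness_exists]) (use that in blast)
  then have "(\<forall>s. \<exists>f. f \<in> X \<rightarrow>\<^sub>M X \<and> witness d s f) \<longleftrightarrow> (\<forall>s. \<exists>f. witness d s f)" for d by blast
  then show ?thesis unfolding borel_asdim_def asdim_def uncolored_witness_iff by presburger
qed

end

theorem corollary5p16:
  fixes M :: "('m, 'b) monoid_scheme" and act :: "'m \<Rightarrow> 'x \<Rightarrow> 'x" and X :: "'x measure"
  assumes "comm_monoid M" and "finitely_generated M"
    and "borel_monoid_set M act X" and "bounded_to_one M act X"
  shows "borel_asdim_action M act X = asdim_action M act X"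
proof -
  obtain R where gen: "finitely_generates M R" using assms(2) by (auto simp: finitely_generated_def)
  interpret comm_monoid M by (rule assms(1))
  interpret borel_monoid_set M act X by (rule assms(3))
  interpret commutative_schreier M act X R by unfold_locales (rule gen, rule assms(4))
  show ?thesis
    using borel_asdim_eq_asdim asdim_action_eq[OF gen] borel_asdim_action_eq[OF gen] by (simp add: E_def)
qed

end
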